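(* Let $(M,\Omega)$ be a symplectic manifold. With respect to the bracket $[\alpha,\beta]=(\alpha,\beta)+[\![\alpha,\beta]\!]$ and the symmetric product $\odot$, the subspace $$\widehat{\mathsf H}(M)=\{\alpha\in\widehat{\mathsf S}(M):\alpha_1=-\delta^*\alpha_0\}$$ is a Poisson subalgebra of $(\widehat{\mathsf S}(M),[\cdot,\cdot])$. For $k\ge0$, let $\widehat{\mathsf H}_k(M)=\{\alpha\in\widehat{\mathsf H}(M):\alpha_i=0\text{ if }i<k\}$ (so $\widehat{\mathsf H}_k(M)=\widehat{\mathsf S}_k(M)$ for $k\ge2$). For $k\ge0$ and $l\ge2$, $[\widehat{\mathsf H}_k(M),\widehat{\mathsf H}_l(M)]\subset\widehat{\mathsf H}_{k+l-2}(M)$. In particular, for $k\ge2$, $(\widehat{\mathsf H}_k(M),[\cdot,\cdot],\odot)$ is a Poisson ideal in $(\widehat{\mathsf H}(M),[\cdot,\cdot],\odot)$. Define $\pi:\widehat{\mathsf H}(M)\to C^\infty(M)$ by $\pi(\alpha)=-\alpha_0$. The sequence $$\{0\}\to(\widehat{\mathsf H}_2(M),[\cdot,\cdot],\odot)\to(\widehat{\mathsf H}(M),[\cdot,\cdot],\odot)\xrightarrow{\ \pi\ }(C^\infty(M),\{\cdot,\cdot\})\to\{0\}$$ of Poisson algebras is exact, and $\iota:(C^\infty(M),\{\cdot,\cdot\})\to(\widehat{\mathsf H}(M),[\cdot,\cdot])$ defined by $\iota(f)=-f+\delta^*f$ is an injective Lie algebra homomorphism such that $\pi\circ\iota$ is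 the identity. That is, the sequence splits and $\widehat{\mathsf H}(M)$ is the semidirect product of the Lie subalgebra $$\mathsf h(M)=\iota(C^\infty(M))=\{\alpha\in\widehat{\mathsf S}(M):\alpha_1=-\delta^*\alpha_0,\ \alpha_i=0\text{ for }i\ge2\}$$ and the Poisson ideal $\widehat{\mathsf H}_2(M)$.
   Context: Abstract indices and the summation convention are used; parentheses around indices denote complete symmetrization. $\Omega^{ij}$ is defined by $\Omega^{ip}\Omega_{pj}=-\delta_j{}^i$; indices are raised and lowered by $X^i=\Omega^{ip}X_p$, $X_i=X^p\Omega_{pi}$, keeping horizontal position. $\mathsf S^k(M)=\Gamma(S^k(T^*M))$ (with $\mathsf S^0(M)=C^\infty(M)$), $\widehat{\mathsf S}(M)=\prod_{k\ge0}\mathsf S^k(M)$, and $\widehat{\mathsf S}_k(M)=\prod_{i\ge k}\mathsf S^i(M)$; $\alpha_k$ denotes the component of $\alpha\in\widehat{\mathsf S}(M)$ in $\mathsf S^k(M)$. Symmetric product: $(\alpha\odot\beta)_{i_1\dots i_{k+l}}=\alpha_{(i_1\dots i_k}\beta_{i_{k+1}\dots i_{k+l})}$. On functions, $\delta^*f=-df$. Poisson bracket on $C^\infty(M)$: $H_f^i=\Omega^{pi}df_p$, $\{f,g\}=\Omega(H_f,H_g)$. For $\alpha\in\mathsf S^k(M)$, $\beta\in\mathsf S^l(M)$: the algebraic bracket is $(\alpha,\beta)_{i_1\dots i_{k+l-2}}=kl\,\alpha_{p(i_1\dots i_{k-1}}\beta_{i_k\dots i_{k+l-2})}{}^p$ (zero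 if $k=0$ or $l=0$); the Schouten bracket is $[\![\alpha,\beta]\!]_{i_1\dots i_{k+l-1}}=-k\alpha_{p(i_1\dots i_{k-1}}\nabla^p\beta_{i_k\dots i_{k+l-1})}+l\beta_{p(i_1\dots i_{l-1}}\nabla^p\alpha_{i_l\dots i_{k+l-1})}$, where $\nabla$ is any torsion-free affine connection with $\nabla\Omega=0$ (the result is independent of the choice). Both extend to $\widehat{\mathsf S}(M)$ by bilinearity over components; each is a Lie bracket forming with $\odot$ a Poisson structure, and the two are compatible, so their sum $[\cdot,\cdot]$ is also a Lie bracket. A Poisson subalgebra (ideal) is a subspace that is a subalgebra (ideal) for both the Lie bracket and the product.
   Formalization: With the usual product of functions π is not multiplicative (if α_0=β_0=1, π(α⊙β)=−1 but π(α)π(β)=1); what is proved is that π is a Lie homomorphism with π(α⊙β)=−π(α)π(β), i.e. Poisson for the product −fg on C^∞(M). M has positive dimension. *)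

theory Defs
  imports "HOL-Analysis.Analysis" "HOL-Library.Function_Algebras" "HOL-Combinatorics.Permutations"
begin

section \<open>Subalgebras, ideals and homomorphisms\<close>

text \<open>Function spaces carry the pointwise operations, so that tensor fields and graded sequences
  of them live in real vector spaces (addition and multiplication come from
  Function_Algebras). The algebras below are subsets of such types.\<close>

instantiation "fun" :: (type, real_vector) real_vector
begin

definition scaleR_fun :: "real \<Rightarrow> ('a \<Rightarrow> 'b) \<Rightarrow> 'a \<Rightarrow> 'b"
  where "scaleR_fun r f = (\<lambda>x. r *\<^sub>R f x)"

instance
  by standard (simp_all add: scaleR_fun_def fun_eq_iff algebra_simps)

end

definition lie_subalgebra :: "'v::real_vector set \<Rightarrow> ('v \<Rightarrow> 'v \<Rightarrow> 'v) \<Rightarrow> 'v set \<Rightarrow> bool"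
  where "lie_subalgebra A br H \<longleftrightarrow>
    subspace H \<and> H \<subseteq> A \<and> (\<forall>x\<in>H. \<forall>y\<in>H. br x y \<in> H)"

definition lie_ideal :: "'v::real_vector set \<Rightarrow> ('v \<Rightarrow> 'v \<Rightarrow> 'v) \<Rightarrow> 'v set \<Rightarrow> bool"
  where "lie_ideal A br I \<longleftrightarrow>
    subspace I \<and> I \<subseteq> A \<and> (\<forall>x\<in>A. \<forall>y\<in>I. br x y \<in> I \<and> br y x \<in> I)"

definition poisson_subalgebra ::
    "'v::real_vector set \<Rightarrow> ('v \<Rightarrow> 'v \<Rightarrow> 'v) \<Rightarrow> ('v \<Rightarrow> 'v \<Rightarrow> 'v) \<Rightarrow> 'v set \<Rightarrow> bool"
  where "poisson_subalgebra A br pr H \<longleftrightarrow>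
    lie_subalgebra A br H \<and> (\<forall>x\<in>H. \<forall>y\<in>H. pr x y \<in> H)"

definition poisson_ideal ::
    "'v::real_vector set \<Rightarrow> ('v \<Rightarrow> 'v \<Rightarrow> 'v) \<Rightarrow> ('v \<Rightarrow> 'v \<Rightarrow> 'v) \<Rightarrow> 'v set \<Rightarrow> bool"
  where "poisson_ideal A br pr I \<longleftrightarrow>
    lie_ideal A br I \<and> (\<forall>x\<in>A. \<forall>y\<in>I. pr x y \<in> I \<and> pr y x \<in> I)"

definition lie_hom ::
    "'v::real_vector set \<Rightarrow> ('v \<Rightarrow> 'v \<Rightarrow> 'v) \<Rightarrow> 'w::real_vector set \<Rightarrow> ('w \<Rightarrow> 'w \<Rightarrow> 'w) \<Rightarrow>
      ('v \<Rightarrow> 'w) \<Rightarrow> bool"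
  where "lie_hom A brA B brB f \<longleftrightarrow>
    f ` A \<subseteq> B \<and>
    (\<forall>x\<in>A. \<forall>y\<in>A. f (x + y) = f x + f y) \<and>
    (\<forall>r. \<forall>x\<in>A. f (r *\<^sub>R x) = r *\<^sub>R f x) \<and>
    (\<forall>x\<in>A. \<forall>y\<in>A. f (brA x y) = brB (f x) (f y))"

definition short_exact ::
    "'u::zero set \<Rightarrow> ('u \<Rightarrow> 'v) \<Rightarrow> 'v::zero set \<Rightarrow> ('v \<Rightarrow> 'w) \<Rightarrow> 'w::zero set \<Rightarrow> bool"
  where "short_exact A f B g C \<longleftrightarrow>
    inj_on f A \<and> f ` A = {b \<in> B. g b = 0} \<and> g ` B = C"

definition lie_semidirect ::
    "'v::real_vector set \<Rightarrow> ('v \<Rightarrow> 'v \<Rightarrow> 'v) \<Rightarrow> 'v set \<Rightarrow> 'v set \<Rightarrow> bool"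
  where "lie_semidirect A br H I \<longleftrightarrow>
    lie_subalgebra A br H \<and> lie_ideal A br I \<and> H \<inter> I = {0} \<and> A = {x + y |x y. x \<in> H \<and> y \<in> I}"

section \<open>Smooth manifolds\<close>

primrec Ck_on :: "nat \<Rightarrow> (real ^ 'n::finite) set \<Rightarrow> (real ^ 'n \<Rightarrow> real) \<Rightarrow> bool"
  where
    "Ck_on 0 S f \<longleftrightarrow> continuous_on S f"
  | "Ck_on (Suc k) S f \<longleftrightarrow> f differentiable_on S \<and>
       (\<forall>i. Ck_on k S (\<lambda>x. frechet_derivative f (at x) (axis i 1)))"

text \<open>Used for open \<open>S\<close> only.\<close>

definition smooth_on :: "(real ^ 'n::finite) set \<Rightarrow> (real ^ 'n \<Rightarrow> real) \<Rightarrow> bool"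
  where "smooth_on S f \<longleftrightarrow> (\<forall>k. Ck_on k S f)"

text \<open>A chart is a pair of a domain and a coordinate map; the values of the coordinate map
  off the domain are irrelevant.\<close>

type_synonym ('a, 'n) chart = "'a set \<times> ('a \<Rightarrow> real ^ 'n)"

definition coord_image :: "('a, 'n::finite) chart \<Rightarrow> (real ^ 'n) set"
  where "coord_image c = snd c ` fst c"

definition in_coords :: "('a, 'n::finite) chart \<Rightarrow> ('a \<Rightarrow> real) \<Rightarrow> real ^ 'n \<Rightarrow> real"
  where "in_coords c f = (\<lambda>x. f (inv_into (fst c) (snd c) x))"

definition smooth_manifold :: "'a topology \<Rightarrow> ('a, 'n::finite) chart set \<Rightarrow> bool"
  where "smooth_manifold M A \<longleftrightarrow>
    Hausdorff_space M \<and> second_countable M \<and>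
    topspace M = \<Union> (fst ` A) \<and>
    (\<forall>c\<in>A. openin M (fst c) \<and> open (coord_image c) \<and>
       homeomorphic_map (subtopology M (fst c)) (top_of_set (coord_image c)) (snd c)) \<and>
    (\<forall>c\<in>A. \<forall>c'\<in>A. \<forall>i.
       smooth_on (snd c ` (fst c \<inter> fst c')) (in_coords c (\<lambda>p. snd c' p $ i)))"

text \<open>Functions on the manifold are extended by zero off the carrier.\<close>

definition Cinf :: "('a, 'n::finite) chart set \<Rightarrow> ('a \<Rightarrow> real) set"
  where "Cinf A = {f. (\<forall>p. p \<notin> \<Union> (fst ` A) \<longrightarrow> f p = 0) \<and>
    (\<forall>c\<in>A. smooth_on (coord_image c) (in_coords c f))}"

text \<open>\<open>pd c i f p\<close> is the partial derivative of \<open>f\<close> in the \<open>i\<close>-th coordinate of the chart \<open>c\<close>.\<close>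

definition pd :: "('a, 'n::finite) chart \<Rightarrow> 'n \<Rightarrow> ('a \<Rightarrow> real) \<Rightarrow> 'a \<Rightarrow> real"
  where "pd c i f p = frechet_derivative (in_coords c f) (at (snd c p)) (axis i 1)"

text \<open>With \<open>x\<close> the coordinates of \<open>c\<close> and \<open>y\<close> those of \<open>c'\<close>, \<open>jac c c' j i p\<close> is
  the derivative of \<open>x\<^sup>j\<close> with respect to \<open>y\<^sup>i\<close>.\<close>

definition jac :: "('a, 'n::finite) chart \<Rightarrow> ('a, 'n) chart \<Rightarrow> 'n \<Rightarrow> 'n \<Rightarrow> 'a \<Rightarrow> real"
  where "jac c c' j i p = pd c' i (\<lambda>q. snd c q $ j) p"

section \<open>Covariant tensor fields\<close>

text \<open>A covariant tensor field of rank \<open>k\<close> is given classically, by its components in every chart: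
  \<open>\<alpha> c p [i\<^sub>1, \<dots>, i\<^sub>k]\<close> is the component of \<open>\<alpha>\<close> at the point \<open>p\<close> in the chart \<open>c\<close>. Components
  transform tensorially and are zero outside their range of meaning, so that equality of
  tensor fields is equality of functions.\<close>

type_synonym ('a, 'n) tfield = "('a, 'n) chart \<Rightarrow> 'a \<Rightarrow> 'n list \<Rightarrow> real"

definition tensor_fields :: "('a, 'n::finite) chart set \<Rightarrow> nat \<Rightarrow> ('a, 'n) tfield set"
  where "tensor_fields A k = {\<alpha>.
    (\<forall>c p I. \<not> (c \<in> A \<and> p \<in> fst c \<and> length I = k) \<longrightarrow> \<alpha> c p I = 0) \<and>
    (\<forall>c\<in>A. \<forall>I. smooth_on (coord_image c) (in_coords c (\<lambda>p. \<alpha> c p I))) \<and>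
    (\<forall>c\<in>A. \<forall>c'\<in>A. \<forall>p\<in>fst c \<inter> fst c'. \<forall>I. length I = k \<longrightarrow>
       \<alpha> c' p I = (\<Sum>J | length J = k. \<alpha> c p J * (\<Prod>m<k. jac c c' (J ! m) (I ! m) p)))}"

definition sym_fields :: "('a, 'n::finite) chart set \<Rightarrow> nat \<Rightarrow> ('a, 'n) tfield set"
  where "sym_fields A k = {\<alpha> \<in> tensor_fields A k.
    \<forall>c p I \<sigma>. length I = k \<longrightarrow> \<sigma> permutes {..<k} \<longrightarrow> \<alpha> c p (permute_list \<sigma> I) = \<alpha> c p I}"

text \<open>The identification of \<open>S\<^sup>0(M)\<close> with \<open>C\<^sup>\<infinity>(M)\<close>. The value of a rank 0 tensor field
  at \<open>p\<close> is the same in all charts around \<open>p\<close>, so any of them can be chosen.\<close>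

definition chart_at :: "('a, 'n::finite) chart set \<Rightarrow> 'a \<Rightarrow> ('a, 'n) chart"
  where "chart_at A p = (SOME c. c \<in> A \<and> p \<in> fst c)"

definition to_fun :: "('a, 'n::finite) chart set \<Rightarrow> ('a, 'n) tfield \<Rightarrow> 'a \<Rightarrow> real"
  where "to_fun A \<alpha> = (\<lambda>p. if p \<in> \<Union> (fst ` A) then \<alpha> (chart_at A p) p [] else 0)"

definition of_fun :: "('a, 'n::finite) chart set \<Rightarrow> ('a \<Rightarrow> real) \<Rightarrow> ('a, 'n) tfield"
  where "of_fun A f = (\<lambda>c p I. if c \<in> A \<and> p \<in> fst c \<and> I = [] then f p else 0)"

definition dform :: "('a, 'n::finite) chart set \<Rightarrow> ('a \<Rightarrow> real) \<Rightarrow> ('a, 'n) tfield"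
  where "dform A f = (\<lambda>c p I. if c \<in> A \<and> p \<in> fst c \<and> length I = 1 then pd c (hd I) f p else 0)"

definition delta_star :: "('a, 'n::finite) chart set \<Rightarrow> ('a \<Rightarrow> real) \<Rightarrow> ('a, 'n) tfield"
  where "delta_star A f = - dform A f"

section \<open>Symplectic forms and symplectic connections\<close>

definition form_matrix :: "('a, 'n::finite) tfield \<Rightarrow> ('a, 'n) chart \<Rightarrow> 'a \<Rightarrow> real ^ 'n ^ 'n"
  where "form_matrix \<Omega> c p = (\<chi> i j. \<Omega> c p [i, j])"

definition symplectic_manifold ::
    "'a topology \<Rightarrow> ('a, 'n::finite) chart set \<Rightarrow> ('a, 'n) tfield \<Rightarrow> bool"
  where "symplectic_manifold M A \<Omega> \<longleftrightarrow>
    smooth_manifold M A \<and> \<Omega> \<in> tensor_fields A 2 \<and>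
    (\<forall>c\<in>A. \<forall>p\<in>fst c.
       (\<forall>i j. \<Omega> c p [i, j] = - \<Omega> c p [j, i]) \<and>
       invertible (form_matrix \<Omega> c p) \<and>
       (\<forall>i j k. pd c i (\<lambda>q. \<Omega> c q [j, k]) p + pd c j (\<lambda>q. \<Omega> c q [k, i]) p
              + pd c k (\<lambda>q. \<Omega> c q [i, j]) p = 0))"

text \<open>\<open>omega_up \<Omega> c p i j\<close> is \<open>\<Omega>\<^sup>i\<^sup>j\<close>, determined by \<open>\<Omega>\<^sup>i\<^sup>p \<Omega>\<^sub>p\<^sub>j = - \<delta>\<^sub>j\<^sup>i\<close>; thus it is minus the
  matrix inverse. In the formulas below the contravariant index of \<open>\<nabla>\<^sup>p\<close> and \<open>\<beta>\<^sub>\<dots>\<^sup>p\<close>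
  is raised by \<open>X\<^sup>p = \<Omega>\<^sup>p\<^sup>q X\<^sub>q\<close>.\<close>

definition omega_up :: "('a, 'n::finite) tfield \<Rightarrow> ('a, 'n) chart \<Rightarrow> 'a \<Rightarrow> 'n \<Rightarrow> 'n \<Rightarrow> real"
  where "omega_up \<Omega> c p i j = (THE W. W ** form_matrix \<Omega> c p = - mat 1) $ i $ j"

text \<open>An affine connection is given by its Christoffel symbols: \<open>\<Gamma> c p k i j\<close> is the
  coefficient of \<open>\<partial>\<^sub>k\<close> in \<open>\<nabla>\<^bsub>\<partial>\<^sub>i\<^esub> \<partial>\<^sub>j\<close>.\<close>

type_synonym ('a, 'n) christoffel = "('a, 'n) chart \<Rightarrow> 'a \<Rightarrow> 'n \<Rightarrow> 'n \<Rightarrow> 'n \<Rightarrow> real"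

definition affine_connection :: "('a, 'n::finite) chart set \<Rightarrow> ('a, 'n) christoffel \<Rightarrow> bool"
  where "affine_connection A \<Gamma> \<longleftrightarrow>
    (\<forall>c\<in>A. \<forall>k i j. smooth_on (coord_image c) (in_coords c (\<lambda>p. \<Gamma> c p k i j))) \<and>
    (\<forall>c\<in>A. \<forall>c'\<in>A. \<forall>p\<in>fst c \<inter> fst c'. \<forall>k i j.
       \<Gamma> c' p k i j = (\<Sum>r\<in>UNIV. jac c' c k r p *
         (pd c' i (\<lambda>q. jac c c' r j q) p +
          (\<Sum>a\<in>UNIV. \<Sum>b\<in>UNIV. jac c c' a i p * jac c c' b j p * \<Gamma> c p r a b))))"

definition torsion_free :: "('a, 'n::finite) chart set \<Rightarrow> ('a, 'n) christoffel \<Rightarrow> bool"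
  where "torsion_free A \<Gamma> \<longleftrightarrow> (\<forall>c\<in>A. \<forall>p\<in>fst c. \<forall>k i j. \<Gamma> c p k i j = \<Gamma> c p k j i)"

text \<open>\<open>cov \<Gamma> \<alpha> c p q I\<close> is \<open>\<nabla>\<^sub>q \<alpha>\<^sub>I\<close>.\<close>

definition cov :: "('a, 'n::finite) christoffel \<Rightarrow> ('a, 'n) tfield \<Rightarrow>
    ('a, 'n) chart \<Rightarrow> 'a \<Rightarrow> 'n \<Rightarrow> 'n list \<Rightarrow> real"
  where "cov \<Gamma> \<alpha> c p q I = pd c q (\<lambda>x. \<alpha> c x I) p
    - (\<Sum>m<length I. \<Sum>r\<in>UNIV. \<Gamma> c p r q (I ! m) * \<alpha> c p (I[m := r]))"

definition symplectic_connection ::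
    "('a, 'n::finite) chart set \<Rightarrow> ('a, 'n) tfield \<Rightarrow> ('a, 'n) christoffel \<Rightarrow> bool"
  where "symplectic_connection A \<Omega> \<Gamma> \<longleftrightarrow>
    affine_connection A \<Gamma> \<and> torsion_free A \<Gamma> \<and>
    (\<forall>c\<in>A. \<forall>p\<in>fst c. \<forall>q i j. cov \<Gamma> \<Omega> c p q [i, j] = 0)"

definition cov_up :: "('a, 'n::finite) tfield \<Rightarrow> ('a, 'n) christoffel \<Rightarrow> ('a, 'n) tfield \<Rightarrow>
    ('a, 'n) chart \<Rightarrow> 'a \<Rightarrow> 'n \<Rightarrow> 'n list \<Rightarrow> real"
  where "cov_up \<Omega> \<Gamma> \<alpha> c p r I = (\<Sum>q\<in>UNIV. omega_up \<Omega> c p r q * cov \<Gamma> \<alpha> c p q I)"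

definition ham :: "('a, 'n::finite) tfield \<Rightarrow> ('a \<Rightarrow> real) \<Rightarrow> ('a, 'n) chart \<Rightarrow> 'a \<Rightarrow> 'n \<Rightarrow> real"
  where "ham \<Omega> f c p i = (\<Sum>r\<in>UNIV. omega_up \<Omega> c p r i * pd c r f p)"

definition poisson_bracket :: "('a, 'n::finite) chart set \<Rightarrow> ('a, 'n) tfield \<Rightarrow>
    ('a \<Rightarrow> real) \<Rightarrow> ('a \<Rightarrow> real) \<Rightarrow> 'a \<Rightarrow> real"
  where "poisson_bracket A \<Omega> f g = to_fun A (\<lambda>c p _.
    \<Sum>i\<in>UNIV. \<Sum>j\<in>UNIV. \<Omega> c p [i, j] * ham \<Omega> f c p i * ham \<Omega> g c p j)"

section \<open>Product and brackets of symmetric tensor fields\<close>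

definition symmetrize :: "('n::finite list \<Rightarrow> real) \<Rightarrow> 'n list \<Rightarrow> real"
  where "symmetrize T I =
    (\<Sum>\<sigma> | \<sigma> permutes {..<length I}. T (permute_list \<sigma> I)) / fact (length I)"

text \<open>The following operations are meant for \<open>\<alpha>\<close> of rank \<open>k\<close> and \<open>\<beta>\<close> of rank \<open>l\<close>. Their results are
  supported on index lists of length \<open>k + l\<close>, \<open>k + l - 2\<close> and \<open>k + l - 1\<close> respectively, because
  \<open>\<alpha>\<close> and \<open>\<beta>\<close> are zero on index lists of the wrong length. When \<open>k - 1\<close> or \<open>l - 1\<close> is
  truncated, the coefficient of the term vanishes.\<close>

definition sym_prod :: "nat \<Rightarrow> nat \<Rightarrow> ('a, 'n::finite) tfield \<Rightarrow> ('a, 'n) tfield \<Rightarrow> ('a, 'n) tfield"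
  where "sym_prod k l \<alpha> \<beta> = (\<lambda>c p.
    symmetrize (\<lambda>J. \<alpha> c p (take k J) * \<beta> c p (drop k J)))"

definition alg_bracket :: "('a, 'n::finite) tfield \<Rightarrow> nat \<Rightarrow> nat \<Rightarrow>
    ('a, 'n) tfield \<Rightarrow> ('a, 'n) tfield \<Rightarrow> ('a, 'n) tfield"
  where "alg_bracket \<Omega> k l \<alpha> \<beta> = (\<lambda>c p I.
    real k * real l * symmetrize (\<lambda>J. \<Sum>r\<in>UNIV. \<alpha> c p (r # take (k - 1) J) *
      (\<Sum>q\<in>UNIV. omega_up \<Omega> c p r q * \<beta> c p (drop (k - 1) J @ [q]))) I)"

definition schouten_bracket :: "('a, 'n::finite) tfield \<Rightarrow> ('a, 'n) christoffel \<Rightarrow> nat \<Rightarrow> nat \<Rightarrow>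
    ('a, 'n) tfield \<Rightarrow> ('a, 'n) tfield \<Rightarrow> ('a, 'n) tfield"
  where "schouten_bracket \<Omega> \<Gamma> k l \<alpha> \<beta> = (\<lambda>c p I.
    - real k * symmetrize (\<lambda>J. \<Sum>r\<in>UNIV.
        \<alpha> c p (r # take (k - 1) J) * cov_up \<Omega> \<Gamma> \<beta> c p r (drop (k - 1) J)) I
    + real l * symmetrize (\<lambda>J. \<Sum>r\<in>UNIV.
        \<beta> c p (r # take (l - 1) J) * cov_up \<Omega> \<Gamma> \<alpha> c p r (drop (l - 1) J)) I)"

section \<open>The completed algebra\<close>

type_synonym ('a, 'n) gfield = "nat \<Rightarrow> ('a, 'n) tfield"

definition S_hat :: "('a, 'n::finite) chart set \<Rightarrow> ('a, 'n) gfield set"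
  where "S_hat A = {\<alpha>. \<forall>k. \<alpha> k \<in> sym_fields A k}"

definition S_hat_ge :: "('a, 'n::finite) chart set \<Rightarrow> nat \<Rightarrow> ('a, 'n) gfield set"
  where "S_hat_ge A k = {\<alpha> \<in> S_hat A. \<forall>i<k. \<alpha> i = 0}"

definition hat_prod :: "('a, 'n::finite) gfield \<Rightarrow> ('a, 'n) gfield \<Rightarrow> ('a, 'n) gfield"
  where "hat_prod \<alpha> \<beta> = (\<lambda>n. \<Sum>(k, l) | k + l = n. sym_prod k l (\<alpha> k) (\<beta> l))"

definition hat_alg :: "('a, 'n::finite) tfield \<Rightarrow>
    ('a, 'n) gfield \<Rightarrow> ('a, 'n) gfield \<Rightarrow> ('a, 'n) gfield"
  where "hat_alg \<Omega> \<alpha> \<beta> = (\<lambda>n. \<Sum>(k, l) | k + l = n + 2. alg_bracket \<Omega> k l (\<alpha> k) (\<beta> l))"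

definition hat_schouten :: "('a, 'n::finite) tfield \<Rightarrow> ('a, 'n) christoffel \<Rightarrow>
    ('a, 'n) gfield \<Rightarrow> ('a, 'n) gfield \<Rightarrow> ('a, 'n) gfield"
  where "hat_schouten \<Omega> \<Gamma> \<alpha> \<beta> =
    (\<lambda>n. \<Sum>(k, l) | k + l = n + 1. schouten_bracket \<Omega> \<Gamma> k l (\<alpha> k) (\<beta> l))"

definition hat_bracket :: "('a, 'n::finite) tfield \<Rightarrow> ('a, 'n) christoffel \<Rightarrow>
    ('a, 'n) gfield \<Rightarrow> ('a, 'n) gfield \<Rightarrow> ('a, 'n) gfield"
  where "hat_bracket \<Omega> \<Gamma> \<alpha> \<beta> = hat_alg \<Omega> \<alpha> \<beta> + hat_schouten \<Omega> \<Gamma> \<alpha> \<beta>"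

definition H_hat :: "('a, 'n::finite) chart set \<Rightarrow> ('a, 'n) gfield set"
  where "H_hat A = {\<alpha> \<in> S_hat A. \<alpha> 1 = - delta_star A (to_fun A (\<alpha> 0))}"

definition H_hat_ge :: "('a, 'n::finite) chart set \<Rightarrow> nat \<Rightarrow> ('a, 'n) gfield set"
  where "H_hat_ge A k = {\<alpha> \<in> H_hat A. \<forall>i<k. \<alpha> i = 0}"

definition in_degree :: "nat \<Rightarrow> ('a, 'n::finite) tfield \<Rightarrow> ('a, 'n) gfield"
  where "in_degree k \<alpha> = (\<lambda>i. if i = k then \<alpha> else 0)"

definition proj_fun :: "('a, 'n::finite) chart set \<Rightarrow> ('a, 'n) gfield \<Rightarrow> 'a \<Rightarrow> real"
  where "proj_fun A \<alpha> = - to_fun A (\<alpha> 0)"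

definition iota :: "('a, 'n::finite) chart set \<Rightarrow> ('a \<Rightarrow> real) \<Rightarrow> ('a, 'n) gfield"
  where "iota A f = in_degree 0 (of_fun A (- f)) + in_degree 1 (delta_star A f)"

end

theory Submission
  imports Defs
begin

text \<open>Three things have to be shown: the operations produce smooth symmetric tensor fields, so that
they stay inside \<open>S_hat A\<close>; the condition \<open>\<alpha>\<^sub>1 = d\<alpha>\<^sub>0\<close> that cuts out \<open>H_hat A\<close> survives the product and
the bracket; and the remaining claims, which are degree counting and linear algebra.

The heart is a cancellation between the two summands of the bracket. If \<open>\<alpha>\<^sub>1 = d\<alpha>\<^sub>0\<close>, then the algebraic
bracket of \<open>\<alpha>\<^sub>1\<close> with a symmetric tensor \<open>\<beta>\<close> contracts \<open>\<beta>\<close> with \<open>\<Omega>\<^sup>r\<^sup>q \<partial>\<^sub>r\<alpha>\<^sub>0\<close>, and the Schouten bracket of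
\<open>\<alpha>\<^sub>0\<close> with \<open>\<beta>\<close> contracts it with the opposite vector, since \<open>\<Omega>\<^sup>r\<^sup>q\<close> is antisymmetric
(\<open>exact_head_cancels_left\<close>, \<open>exact_head_cancels_right\<close>). Two consequences carry the theorem. Firstly,
bracketing with an element of \<open>H_hat A\<close> does not lower the degree of an element of
\<open>H_hat_ge A l\<close>, although each summand separately lowers it by one; hence the ideals. Secondly, in degrees 0 and 1 the bracket
of \<open>\<alpha>, \<beta> \<in> H_hat A\<close> reduces to the Schouten brackets \<open>- \<Omega>\<^sup>r\<^sup>q \<alpha>\<^sub>r \<beta>\<^sub>q\<close> of \<open>\<alpha>\<^sub>1\<close> with \<open>\<beta>\<^sub>0\<close> and
\<open>- \<alpha>\<^sub>r \<Omega>\<^sup>r\<^sup>q \<nabla>\<^sub>q \<beta>\<^sub>i + \<beta>\<^sub>r \<Omega>\<^sup>r\<^sup>q \<nabla>\<^sub>q \<alpha>\<^sub>i\<close> of \<open>\<alpha>\<^sub>1\<close> with \<open>\<beta>\<^sub>1\<close>. The second is the differential of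
the first, because \<open>\<nabla>\<close> preserves \<open>\<Omega>\<close> (\<open>pd_W\<close>), is torsion-free, and second partial derivatives
commute (\<open>partial_commute\<close>); this gives closure of \<open>H_hat A\<close> (\<open>hat_bracket_H_hat\<close>). The first is minus the
Poisson bracket of \<open>\<alpha>\<^sub>0\<close> and \<open>\<beta>\<^sub>0\<close>, so \<open>proj_fun\<close> is a homomorphism (\<open>proj_fun_hat_bracket\<close>).

An element of \<open>H_hat A\<close> is determined in degrees 0 and 1 by its projection. Since the bracket of two
elements concentrated in degrees 0 and 1 is again concentrated there, the homomorphism property of
\<open>iota\<close> follows from the one of \<open>proj_fun\<close>, and the splitting \<open>\<alpha> = iota (proj_fun \<alpha>) + (\<alpha> - iota (proj_fun \<alpha>))\<close>
is the semidirect decomposition.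

Tensoriality is pointwise multilinear algebra with index lists. A change of chart acts on components
by \<open>pullback P\<close> with \<open>P\<close> the Jacobian matrix; pullback commutes with symmetrization and with
contraction against \<open>\<Omega>\<^sup>r\<^sup>q\<close>, and the Christoffel terms of a pulled back tensor reproduce exactly the
derivatives of the Jacobian (\<open>christoffel_term_pullback\<close>). Smoothness of \<open>\<Omega>\<^sup>r\<^sup>q\<close> is Cramer's rule.\<close>

section \<open>Pullback of component arrays by a matrix\<close>

text \<open>The transformation law of covariant components in \<open>tensor_fields\<close>, for one
matrix \<open>P\<close> in place of the Jacobian of two charts at a point.\<close>

definition pullback :: "('n::finite \<Rightarrow> 'n \<Rightarrow> real) \<Rightarrow> ('n list \<Rightarrow> real) \<Rightarrow> 'n list \<Rightarrow> real"
  where "pullback P T I =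
    (\<Sum>J | length J = length I. T J * (\<Prod>m<length I. P (J ! m) (I ! m)))"

lemma finite_lists_of_length [simp]: "finite {J :: 'n::finite list. length J = k}"
  using finite_lists_length_eq [of "UNIV :: 'n set" k] by simp

lemma pullback_Nil [simp]: "pullback P T [] = T []"
proof -
  have "{J :: 'a list. length J = 0} = {[]}" by auto
  then show ?thesis by (simp add: pullback_def)
qed

text \<open>Together with \<open>pullback_Nil\<close> this makes pullback a recursion over the index list, which
turns the multilinear identities below into inductions.\<close>

lemma pullback_Cons:
  "pullback P T (i # I) = (\<Sum>j\<in>UNIV. P j i * pullback P (\<lambda>J. T (j # J)) I)"
proof -
  have lists: "{J. length J = Suc (length I)} = (\<lambda>(j, J). j # J) ` (UNIV \<times> {J. length J = length I})"
    by (auto simp: length_Suc_conv image_iff)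
  have inj: "inj_on (\<lambda>(j, J). j # J) (UNIV \<times> {J. length J = length I})"
    by (auto simp: inj_on_def)
  have "pullback P T (i # I) = (\<Sum>J | length J = Suc (length I).
      T J * (P (J ! 0) i * (\<Prod>m<length I. P (J ! Suc m) (I ! m))))"
    by (simp add: pullback_def prod.lessThan_Suc_shift del: prod.lessThan_Suc)
  also have "\<dots> = (\<Sum>(j, J)\<in>UNIV \<times> {J. length J = length I}.
      T (j # J) * (P j i * (\<Prod>m<length I. P (J ! m) (I ! m))))"
    unfolding lists by (subst sum.reindex [OF inj]) (simp add: case_prod_unfold)
  also have "\<dots> = (\<Sum>j\<in>UNIV. P j i * pullback P (\<lambda>J. T (j # J)) I)"
    unfolding pullback_def sum_distrib_left
    by (simp add: sum.cartesian_product [symmetric] mult_ac)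
  finally show ?thesis .
qed

lemma pullback_cong:
  assumes "\<And>J. length J = length I \<Longrightarrow> T J = T' J"
  shows "pullback P T I = pullback P T' I"
  using assms by (simp add: pullback_def)

lemma pullback_zero [simp]: "pullback P 0 I = 0" "pullback P (\<lambda>_. 0) I = 0"
  by (simp_all add: pullback_def)

lemma pullback_add: "pullback P (\<lambda>J. T J + T' J) I = pullback P T I + pullback P T' I"
  by (simp add: pullback_def algebra_simps sum.distrib)

lemma pullback_diff: "pullback P (\<lambda>J. T J - T' J) I = pullback P T I - pullback P T' I"
  by (simp add: pullback_def algebra_simps sum_subtractf)

lemma pullback_cmult: "pullback P (\<lambda>J. r * T J) I = r * pullback P T I"
  unfolding pullback_def sum_distrib_left by (simp add: mult_ac)

lemma pullback_multc: "pullback P (\<lambda>J. T J * r) I = pullback P T I * r"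
  unfolding pullback_def sum_distrib_right by (simp add: mult_ac)

lemma pullback_sum: "pullback P (\<lambda>J. \<Sum>x\<in>X. T x J) I = (\<Sum>x\<in>X. pullback P (T x) I)"
  unfolding pullback_def by (subst sum.swap) (simp add: sum_distrib_right)

lemma pullback_append:
  "pullback P T (I @ K) = pullback P (\<lambda>J. pullback P (\<lambda>L. T (J @ L)) K) I"
  by (induction I arbitrary: T) (simp_all add: pullback_Cons)

lemma pullback_snoc:
  "pullback P T (I @ [q]) = (\<Sum>s\<in>UNIV. P s q * pullback P (\<lambda>J. T (J @ [s])) I)"
  by (simp add: pullback_append pullback_Cons pullback_sum pullback_cmult)

lemma pullback_take_drop:
  assumes "k \<le> length I"
  shows "pullback P (\<lambda>J. S (take k J) * T (drop k J)) I
    = pullback P S (take k I) * pullback P T (drop k I)"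
proof -
  have "pullback P (\<lambda>J. S (take k J) * T (drop k J)) (take k I @ drop k I)
      = pullback P (\<lambda>J. S J * pullback P T (drop k I)) (take k I)"
    unfolding pullback_append using assms by (intro pullback_cong) (simp flip: pullback_cmult)
  then show ?thesis by (simp add: pullback_multc)
qed

lemma permute_list_inverse:
  assumes "\<sigma> permutes {..<length I}"
  shows "permute_list \<sigma> (permute_list (inv \<sigma>) I) = I"
    and "permute_list (inv \<sigma>) (permute_list \<sigma> I) = I"
  using permute_list_compose [OF assms, of "inv \<sigma>"]
    permute_list_compose [OF permutes_inv [OF assms], of \<sigma>] assms
  by (simp_all add: permutes_inv_o)

text \<open>Permuting the summation index together with \<open>I\<close> only reorders the factors of each
product.\<close>

lemma pullback_permute:
  fixes I :: "'n::finite list"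
  assumes \<sigma>: "\<sigma> permutes {..<length I}"
  shows "pullback P T (permute_list \<sigma> I) = pullback P (\<lambda>J. T (permute_list \<sigma> J)) I"
proof -
  let ?L = "{J :: 'n list. length J = length I}"
  have "bij_betw (permute_list \<sigma>) ?L ?L"
    by (rule bij_betw_byWitness [where f' = "permute_list (inv \<sigma>)"])
      (use \<sigma> in \<open>auto simp: permute_list_inverse\<close>)
  then have "pullback P T (permute_list \<sigma> I) = (\<Sum>J\<in>?L. T (permute_list \<sigma> J) *
      (\<Prod>m<length I. P (permute_list \<sigma> J ! m) (permute_list \<sigma> I ! m)))"
    unfolding pullback_def length_permute_list by (rule sum.reindex_bij_betw [symmetric])
  also have "\<dots> = (\<Sum>J\<in>?L. T (permute_list \<sigma> J) * (\<Prod>m<length I. P (J ! m) (I ! m)))"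
  proof (intro sum.cong refl arg_cong2 [where f = "(*)"])
    fix J assume "J \<in> ?L"
    then have "(\<Prod>m<length I. P (permute_list \<sigma> J ! m) (permute_list \<sigma> I ! m))
        = (\<Prod>m<length I. P (J ! \<sigma> m) (I ! \<sigma> m))"
      using \<sigma> by (intro prod.cong) (simp_all add: permute_list_nth)
    also have "\<dots> = (\<Prod>m<length I. P (J ! m) (I ! m))"
      using prod.permute [OF \<sigma>, of "\<lambda>m. P (J ! m) (I ! m)"] by (simp add: o_def)
    finally show "(\<Prod>m<length I. P (permute_list \<sigma> J ! m) (permute_list \<sigma> I ! m))
        = (\<Prod>m<length I. P (J ! m) (I ! m))" .
  qed
  finally show ?thesis by (simp add: pullback_def)
qed

lemma symmetrize_cong:
  assumes "\<And>J. length J = length I \<Longrightarrow> T J = T' J"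
  shows "symmetrize T I = symmetrize T' I"
  using assms by (simp add: symmetrize_def)

lemma symmetrize_zero: "(\<And>J. length J = length I \<Longrightarrow> T J = 0) \<Longrightarrow> symmetrize T I = 0"
  by (simp add: symmetrize_def)

lemma symmetrize_Nil [simp]: "symmetrize T [] = T []"
  by (simp add: symmetrize_def)

lemma symmetrize_singleton [simp]: "symmetrize T [i] = T [i]"
proof -
  have "{\<sigma>. \<sigma> permutes {..<Suc 0}} = {id}"
    by (auto simp: lessThan_Suc)
  then show ?thesis by (simp add: symmetrize_def)
qed

lemma symmetrize_pullback:
  assumes T: "\<And>J. length J = length I \<Longrightarrow> T' J = pullback P T J"
  shows "symmetrize T' I = pullback P (symmetrize T) I"
proof -
  have "symmetrize T' I = (\<Sum>\<sigma> | \<sigma> permutes {..<length I}.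
      pullback P (\<lambda>J. T (permute_list \<sigma> J)) I) / fact (length I)"
    by (simp add: symmetrize_def T pullback_permute)
  also have "\<dots> = pullback P (\<lambda>J. (\<Sum>\<sigma> | \<sigma> permutes {..<length I}.
      T (permute_list \<sigma> J)) * (1 / fact (length I))) I"
    by (simp only: pullback_sum pullback_multc) simp
  also have "\<dots> = pullback P (symmetrize T) I"
    by (rule pullback_cong) (simp add: symmetrize_def)
  finally show ?thesis .
qed

lemma symmetrize_permute:
  assumes \<tau>: "\<tau> permutes {..<length I}"
  shows "symmetrize T (permute_list \<tau> I) = symmetrize T I"
proof -
  have "(\<Sum>\<sigma> | \<sigma> permutes {..<length I}. T (permute_list \<sigma> (permute_list \<tau> I)))
      = (\<Sum>\<sigma> | \<sigma> permutes {..<length I}. T (permute_list (\<tau> \<circ> \<sigma>) I))"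
    by (intro sum.cong) (simp_all add: permute_list_compose)
  also have "\<dots> = (\<Sum>\<sigma> | \<sigma> permutes {..<length I}. T (permute_list \<sigma> I))"
    by (rule setum_permutations_compose_left [OF \<tau>, symmetric])
  finally show ?thesis by (simp add: symmetrize_def)
qed

text \<open>Contracting a lower index with an upper one is invariant. The upper index of \<open>V\<close> is
required to transform in the form \<open>\<Sum>\<^sub>i P\<^sup>j\<^sub>i V'\<^sup>i = V\<^sup>j\<close>, so the inverse of \<open>P\<close> does
not occur.\<close>

lemma contraction_pullback:
  assumes T: "\<And>i. T' (i # I) = pullback P T (i # I)"
    and V: "\<And>j. (\<Sum>i\<in>UNIV. P j i * V' i) = pullback P (V j) K"
  shows "(\<Sum>i\<in>UNIV. T' (i # I) * V' i)
    = pullback P (\<lambda>J. \<Sum>j\<in>UNIV. T (j # take (length I) J) * V j (drop (length I) J)) (I @ K)"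
proof -
  have "(\<Sum>i\<in>UNIV. T' (i # I) * V' i)
      = (\<Sum>i\<in>UNIV. \<Sum>j\<in>UNIV. pullback P (\<lambda>J. T (j # J)) I * (P j i * V' i))"
    unfolding T pullback_Cons sum_distrib_right by (simp add: mult_ac)
  also have "\<dots> = (\<Sum>j\<in>UNIV. pullback P (\<lambda>J. T (j # J)) I * pullback P (V j) K)"
    by (subst sum.swap) (simp add: sum_distrib_left [symmetric] V)
  also have "\<dots> = pullback P (\<lambda>J. \<Sum>j\<in>UNIV. T (j # take (length I) J) * V j (drop (length I) J)) (I @ K)"
    by (simp add: pullback_sum pullback_take_drop [of "length I" "I @ K" P "\<lambda>J. T (_ # J)"])
  finally show ?thesis .
qed

section \<open>Christoffel terms and the matrix of the symplectic form\<close>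

text \<open>The zeroth-order part of a covariant derivative in a fixed direction: \<open>G r i\<close> stands
for \<open>\<Gamma>\<^sup>r\<^sub>q\<^sub>i\<close> with \<open>q\<close> fixed.\<close>

definition christoffel_term ::
    "('n::finite \<Rightarrow> 'n \<Rightarrow> real) \<Rightarrow> ('n list \<Rightarrow> real) \<Rightarrow> 'n list \<Rightarrow> real"
  where "christoffel_term G T I = (\<Sum>m<length I. \<Sum>r\<in>UNIV. G r (I ! m) * T (I[m := r]))"

lemma christoffel_term_Nil [simp]: "christoffel_term G T [] = 0"
  by (simp add: christoffel_term_def)

lemma christoffel_term_Cons:
  "christoffel_term G T (i # I) =
    (\<Sum>r\<in>UNIV. G r i * T (r # I)) + christoffel_term G (\<lambda>J. T (i # J)) I"
  by (simp add: christoffel_term_def sum.lessThan_Suc_shift del: sum.lessThan_Suc)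

lemma christoffel_term_cong:
  assumes "\<And>J. length J = length I \<Longrightarrow> T J = T' J"
  shows "christoffel_term G T I = christoffel_term G T' I"
  using assms by (simp add: christoffel_term_def)

lemma christoffel_term_sum:
  "christoffel_term G (\<lambda>J. \<Sum>x\<in>X. T x J) I = (\<Sum>x\<in>X. christoffel_term G (T x) I)"
proof -
  have "christoffel_term G (\<lambda>J. \<Sum>x\<in>X. T x J) I
      = (\<Sum>m<length I. \<Sum>r\<in>UNIV. \<Sum>x\<in>X. G r (I ! m) * T x (I[m := r]))"
    by (simp add: christoffel_term_def sum_distrib_left)
  also have "\<dots> = (\<Sum>m<length I. \<Sum>x\<in>X. \<Sum>r\<in>UNIV. G r (I ! m) * T x (I[m := r]))"
    by (intro sum.cong refl sum.swap)
  also have "\<dots> = (\<Sum>x\<in>X. christoffel_term G (T x) I)"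
    unfolding christoffel_term_def by (rule sum.swap)
  finally show ?thesis .
qed

lemma christoffel_term_cmult: "christoffel_term G (\<lambda>J. a * T J) I = a * christoffel_term G T I"
  unfolding christoffel_term_def sum_distrib_left by (simp add: mult_ac)

lemma christoffel_term_sum_symbols:
  "christoffel_term (\<lambda>r b. \<Sum>a\<in>X. f a * G a r b) T I = (\<Sum>a\<in>X. f a * christoffel_term (G a) T I)"
proof -
  have "christoffel_term (\<lambda>r b. \<Sum>a\<in>X. f a * G a r b) T I
      = (\<Sum>m<length I. \<Sum>r\<in>UNIV. \<Sum>a\<in>X. f a * (G a r (I ! m) * T (I[m := r])))"
    unfolding christoffel_term_def sum_distrib_right by (simp add: mult_ac)
  also have "\<dots> = (\<Sum>m<length I. \<Sum>a\<in>X. \<Sum>r\<in>UNIV. f a * (G a r (I ! m) * T (I[m := r])))"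
    by (intro sum.cong refl sum.swap)
  also have "\<dots> = (\<Sum>a\<in>X. \<Sum>m<length I. \<Sum>r\<in>UNIV. f a * (G a r (I ! m) * T (I[m := r])))"
    by (rule sum.swap)
  also have "\<dots> = (\<Sum>a\<in>X. f a * christoffel_term (G a) T I)"
    by (simp add: christoffel_term_def sum_distrib_left)
  finally show ?thesis .
qed

text \<open>The derivative of \<open>pullback P T I\<close> in \<open>P\<close>, in the direction \<open>dP\<close>: each factor \<open>P\<close> in turn is
replaced by \<open>dP\<close>.\<close>

primrec pullback_variation :: "('n::finite \<Rightarrow> 'n \<Rightarrow> real) \<Rightarrow> ('n \<Rightarrow> 'n \<Rightarrow> real) \<Rightarrow>
    'n list \<Rightarrow> ('n list \<Rightarrow> real) \<Rightarrow> real"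
  where
    "pullback_variation P dP [] = (\<lambda>T. 0)"
  | "pullback_variation P dP (i # I) = (\<lambda>T. \<Sum>j\<in>UNIV.
       dP j i * pullback P (\<lambda>J. T (j # J)) I + P j i * pullback_variation P dP I (\<lambda>J. T (j # J)))"

lemma has_derivative_pullback:
  assumes P: "\<And>j i. ((\<lambda>x. P x j i) has_derivative P' j i) (at y)"
    and T: "\<And>J. length J = length I \<Longrightarrow> ((\<lambda>x. T x J) has_derivative T' J) (at y)"
  shows "((\<lambda>x. pullback (P x) (T x) I) has_derivative
    (\<lambda>v. pullback (P y) (\<lambda>J. T' J v) I + pullback_variation (P y) (\<lambda>j i. P' j i v) I (T y))) (at y)"
  using T
proof (induction I arbitrary: T T')
  case Nil
  then show ?case by simp
next
  case (Cons i I)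
  have IH: "((\<lambda>x. pullback (P x) (\<lambda>J. T x (j # J)) I) has_derivative
    (\<lambda>v. pullback (P y) (\<lambda>J. T' (j # J) v) I
      + pullback_variation (P y) (\<lambda>j i. P' j i v) I (\<lambda>J. T y (j # J)))) (at y)" for j
    by (rule Cons.IH) (simp add: Cons.prems)
  show ?case
    unfolding pullback_Cons
    by (rule has_derivative_eq_rhs, rule has_derivative_sum, rule has_derivative_mult [OF P IH])
      (simp add: fun_eq_iff algebra_simps sum.distrib)
qed

text \<open>The reason why covariant derivatives are tensors. The hypothesis is the transformation
law of Christoffel symbols, multiplied by the Jacobian \<open>P\<close>; its inhomogeneous term \<open>dP\<close> produces
precisely the variation of the pullback that the ordinary derivative of the transformed components
contains.\<close>

lemma christoffel_term_pullback:
  assumes G: "\<And>s i. (\<Sum>r\<in>UNIV. P s r * G' r i) = dP s i + (\<Sum>b\<in>UNIV. P b i * G s b)"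
  shows "christoffel_term G' (pullback P T) I
    = pullback_variation P dP I T + pullback P (christoffel_term G T) I"
proof (induction I arbitrary: T)
  case Nil
  then show ?case by simp
next
  case (Cons i I)
  let ?T = "\<lambda>j. pullback P (\<lambda>J. T (j # J)) I"
  have "(\<Sum>r\<in>UNIV. G' r i * pullback P T (r # I)) = (\<Sum>r\<in>UNIV. \<Sum>j\<in>UNIV. P j r * G' r i * ?T j)"
    unfolding pullback_Cons sum_distrib_left by (simp add: mult_ac)
  also have "\<dots> = (\<Sum>j\<in>UNIV. (\<Sum>r\<in>UNIV. P j r * G' r i) * ?T j)"
    unfolding sum_distrib_right by (rule sum.swap)
  also have "\<dots> = (\<Sum>j\<in>UNIV. dP j i * ?T j) + (\<Sum>j\<in>UNIV. \<Sum>b\<in>UNIV. P b i * G j b * ?T j)"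
    by (simp add: G distrib_right sum.distrib sum_distrib_right)
  also have "(\<Sum>j\<in>UNIV. \<Sum>b\<in>UNIV. P b i * G j b * ?T j)
      = (\<Sum>b\<in>UNIV. P b i * pullback P (\<lambda>J. \<Sum>j\<in>UNIV. G j b * T (j # J)) I)"
    by (subst sum.swap) (simp add: pullback_sum pullback_cmult sum_distrib_left mult.assoc)
  finally have head: "(\<Sum>r\<in>UNIV. G' r i * pullback P T (r # I)) = (\<Sum>j\<in>UNIV. dP j i * ?T j)
      + (\<Sum>b\<in>UNIV. P b i * pullback P (\<lambda>J. \<Sum>j\<in>UNIV. G j b * T (j # J)) I)" .
  have "christoffel_term G' (\<lambda>J. pullback P T (i # J)) I
      = (\<Sum>j\<in>UNIV. P j i * christoffel_term G' (pullback P (\<lambda>J. T (j # J))) I)"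
    by (simp add: pullback_Cons christoffel_term_sum christoffel_term_cmult)
  also have "\<dots> = (\<Sum>j\<in>UNIV. P j i * pullback_variation P dP I (\<lambda>J. T (j # J)))
      + (\<Sum>j\<in>UNIV. P j i * pullback P (christoffel_term G (\<lambda>J. T (j # J))) I)"
    by (simp add: Cons.IH distrib_left sum.distrib)
  finally have tail: "christoffel_term G' (\<lambda>J. pullback P T (i # J)) I
      = (\<Sum>j\<in>UNIV. P j i * pullback_variation P dP I (\<lambda>J. T (j # J)))
      + (\<Sum>j\<in>UNIV. P j i * pullback P (christoffel_term G (\<lambda>J. T (j # J))) I)" .
  show ?case
    unfolding christoffel_term_Cons head tail
    by (simp add: christoffel_term_Cons pullback_Cons pullback_add distrib_left sum.distrib)
qed

lemma minus_matrix_mult: "(- A) ** (B :: real^'n^'n) = - (A ** B)"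
  by (simp add: matrix_matrix_mult_def vec_eq_iff sum_negf)

lemma matrix_mult_minus: "A ** (- B :: real^'n^'n) = - (A ** B)"
  by (simp add: matrix_matrix_mult_def vec_eq_iff sum_negf)

lemma transpose_minus: "transpose (- A) = - transpose (A :: real^'n^'n)"
  by (simp add: transpose_def vec_eq_iff)

lemma matrix_minus_inverse_commute:
  fixes A B :: "real^'n^'n"
  shows "A ** B = - mat 1 \<longleftrightarrow> B ** A = - mat 1"
proof -
  have "A ** B = - mat 1 \<longleftrightarrow> (- A) ** B = mat 1"
    by (simp add: minus_matrix_mult minus_equation_iff [of _ "mat 1"] eq_commute [of "A ** B"])
  also have "\<dots> \<longleftrightarrow> B ** (- A) = mat 1"
    by (rule matrix_left_right_inverse)
  also have "\<dots> \<longleftrightarrow> B ** A = - mat 1"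
    by (simp add: matrix_mult_minus minus_equation_iff [of _ "mat 1"] eq_commute [of "B ** A"])
  finally show ?thesis .
qed

lemma minus_inverse_unique:
  fixes A X Y :: "real^'n^'n"
  assumes "X ** A = - mat 1" and "Y ** A = - mat 1"
  shows "X = Y"
proof -
  have "X ** (A ** Y) = Y ** (A ** Y)"
    using assms by (simp add: matrix_mul_assoc)
  moreover have "A ** Y = - mat 1"
    using assms(2) by (subst matrix_minus_inverse_commute)
  ultimately show ?thesis by (simp add: matrix_mult_minus)
qed

text \<open>If a bilinear form transforms by congruence, its negative inverse transforms
contravariantly. \<open>P\<close> has a left inverse since \<open>\<Omega>'\<close> is
invertible with \<open>P\<close> as its last factor, and for square matrices the left inverse is a right inverse.\<close>

lemma minus_inverse_congruence:
  fixes P \<Omega> \<Omega>' W W' :: "real^'n^'n"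
  assumes W: "W ** \<Omega> = - mat 1" and W': "W' ** \<Omega>' = - mat 1"
    and \<Omega>': "\<Omega>' = transpose P ** \<Omega> ** P"
  shows "P ** W' ** transpose P = W"
proof (rule minus_inverse_unique [OF _ W])
  have "(W' ** transpose P ** \<Omega>) ** P = - mat 1"
    using W' by (simp add: \<Omega>' matrix_mul_assoc)
  then have "P ** (W' ** transpose P ** \<Omega>) = - mat 1"
    by (subst matrix_minus_inverse_commute)
  then show "P ** W' ** transpose P ** \<Omega> = - mat 1"
    by (simp add: matrix_mul_assoc)
qed

definition omega_up_matrix :: "('a, 'n::finite) tfield \<Rightarrow> ('a, 'n) chart \<Rightarrow> 'a \<Rightarrow> real^'n^'n"
  where "omega_up_matrix \<Omega> c p = (\<chi> i j. omega_up \<Omega> c p i j)"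

lemma omega_up_matrix_unique:
  assumes "W ** form_matrix \<Omega> c p = - mat 1"
  shows "omega_up_matrix \<Omega> c p = W"
proof -
  have "(THE W. W ** form_matrix \<Omega> c p = - mat 1) = W"
    using assms minus_inverse_unique by blast
  then show ?thesis by (simp add: omega_up_matrix_def omega_up_def vec_eq_iff)
qed

lemma omega_up_matrix_inverse:
  assumes "invertible (form_matrix \<Omega> c p)"
  shows "omega_up_matrix \<Omega> c p ** form_matrix \<Omega> c p = - mat 1"
proof -
  obtain B where "B ** form_matrix \<Omega> c p = mat 1"
    using assms by (auto simp: invertible_def)
  then have B: "(- B) ** form_matrix \<Omega> c p = - mat 1"
    by (simp add: minus_matrix_mult)
  then have "omega_up_matrix \<Omega> c p = - B"
    by (rule omega_up_matrix_unique)
  with B show ?thesis by (simp only:)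
qed

lemma omega_up_antisym:
  assumes inv: "invertible (form_matrix \<Omega> c p)"
    and anti: "\<And>i j. \<Omega> c p [i, j] = - \<Omega> c p [j, i]"
  shows "omega_up \<Omega> c p i j = - omega_up \<Omega> c p j i"
proof -
  let ?W = "omega_up_matrix \<Omega> c p" and ?F = "form_matrix \<Omega> c p"
  have F: "transpose ?F = - ?F"
    by (simp add: form_matrix_def transpose_def vec_eq_iff) (intro allI anti)
  have "?F ** ?W = - mat 1"
    using omega_up_matrix_inverse [OF inv] by (subst matrix_minus_inverse_commute)
  then have "transpose ?W ** transpose ?F = - mat 1"
    by (simp add: matrix_transpose_mul [symmetric] transpose_minus)
  then have "(- transpose ?W) ** ?F = - mat 1"
    by (simp add: F minus_matrix_mult matrix_mult_minus)
  then have "?W = - transpose ?W" by (rule omega_up_matrix_unique)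
  then have "?W $ i $ j = (- transpose ?W) $ i $ j" by simp
  then show ?thesis by (simp add: omega_up_matrix_def transpose_def)
qed

section \<open>Smooth functions on open sets\<close>

definition partial :: "'n::finite \<Rightarrow> (real^'n \<Rightarrow> real) \<Rightarrow> real^'n \<Rightarrow> real"
  where "partial i f x = frechet_derivative f (at x) (axis i 1)"

lemma partial_eq: "(f has_derivative f') (at x) \<Longrightarrow> partial i f x = f' (axis i 1)"
  unfolding partial_def by (metis frechet_derivative_at)

lemma partial_cong:
  assumes "open S" "x \<in> S" "\<And>y. y \<in> S \<Longrightarrow> f y = g y"
  shows "partial i f x = partial i g x"
proof -
  have "(f has_derivative f') (at x) \<longleftrightarrow> (g has_derivative f') (at x)" for f'
    using has_derivative_transform_within_open [of f f' x UNIV S g]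
      has_derivative_transform_within_open [of g f' x UNIV S f] assms by auto
  then show ?thesis by (simp add: partial_def frechet_derivative_def)
qed

text \<open>Closure of \<open>Ck_on\<close> under sums, products and inverses is an induction on the order
through this recursion: the partial derivatives are built from functions of the lower order.\<close>

lemma Ck_on_Suc:
  "open S \<Longrightarrow> Ck_on (Suc k) S f \<longleftrightarrow>
    (\<forall>x\<in>S. f differentiable (at x)) \<and> (\<forall>i. Ck_on k S (partial i f))"
  by (simp add: differentiable_on_eq_differentiable_at partial_def [abs_def])

lemma Ck_on_cong:
  assumes "open S"
  shows "(\<And>x. x \<in> S \<Longrightarrow> f x = g x) \<Longrightarrow> Ck_on k S f \<Longrightarrow> Ck_on k S g"
proof (induction k arbitrary: f g)
  case 0
  then show ?case using continuous_on_cong [of S S f g] by simp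
next
  case (Suc k)
  have "Ck_on k S (partial i g)" for i
  proof (rule Suc.IH)
    show "partial i f x = partial i g x" if "x \<in> S" for x
      using assms that Suc.prems(1) by (rule partial_cong)
    show "Ck_on k S (partial i f)"
      using Suc.prems(2) assms by (simp add: Ck_on_Suc del: Ck_on.simps)
  qed
  moreover have "g differentiable (at x)" if "x \<in> S" for x
  proof -
    have "f differentiable (at x)"
      using Suc.prems(2) assms that by (simp add: Ck_on_Suc del: Ck_on.simps)
    then show ?thesis
      unfolding differentiable_def
      using has_derivative_transform_within_open [of f _ x UNIV S g] assms that Suc.prems(1) by blast
  qed
  ultimately show ?case using assms by (simp add: Ck_on_Suc del: Ck_on.simps)
qed

lemma Ck_on_subset: "T \<subseteq> S \<Longrightarrow> Ck_on k S f \<Longrightarrow> Ck_on k T f"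
  by (induction k arbitrary: f) (auto intro: continuous_on_subset differentiable_on_subset)

lemma Ck_on_continuous: "open S \<Longrightarrow> Ck_on k S f \<Longrightarrow> continuous_on S f"
  by (cases k) (auto intro: differentiable_imp_continuous_on)

lemma Ck_on_SucD: "open S \<Longrightarrow> Ck_on (Suc k) S f \<Longrightarrow> Ck_on k S f"
proof (induction k arbitrary: f)
  case 0
  then show ?case using Ck_on_continuous by (metis Ck_on.simps(1))
next
  case (Suc k)
  then show ?case by (simp add: Ck_on_Suc del: Ck_on.simps)
qed

lemma Ck_on_const: "Ck_on k S (\<lambda>x. a)"
  by (induction k arbitrary: a) simp_all

lemma partial_add:
  assumes "f differentiable (at x)" "g differentiable (at x)"
  shows "partial i (\<lambda>x. f x + g x) x = partial i f x + partial i g x"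
proof -
  have "(f has_derivative frechet_derivative f (at x)) (at x)"
    and "(g has_derivative frechet_derivative g (at x)) (at x)"
    using assms by (auto simp: frechet_derivative_works [symmetric])
  from partial_eq [OF has_derivative_add [OF this]] show ?thesis
    by (simp add: partial_def)
qed

lemma Ck_on_add: "open S \<Longrightarrow> Ck_on k S f \<Longrightarrow> Ck_on k S g \<Longrightarrow> Ck_on k S (\<lambda>x. f x + g x)"
proof (induction k arbitrary: f g)
  case 0
  then show ?case by (simp add: continuous_on_add)
next
  case (Suc k)
  have "Ck_on k S (partial i (\<lambda>x. f x + g x))" for i
  proof (rule Ck_on_cong [OF \<open>open S\<close>])
    show "Ck_on k S (\<lambda>x. partial i f x + partial i g x)"
      using Suc by (simp add: Ck_on_Suc del: Ck_on.simps)
    show "partial i f x + partial i g x = partial i (\<lambda>x. f x + g x) x" if "x \<in> S" for x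
      using Suc that by (subst partial_add) (auto simp: Ck_on_Suc simp del: Ck_on.simps)
  qed
  then show ?case using Suc by (simp add: Ck_on_Suc del: Ck_on.simps)
qed

lemma partial_mult:
  assumes "f differentiable (at x)" "g differentiable (at x)"
  shows "partial i (\<lambda>x. f x * g x) x = partial i f x * g x + f x * partial i g x"
proof -
  have "(f has_derivative frechet_derivative f (at x)) (at x)"
    and "(g has_derivative frechet_derivative g (at x)) (at x)"
    using assms by (auto simp: frechet_derivative_works [symmetric])
  from partial_eq [OF has_derivative_mult [OF this]] show ?thesis
    by (simp add: partial_def mult_ac add.commute)
qed

lemma partial_inverse:
  assumes "f differentiable (at x)" "f x \<noteq> 0"
  shows "partial i (\<lambda>x. inverse (f x)) x = - (partial i f x * (inverse (f x) * inverse (f x)))"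
proof -
  have "(f has_derivative frechet_derivative f (at x)) (at x)"
    using assms by (auto simp: frechet_derivative_works [symmetric])
  from partial_eq [OF Deriv.has_derivative_inverse [OF assms(2) this]] show ?thesis
    by (simp add: partial_def mult_ac add.commute)
qed

lemma Ck_on_mult: "open S \<Longrightarrow> Ck_on k S f \<Longrightarrow> Ck_on k S g \<Longrightarrow> Ck_on k S (\<lambda>x. f x * g x)"
proof (induction k arbitrary: f g)
  case 0
  then show ?case by (simp add: continuous_on_mult)
next
  case (Suc k)
  have "Ck_on k S (partial i (\<lambda>x. f x * g x))" for i
  proof (rule Ck_on_cong [OF \<open>open S\<close>])
    show "Ck_on k S (\<lambda>x. partial i f x * g x + f x * partial i g x)"
    proof -
      have "Ck_on k S f" "Ck_on k S g"
        using Suc.prems by (auto intro: Ck_on_SucD simp del: Ck_on.simps)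
      moreover have "Ck_on k S (partial i f)" "Ck_on k S (partial i g)"
        using Suc.prems by (auto simp: Ck_on_Suc simp del: Ck_on.simps)
      ultimately show ?thesis
        using \<open>open S\<close> by (intro Ck_on_add Suc.IH)
    qed
    show "partial i f x * g x + f x * partial i g x = partial i (\<lambda>x. f x * g x) x" if "x \<in> S" for x
      using Suc that by (subst partial_mult) (auto simp: Ck_on_Suc simp del: Ck_on.simps)
  qed
  then show ?case using Suc by (simp add: Ck_on_Suc del: Ck_on.simps)
qed

lemma Ck_on_inverse:
  assumes "open S" "\<And>x. x \<in> S \<Longrightarrow> f x \<noteq> 0"
  shows "Ck_on k S f \<Longrightarrow> Ck_on k S (\<lambda>x. inverse (f x))"
proof (induction k)
  case 0
  then show ?case using assms by (simp add: continuous_on_inverse)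
next
  case (Suc k)
  have "Ck_on k S (partial i (\<lambda>x. inverse (f x)))" for i
  proof (rule Ck_on_cong [OF \<open>open S\<close>])
    have "Ck_on k S (\<lambda>x. inverse (f x))"
      using Ck_on_SucD [OF assms(1) Suc.prems] by (rule Suc.IH)
    moreover have "Ck_on k S (partial i f)"
      using Suc.prems assms by (simp add: Ck_on_Suc del: Ck_on.simps)
    ultimately show "Ck_on k S (\<lambda>x. (- 1) * (partial i f x * (inverse (f x) * inverse (f x))))"
      using assms by (intro Ck_on_mult Ck_on_const)
    show "(- 1) * (partial i f x * (inverse (f x) * inverse (f x))) = partial i (\<lambda>x. inverse (f x)) x"
      if "x \<in> S" for x
      using Suc that assms by (subst partial_inverse) (auto simp: Ck_on_Suc simp del: Ck_on.simps)
  qed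
  then show ?case using Suc assms by (simp add: Ck_on_Suc del: Ck_on.simps)
qed

lemma smooth_on_cong:
  "open S \<Longrightarrow> smooth_on S f \<Longrightarrow> (\<And>x. x \<in> S \<Longrightarrow> f x = g x) \<Longrightarrow> smooth_on S g"
  unfolding smooth_on_def using Ck_on_cong by blast

lemma smooth_on_const [simp]: "smooth_on S (\<lambda>x. a)"
  by (simp add: smooth_on_def Ck_on_const)

lemma smooth_on_add: "open S \<Longrightarrow> smooth_on S f \<Longrightarrow> smooth_on S g \<Longrightarrow> smooth_on S (\<lambda>x. f x + g x)"
  by (simp add: smooth_on_def Ck_on_add)

lemma smooth_on_mult: "open S \<Longrightarrow> smooth_on S f \<Longrightarrow> smooth_on S g \<Longrightarrow> smooth_on S (\<lambda>x. f x * g x)"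
  by (simp add: smooth_on_def Ck_on_mult)

lemma smooth_on_minus: "open S \<Longrightarrow> smooth_on S f \<Longrightarrow> smooth_on S (\<lambda>x. - f x)"
  using smooth_on_mult [of S "\<lambda>x. - 1" f] by simp

lemma smooth_on_diff: "open S \<Longrightarrow> smooth_on S f \<Longrightarrow> smooth_on S g \<Longrightarrow> smooth_on S (\<lambda>x. f x - g x)"
  using smooth_on_add [of S f "\<lambda>x. - g x"] by (simp add: smooth_on_minus)

lemma smooth_on_divide:
  "open S \<Longrightarrow> smooth_on S f \<Longrightarrow> smooth_on S g \<Longrightarrow> (\<And>x. x \<in> S \<Longrightarrow> g x \<noteq> 0) \<Longrightarrow>
    smooth_on S (\<lambda>x. f x / g x)"
  unfolding divide_inverse by (intro smooth_on_mult) (auto simp: smooth_on_def Ck_on_inverse)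

lemma smooth_on_sum:
  "open S \<Longrightarrow> (\<And>a. a \<in> X \<Longrightarrow> smooth_on S (f a)) \<Longrightarrow> smooth_on S (\<lambda>x. \<Sum>a\<in>X. f a x)"
  by (induction X rule: infinite_finite_induct) (auto simp: smooth_on_add)

lemma smooth_on_prod:
  "open S \<Longrightarrow> (\<And>a. a \<in> X \<Longrightarrow> smooth_on S (f a)) \<Longrightarrow> smooth_on S (\<lambda>x. \<Prod>a\<in>X. f a x)"
  by (induction X rule: infinite_finite_induct) (auto simp: smooth_on_mult)

lemma smooth_on_det:
  fixes F :: "real^'n::finite \<Rightarrow> real^'m^'m"
  shows "open S \<Longrightarrow> (\<And>i j. smooth_on S (\<lambda>x. F x $ i $ j)) \<Longrightarrow> smooth_on S (\<lambda>x. det (F x))"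
  unfolding det_def by (intro smooth_on_sum smooth_on_mult smooth_on_prod smooth_on_const)

lemma smooth_on_partial: "open S \<Longrightarrow> smooth_on S f \<Longrightarrow> smooth_on S (partial i f)"
  unfolding smooth_on_def by (metis Ck_on_Suc)

lemma smooth_on_differentiable: "open S \<Longrightarrow> smooth_on S f \<Longrightarrow> x \<in> S \<Longrightarrow> f differentiable (at x)"
  unfolding smooth_on_def by (metis Ck_on_Suc)

lemma smooth_on_continuous: "open S \<Longrightarrow> smooth_on S f \<Longrightarrow> continuous_on S f"
  unfolding smooth_on_def using Ck_on_continuous by blast

lemma has_real_derivative_along_axis:
  assumes "f differentiable (at (y + s *\<^sub>R axis i 1))"
  shows "((\<lambda>s. f (y + s *\<^sub>R axis i 1)) has_real_derivative partial i f (y + s *\<^sub>R axis i 1)) (at s)"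
proof -
  let ?f' = "frechet_derivative f (at (y + s *\<^sub>R axis i 1))"
  have f': "(f has_derivative ?f') (at (y + s *\<^sub>R axis i 1))"
    using assms by (simp add: frechet_derivative_works [symmetric])
  have "((\<lambda>s. y + s *\<^sub>R axis i 1) has_derivative (\<lambda>s. s *\<^sub>R axis i 1)) (at s)"
    by (auto intro!: derivative_eq_intros)
  from has_derivative_compose [OF this f']
  have "((\<lambda>s. f (y + s *\<^sub>R axis i 1)) has_derivative (\<lambda>s. ?f' (s *\<^sub>R axis i 1))) (at s)" .
  moreover have "(\<lambda>s. ?f' (s *\<^sub>R axis i 1)) = (*) (partial i f (y + s *\<^sub>R axis i 1))"
    using has_derivative_linear [OF f'] by (auto simp: partial_def linear_cmul mult.commute)
  ultimately show ?thesis by (simp add: has_field_derivative_def)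
qed

text \<open>The mean value theorem, applied first along the \<open>i\<close>-th axis to
\<open>s \<mapsto> f (x + s e\<^sub>i + h e\<^sub>j) - f (x + s e\<^sub>i)\<close> and then along the \<open>j\<close>-th axis.\<close>

lemma second_difference_mean_value:
  assumes f: "smooth_on (ball x r) f" and h: "0 < h" "2 * h < r"
  obtains y where "dist y x \<le> 2 * h"
    and "f (x + h *\<^sub>R axis i 1 + h *\<^sub>R axis j 1) - f (x + h *\<^sub>R axis i 1)
      - (f (x + h *\<^sub>R axis j 1) - f x) = h * h * partial j (partial i f) y"
proof -
  let ?a = "axis i 1 :: real^'a" and ?b = "axis j 1 :: real^'a"
  have near: "dist (x + s *\<^sub>R ?a + t *\<^sub>R ?b) x \<le> 2 * h"
    if "0 \<le> s" "s \<le> h" "0 \<le> t" "t \<le> h" for s t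
  proof -
    have "norm (s *\<^sub>R ?a + t *\<^sub>R ?b) \<le> s + t"
      using norm_triangle_ineq [of "s *\<^sub>R ?a" "t *\<^sub>R ?b"] that by simp
    then show ?thesis using that by (simp add: dist_norm algebra_simps)
  qed
  then have in_ball: "x + s *\<^sub>R ?a + t *\<^sub>R ?b \<in> ball x r"
    if "0 \<le> s" "s \<le> h" "0 \<le> t" "t \<le> h" for s t
    using that h(2) by (fastforce simp: dist_commute)
  have diff: "g differentiable (at (x + s *\<^sub>R ?a + t *\<^sub>R ?b))"
    if "smooth_on (ball x r) g" "0 \<le> s" "s \<le> h" "0 \<le> t" "t \<le> h" for g s t
    using smooth_on_differentiable [OF open_ball that(1)] in_ball that by blast
  have shift: "x + s *\<^sub>R ?a + t *\<^sub>R ?b = (x + t *\<^sub>R ?b) + s *\<^sub>R ?a" for s t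
    by (simp add: algebra_simps)
  have along_a: "((\<lambda>s. f (x + s *\<^sub>R ?a + t *\<^sub>R ?b)) has_real_derivative
      partial i f (x + s *\<^sub>R ?a + t *\<^sub>R ?b)) (at s)"
    if "0 \<le> s" "s \<le> h" "0 \<le> t" "t \<le> h" for s t
    using diff [OF f that] unfolding shift by (rule has_real_derivative_along_axis)
  have "\<exists>s>0. s < h \<and> (f (x + h *\<^sub>R ?a + h *\<^sub>R ?b) - f (x + h *\<^sub>R ?a + 0 *\<^sub>R ?b))
      - (f (x + 0 *\<^sub>R ?a + h *\<^sub>R ?b) - f (x + 0 *\<^sub>R ?a + 0 *\<^sub>R ?b))
      = (h - 0) * (partial i f (x + s *\<^sub>R ?a + h *\<^sub>R ?b) - partial i f (x + s *\<^sub>R ?a + 0 *\<^sub>R ?b))"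
    using h by (intro MVT2 DERIV_diff along_a) auto
  then obtain s where s: "0 < s" "s < h" and
    s_eq: "(f (x + h *\<^sub>R ?a + h *\<^sub>R ?b) - f (x + h *\<^sub>R ?a)) - (f (x + h *\<^sub>R ?b) - f x)
      = h * (partial i f (x + s *\<^sub>R ?a + h *\<^sub>R ?b) - partial i f (x + s *\<^sub>R ?a + 0 *\<^sub>R ?b))"
    by auto
  have "\<exists>t>0. t < h \<and> partial i f (x + s *\<^sub>R ?a + h *\<^sub>R ?b) - partial i f (x + s *\<^sub>R ?a + 0 *\<^sub>R ?b)
      = (h - 0) * partial j (partial i f) (x + s *\<^sub>R ?a + t *\<^sub>R ?b)"
    using h s by (intro MVT2 has_real_derivative_along_axis diff smooth_on_partial f) auto
  then obtain t where t: "0 < t" "t < h" and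
    "partial i f (x + s *\<^sub>R ?a + h *\<^sub>R ?b) - partial i f (x + s *\<^sub>R ?a + 0 *\<^sub>R ?b)
      = h * partial j (partial i f) (x + s *\<^sub>R ?a + t *\<^sub>R ?b)"
    by auto
  with s_eq near [of s t] s show thesis
    by (intro that [of "x + s *\<^sub>R ?a + t *\<^sub>R ?b"]) auto
qed

text \<open>The second difference is symmetric in the two axes, so both mixed derivatives take equal
values at two points arbitrarily close to \<open>x\<close>; by continuity they agree at \<open>x\<close>.\<close>

lemma partial_commute:
  assumes "open S" and f: "smooth_on S f" and x: "x \<in> S"
  shows "partial i (partial j f) x = partial j (partial i f) x"
proof (rule ccontr)
  let ?F = "\<lambda>i j. partial i (partial j f)"
  assume neq: "?F i j x \<noteq> ?F j i x"
  define e where "e = \<bar>?F i j x - ?F j i x\<bar> / 2"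
  have "e > 0" using neq by (simp add: e_def)
  obtain r where r: "r > 0" "ball x r \<subseteq> S"
    using assms openE by blast
  have f': "smooth_on (ball x r) f"
    using f r by (auto simp: smooth_on_def intro: Ck_on_subset)
  have "isCont (?F i j) x" for i j
    using assms by (metis smooth_on_partial smooth_on_continuous continuous_on_eq_continuous_at)
  then have "\<exists>d>0. \<forall>y. dist y x < d \<longrightarrow> dist (?F i j y) (?F i j x) < e" for i j
    using \<open>e > 0\<close> unfolding continuous_at_eps_delta by blast
  then obtain d d' where d: "d > 0" "\<And>y. dist y x < d \<Longrightarrow> dist (?F i j y) (?F i j x) < e"
    and d': "d' > 0" "\<And>y. dist y x < d' \<Longrightarrow> dist (?F j i y) (?F j i x) < e"
    by meson
  \<comment> \<open>Both mean value points lie within \<open>2 * h\<close> of \<open>x\<close>.\<close>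
  define h where "h = min r (min d d') / 3"
  have h: "0 < h" "2 * h < r" "2 * h < d" "2 * h < d'"
    using r d d' by (auto simp: h_def)
  obtain y where y: "dist y x \<le> 2 * h" and
    y_eq: "f (x + h *\<^sub>R axis i 1 + h *\<^sub>R axis j 1) - f (x + h *\<^sub>R axis i 1)
      - (f (x + h *\<^sub>R axis j 1) - f x) = h * h * ?F j i y"
    using second_difference_mean_value [OF f' h(1,2)] .
  obtain z where z: "dist z x \<le> 2 * h" and
    z_eq: "f (x + h *\<^sub>R axis j 1 + h *\<^sub>R axis i 1) - f (x + h *\<^sub>R axis j 1)
      - (f (x + h *\<^sub>R axis i 1) - f x) = h * h * ?F i j z"
    using second_difference_mean_value [OF f' h(1,2)] .
  have "x + h *\<^sub>R axis j 1 + h *\<^sub>R axis i 1 = x + h *\<^sub>R axis i 1 + h *\<^sub>R axis j 1"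
    by (simp add: algebra_simps)
  with z_eq have "f (x + h *\<^sub>R axis i 1 + h *\<^sub>R axis j 1) - f (x + h *\<^sub>R axis j 1)
      - (f (x + h *\<^sub>R axis i 1) - f x) = h * h * ?F i j z" by simp
  with y_eq have "h * h * ?F j i y = h * h * ?F i j z" by linarith
  with h(1) have "?F j i y = ?F i j z" by simp
  moreover have "dist (?F j i y) (?F j i x) < e" "dist (?F i j z) (?F i j x) < e"
    using d(2) [of z] d'(2) [of y] y z h by auto
  ultimately have "\<bar>?F i j x - ?F j i x\<bar> < 2 * e"
    by (simp add: dist_real_def)
  then show False by (simp add: e_def)
qed

section \<open>Calculus in charts\<close>

lemma in_coords_simps:
  "in_coords c (\<lambda>q. f q + g q) = (\<lambda>x. in_coords c f x + in_coords c g x)"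
  "in_coords c (\<lambda>q. f q - g q) = (\<lambda>x. in_coords c f x - in_coords c g x)"
  "in_coords c (\<lambda>q. f q * g q) = (\<lambda>x. in_coords c f x * in_coords c g x)"
  "in_coords c (\<lambda>q. f q / g q) = (\<lambda>x. in_coords c f x / in_coords c g x)"
  "in_coords c (\<lambda>q. - f q) = (\<lambda>x. - in_coords c f x)"
  "in_coords c (\<lambda>q. \<Sum>a\<in>X. F a q) = (\<lambda>x. \<Sum>a\<in>X. in_coords c (F a) x)"
  "in_coords c (\<lambda>q. r) = (\<lambda>x. r)"
  by (simp_all add: in_coords_def)

definition smooth_in :: "('a, 'n::finite) chart \<Rightarrow> ('a \<Rightarrow> real) \<Rightarrow> bool"
  where "smooth_in c f \<longleftrightarrow> smooth_on (coord_image c) (in_coords c f)"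

text \<open>Differentiability at one point is kept apart from \<open>smooth_in\<close> because coordinates of another
chart, and the Jacobian, are only meaningful on the overlap of the two chart domains.\<close>

definition diff_in :: "('a, 'n::finite) chart \<Rightarrow> ('a \<Rightarrow> real) \<Rightarrow> 'a \<Rightarrow> bool"
  where "diff_in c f p \<longleftrightarrow> in_coords c f differentiable (at (snd c p))"

lemma pd_partial: "pd c i f p = partial i (in_coords c f) (snd c p)"
  by (simp add: pd_def partial_def)

lemma diff_in_has_derivative:
  "diff_in c f p \<Longrightarrow>
    (in_coords c f has_derivative frechet_derivative (in_coords c f) (at (snd c p))) (at (snd c p))"
  by (simp add: diff_in_def frechet_derivative_works [symmetric])

lemma pd_const [simp]: "pd c i (\<lambda>q. r) p = 0"
  by (simp add: pd_def in_coords_simps)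

lemma pd_add:
  "diff_in c f p \<Longrightarrow> diff_in c g p \<Longrightarrow> pd c i (\<lambda>q. f q + g q) p = pd c i f p + pd c i g p"
  by (simp add: pd_partial in_coords_simps diff_in_def partial_add)

lemma diff_in_const: "diff_in c (\<lambda>q. r) p"
  by (simp add: diff_in_def in_coords_simps)

lemma diff_in_add: "diff_in c f p \<Longrightarrow> diff_in c g p \<Longrightarrow> diff_in c (\<lambda>q. f q + g q) p"
  by (simp add: in_coords_simps diff_in_def)

lemma diff_in_mult: "diff_in c f p \<Longrightarrow> diff_in c g p \<Longrightarrow> diff_in c (\<lambda>q. f q * g q) p"
  by (simp add: in_coords_simps diff_in_def)

lemma diff_in_sum:
  "(\<And>a. a \<in> X \<Longrightarrow> diff_in c (F a) p) \<Longrightarrow> diff_in c (\<lambda>q. \<Sum>a\<in>X. F a q) p"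
  by (induction X rule: infinite_finite_induct) (auto simp: diff_in_add diff_in_const)

lemma pd_cmult: "diff_in c f p \<Longrightarrow> pd c i (\<lambda>q. r * f q) p = r * pd c i f p"
  by (simp add: pd_partial in_coords_simps diff_in_def partial_mult) (simp add: partial_def)

lemma pd_minus: "diff_in c f p \<Longrightarrow> pd c i (\<lambda>q. - f q) p = - pd c i f p"
  using pd_cmult [of c f p i "- 1"] by simp

lemma pd_sum:
  "(\<And>a. a \<in> X \<Longrightarrow> diff_in c (F a) p) \<Longrightarrow> pd c i (\<lambda>q. \<Sum>a\<in>X. F a q) p = (\<Sum>a\<in>X. pd c i (F a) p)"
  by (induction X rule: infinite_finite_induct) (auto simp: pd_add diff_in_sum)

locale manifold =
  fixes M :: "'a topology" and A :: "('a, 'n::finite) chart set"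
  assumes smooth_manifold: "smooth_manifold M A"
begin

lemma openin_chart: "c \<in> A \<Longrightarrow> openin M (fst c)"
  and open_coord_image: "c \<in> A \<Longrightarrow> open (coord_image c)"
  and homeomorphic_chart: "c \<in> A \<Longrightarrow>
    homeomorphic_map (subtopology M (fst c)) (top_of_set (coord_image c)) (snd c)"
  and smooth_transition: "c \<in> A \<Longrightarrow> c' \<in> A \<Longrightarrow>
    smooth_on (snd c ` (fst c \<inter> fst c')) (in_coords c (\<lambda>p. snd c' p $ i))"
  using smooth_manifold by (auto simp: smooth_manifold_def)

lemma inj_chart: "c \<in> A \<Longrightarrow> inj_on (snd c) (fst c)"
  using homeomorphic_imp_injective_map [OF homeomorphic_chart] openin_subset [OF openin_chart]
  by (simp add: topspace_subtopology inf_absorb2)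

lemma in_coords_chart [simp]: "c \<in> A \<Longrightarrow> p \<in> fst c \<Longrightarrow> in_coords c f (snd c p) = f p"
  using inj_chart by (simp add: in_coords_def)

lemma snd_in_coord_image [simp]: "p \<in> fst c \<Longrightarrow> snd c p \<in> coord_image c"
  by (simp add: coord_image_def)

lemma coord_imageE:
  assumes "x \<in> coord_image c"
  obtains p where "p \<in> fst c" "x = snd c p"
  using assms by (auto simp: coord_image_def)

lemma open_overlap:
  assumes "c \<in> A" "c' \<in> A"
  shows "open (snd c ` (fst c \<inter> fst c'))"
proof -
  have "openin (subtopology M (fst c)) (fst c \<inter> fst c')"
    using openin_chart [OF assms(2)] by (simp add: openin_subtopology_Int2)
  then have "openin (top_of_set (coord_image c)) (snd c ` (fst c \<inter> fst c'))"
    using homeomorphic_imp_open_map [OF homeomorphic_chart [OF assms(1)]] by (simp add: open_map_def)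
  then show ?thesis
    using open_coord_image [OF assms(1)] by (rule openin_open_trans)
qed

lemma smooth_in_cong:
  assumes "c \<in> A" "smooth_in c f" "\<And>p. p \<in> fst c \<Longrightarrow> f p = g p"
  shows "smooth_in c g"
  unfolding smooth_in_def
proof (rule smooth_on_cong [OF open_coord_image [OF assms(1)]])
  show "smooth_on (coord_image c) (in_coords c f)"
    using assms(2) by (simp add: smooth_in_def)
  show "in_coords c f x = in_coords c g x" if "x \<in> coord_image c" for x
    using that assms(1,3) by (auto elim!: coord_imageE)
qed

lemma smooth_in_diff_in: "c \<in> A \<Longrightarrow> smooth_in c f \<Longrightarrow> p \<in> fst c \<Longrightarrow> diff_in c f p"
  unfolding smooth_in_def diff_in_def
  by (rule smooth_on_differentiable [OF open_coord_image]) (auto simp: coord_image_def)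

lemma smooth_in_const [simp]: "smooth_in c (\<lambda>q. r)"
  by (simp add: smooth_in_def in_coords_simps)

lemma smooth_in_add: "c \<in> A \<Longrightarrow> smooth_in c f \<Longrightarrow> smooth_in c g \<Longrightarrow> smooth_in c (\<lambda>q. f q + g q)"
  by (simp add: smooth_in_def in_coords_simps smooth_on_add open_coord_image)

lemma smooth_in_diff: "c \<in> A \<Longrightarrow> smooth_in c f \<Longrightarrow> smooth_in c g \<Longrightarrow> smooth_in c (\<lambda>q. f q - g q)"
  by (simp add: smooth_in_def in_coords_simps smooth_on_diff open_coord_image)

lemma smooth_in_minus: "c \<in> A \<Longrightarrow> smooth_in c f \<Longrightarrow> smooth_in c (\<lambda>q. - f q)"
  by (simp add: smooth_in_def in_coords_simps smooth_on_minus open_coord_image)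

lemma smooth_in_mult: "c \<in> A \<Longrightarrow> smooth_in c f \<Longrightarrow> smooth_in c g \<Longrightarrow> smooth_in c (\<lambda>q. f q * g q)"
  by (simp add: smooth_in_def in_coords_simps smooth_on_mult open_coord_image)

lemma smooth_in_sum:
  "c \<in> A \<Longrightarrow> (\<And>a. a \<in> X \<Longrightarrow> smooth_in c (F a)) \<Longrightarrow> smooth_in c (\<lambda>q. \<Sum>a\<in>X. F a q)"
  by (simp add: smooth_in_def in_coords_simps smooth_on_sum open_coord_image)

lemma smooth_in_cmult: "c \<in> A \<Longrightarrow> smooth_in c f \<Longrightarrow> smooth_in c (\<lambda>q. r * f q)"
  by (simp add: smooth_in_mult)

lemma in_coords_pd:
  "c \<in> A \<Longrightarrow> x \<in> coord_image c \<Longrightarrow> in_coords c (pd c i f) x = partial i (in_coords c f) x"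
  by (auto elim!: coord_imageE simp: pd_partial)

lemma smooth_in_pd:
  assumes c: "c \<in> A" and f: "smooth_in c f"
  shows "smooth_in c (pd c i f)"
proof -
  have "smooth_on (coord_image c) (partial i (in_coords c f))"
    using f open_coord_image [OF c] by (simp add: smooth_in_def smooth_on_partial)
  then show ?thesis
    unfolding smooth_in_def
    by (rule smooth_on_cong [OF open_coord_image [OF c]]) (simp add: in_coords_pd c)
qed

lemma pd_commute:
  assumes c: "c \<in> A" and f: "smooth_in c f" and p: "p \<in> fst c"
  shows "pd c i (pd c j f) p = pd c j (pd c i f) p"
proof -
  have "pd c i (pd c j f) p = partial i (partial j (in_coords c f)) (snd c p)" for i j
    unfolding pd_partial [of c i]
    by (rule partial_cong [OF open_coord_image [OF c]]) (use p c in \<open>auto simp: in_coords_pd\<close>)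
  then show ?thesis
    using partial_commute [OF open_coord_image [OF c], of "in_coords c f" "snd c p" i j] f p
    by (simp add: smooth_in_def)
qed

lemma pd_cong:
  assumes c: "c \<in> A" and c': "c' \<in> A" and p: "p \<in> fst c \<inter> fst c'"
    and eq: "\<And>q. q \<in> fst c \<inter> fst c' \<Longrightarrow> f q = g q"
  shows "pd c i f p = pd c i g p"
  unfolding pd_partial
  by (rule partial_cong [OF open_overlap [OF c c']]) (use p eq c in auto)

lemma diff_in_coordinate:
  "c \<in> A \<Longrightarrow> c' \<in> A \<Longrightarrow> p \<in> fst c \<inter> fst c' \<Longrightarrow> diff_in c' (\<lambda>q. snd c q $ j) p"
  unfolding diff_in_def
  using smooth_on_differentiable [OF open_overlap [of c' c] smooth_transition [of c' c j]] by blast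

lemma diff_in_jac:
  assumes c: "c \<in> A" and c': "c' \<in> A" and p: "p \<in> fst c \<inter> fst c'"
  shows "diff_in c' (jac c c' j i) p"
proof -
  let ?O = "snd c' ` (fst c' \<inter> fst c)"
  have "smooth_on ?O (partial i (in_coords c' (\<lambda>q. snd c q $ j)))"
    using open_overlap [OF c' c] smooth_transition [OF c' c] by (rule smooth_on_partial)
  then have "smooth_on ?O (in_coords c' (jac c c' j i))"
    by (rule smooth_on_cong [OF open_overlap [OF c' c]])
      (use c' in \<open>auto simp: jac_def pd_partial\<close>)
  then show ?thesis
    unfolding diff_in_def using p smooth_on_differentiable [OF open_overlap [OF c' c]] by blast
qed

text \<open>Near \<open>p\<close>, the coordinate expression of \<open>f\<close> in \<open>c'\<close> is its expression in \<open>c\<close> composed with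
the change of coordinates.\<close>

lemma has_derivative_transition:
  assumes c: "c \<in> A" and c': "c' \<in> A" and p: "p \<in> fst c \<inter> fst c'" and f: "diff_in c f p"
  defines "D j \<equiv> frechet_derivative (in_coords c' (\<lambda>q. snd c q $ j)) (at (snd c' p))"
  shows "(in_coords c' f has_derivative
    (\<lambda>v. frechet_derivative (in_coords c f) (at (snd c p)) (\<chi> j. D j v))) (at (snd c' p))"
proof -
  let ?F = "frechet_derivative (in_coords c f) (at (snd c p))"
  let ?\<phi> = "\<lambda>y. \<chi> j. in_coords c' (\<lambda>q. snd c q $ j) y"
  have "(?\<phi> has_derivative (\<lambda>v. \<chi> j. D j v)) (at (snd c' p))"
    unfolding has_derivative_componentwise_within [of ?\<phi>] Basis_vec_def D_def
    using diff_in_has_derivative [OF diff_in_coordinate [OF c c' p]] by (auto simp: inner_axis)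
  moreover have "?\<phi> (snd c' p) = snd c p"
    using c' p by (simp add: vec_eq_iff)
  then have "(in_coords c f has_derivative ?F) (at (?\<phi> (snd c' p)))"
    using f by (simp add: diff_in_has_derivative)
  ultimately have "((\<lambda>y. in_coords c f (?\<phi> y)) has_derivative (\<lambda>v. ?F (\<chi> j. D j v))) (at (snd c' p))"
    by (rule has_derivative_compose)
  then show ?thesis
  proof (rule has_derivative_transform_within_open [OF _ open_overlap [OF c' c]])
    show "snd c' p \<in> snd c' ` (fst c' \<inter> fst c)" using p by auto
    fix y assume "y \<in> snd c' ` (fst c' \<inter> fst c)"
    then obtain q where q: "q \<in> fst c'" "q \<in> fst c" "y = snd c' q" by auto
    have "?\<phi> (snd c' q) = snd c q"
      using c' q(1) by (simp add: vec_eq_iff)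
    then have "?\<phi> y = snd c q" by (simp only: q(3))
    then show "in_coords c f (?\<phi> y) = in_coords c' f y"
      using q c c' by simp
  qed
qed

lemma diff_in_other_chart:
  "c \<in> A \<Longrightarrow> c' \<in> A \<Longrightarrow> p \<in> fst c \<inter> fst c' \<Longrightarrow> diff_in c f p \<Longrightarrow> diff_in c' f p"
  unfolding diff_in_def [of c'] differentiable_def using has_derivative_transition by blast

lemma chain_rule:
  assumes c: "c \<in> A" and c': "c' \<in> A" and p: "p \<in> fst c \<inter> fst c'" and f: "diff_in c f p"
  shows "pd c' i f p = (\<Sum>j\<in>UNIV. jac c c' j i p * pd c j f p)"
proof -
  let ?F = "frechet_derivative (in_coords c f) (at (snd c p))"
  have lin: "linear ?F"
    using diff_in_has_derivative [OF f] by (rule has_derivative_linear)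
  have "pd c' i f p = ?F (\<chi> j. jac c c' j i p)"
    unfolding pd_partial partial_eq [OF has_derivative_transition [OF assms]]
    by (simp add: jac_def pd_def)
  also have "(\<chi> j. jac c c' j i p) = (\<Sum>j\<in>UNIV. jac c c' j i p *\<^sub>R axis j 1)"
    using basis_expansion [of "\<chi> j. jac c c' j i p"] by (simp add: scalar_mult_eq_scaleR)
  also have "?F \<dots> = (\<Sum>j\<in>UNIV. jac c c' j i p * pd c j f p)"
    by (simp add: linear_sum [OF lin] linear_cmul [OF lin] pd_def)
  finally show ?thesis .
qed

lemma pd_coordinate:
  assumes c: "c \<in> A" and p: "p \<in> fst c"
  shows "pd c i (\<lambda>q. snd c q $ j) p = (if i = j then 1 else 0)"
proof -
  have "partial i (in_coords c (\<lambda>q. snd c q $ j)) (snd c p) = partial i (\<lambda>x. x $ j) (snd c p)"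
    by (rule partial_cong [OF open_coord_image [OF c]]) (use p c in \<open>auto elim!: coord_imageE\<close>)
  also have "\<dots> = axis i 1 $ j"
    by (rule partial_eq) (auto intro: bounded_linear_imp_has_derivative)
  finally show ?thesis by (simp add: pd_partial axis_def)
qed

text \<open>The chain rule for the coordinate functions of \<open>c\<close>.\<close>

lemma jac_inverse:
  assumes c: "c \<in> A" and c': "c' \<in> A" and p: "p \<in> fst c \<inter> fst c'"
  shows "(\<Sum>k\<in>UNIV. jac c c' s k p * jac c' c k r p) = (if r = s then 1 else 0)"
proof -
  have "pd c r (\<lambda>q. snd c q $ s) p = (\<Sum>k\<in>UNIV. jac c' c k r p * pd c' k (\<lambda>q. snd c q $ s) p)"
    using p by (intro chain_rule c c' diff_in_coordinate) auto
  then show ?thesis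
    using p c by (simp add: pd_coordinate jac_def mult.commute)
qed

lemma pd_product:
  "c \<in> A \<Longrightarrow> p \<in> fst c \<Longrightarrow> diff_in c f p \<Longrightarrow> diff_in c g p \<Longrightarrow>
    pd c i (\<lambda>q. f q * g q) p = pd c i f p * g p + f p * pd c i g p"
  by (simp add: pd_partial in_coords_simps diff_in_def partial_mult)

abbreviation "J c c' p \<equiv> \<lambda>j i. jac c c' j i p"

lemma tensor_fields_pullback:
  "\<alpha> \<in> tensor_fields A k \<Longrightarrow> c \<in> A \<Longrightarrow> c' \<in> A \<Longrightarrow> p \<in> fst c \<inter> fst c' \<Longrightarrow> length I = k \<Longrightarrow>
    \<alpha> c' p I = pullback (J c c' p) (\<alpha> c p) I"
  unfolding tensor_fields_def pullback_def by blast

lemma tensor_fields_smooth: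
  "\<alpha> \<in> tensor_fields A k \<Longrightarrow> c \<in> A \<Longrightarrow> smooth_in c (\<lambda>q. \<alpha> c q I)"
  by (simp add: tensor_fields_def smooth_in_def)

lemma tensor_fields_zero:
  "\<alpha> \<in> tensor_fields A k \<Longrightarrow> \<not> (c \<in> A \<and> p \<in> fst c \<and> length I = k) \<Longrightarrow> \<alpha> c p I = 0"
  unfolding tensor_fields_def by blast

lemma tensor_fieldsI:
  assumes "\<And>c p I. \<not> (c \<in> A \<and> p \<in> fst c \<and> length I = k) \<Longrightarrow> \<alpha> c p I = 0"
    and "\<And>c I. c \<in> A \<Longrightarrow> length I = k \<Longrightarrow> smooth_in c (\<lambda>q. \<alpha> c q I)"
    and "\<And>c c' p I. c \<in> A \<Longrightarrow> c' \<in> A \<Longrightarrow> p \<in> fst c \<inter> fst c' \<Longrightarrow> length I = k \<Longrightarrow>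
      \<alpha> c' p I = pullback (J c c' p) (\<alpha> c p) I"
  shows "\<alpha> \<in> tensor_fields A k"
proof -
  have "smooth_in c (\<lambda>q. \<alpha> c q I)" if "c \<in> A" for c I
    using assms(1,2) that by (cases "length I = k") auto
  then have "\<forall>c\<in>A. \<forall>I. smooth_on (coord_image c) (in_coords c (\<lambda>p. \<alpha> c p I))"
    by (simp add: smooth_in_def)
  moreover have "\<forall>c\<in>A. \<forall>c'\<in>A. \<forall>p\<in>fst c \<inter> fst c'. \<forall>I. length I = k \<longrightarrow>
      \<alpha> c' p I = (\<Sum>K | length K = k. \<alpha> c p K * (\<Prod>m<k. jac c c' (K ! m) (I ! m) p))"
    using assms(3) unfolding pullback_def by blast
  ultimately show ?thesis
    using assms(1) unfolding tensor_fields_def by blast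
qed

lemma cov_christoffel_term:
  "cov \<Gamma> \<alpha> c p q I = pd c q (\<lambda>x. \<alpha> c x I) p - christoffel_term (\<lambda>r i. \<Gamma> c p r q i) (\<alpha> c p) I"
  by (simp add: cov_def christoffel_term_def)

lemma pd_pullback:
  assumes \<alpha>: "\<alpha> \<in> tensor_fields A k" and c: "c \<in> A" and c': "c' \<in> A"
    and p: "p \<in> fst c \<inter> fst c'" and I: "length I = k"
  shows "pd c' q (\<lambda>x. \<alpha> c' x I) p
    = pullback (J c c' p) (\<lambda>K. pd c' q (\<lambda>x. \<alpha> c x K) p) I
      + pullback_variation (J c c' p) (\<lambda>j i. pd c' q (jac c c' j i) p) I (\<alpha> c p)"
proof -
  have T: "diff_in c' (\<lambda>x. \<alpha> c x K) p" for K
    using p by (intro diff_in_other_chart [OF c c' p] smooth_in_diff_in [OF c]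
        tensor_fields_smooth [OF \<alpha> c]) auto
  have "pd c' q (\<lambda>x. \<alpha> c' x I) p = pd c' q (\<lambda>x. pullback (J c c' x) (\<alpha> c x) I) p"
    by (rule pd_cong [OF c' c]) (use tensor_fields_pullback [OF \<alpha> c c'] p I in auto)
  also have "\<dots> = partial q (\<lambda>y. pullback (\<lambda>j i. in_coords c' (jac c c' j i) y)
      (\<lambda>K. in_coords c' (\<lambda>x. \<alpha> c x K) y) I) (snd c' p)"
    by (simp add: pd_partial in_coords_def)
  also have "\<dots> = pullback (\<lambda>j i. in_coords c' (jac c c' j i) (snd c' p))
      (\<lambda>K. pd c' q (\<lambda>x. \<alpha> c x K) p) I
      + pullback_variation (\<lambda>j i. in_coords c' (jac c c' j i) (snd c' p))
        (\<lambda>j i. pd c' q (jac c c' j i) p) I (\<lambda>K. in_coords c' (\<lambda>x. \<alpha> c x K) (snd c' p))"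
    unfolding pd_def
    by (rule partial_eq, rule has_derivative_pullback)
      (intro diff_in_has_derivative diff_in_jac c c' p T)+
  finally show ?thesis using c' p by simp
qed

text \<open>The inhomogeneous terms of the two parts of \<open>cov\<close> cancel, by \<open>pd_pullback\<close> and
\<open>christoffel_term_pullback\<close>. The result transforms like a tensor with one further lower index \<open>q\<close>.\<close>

lemma cov_pullback:
  assumes \<Gamma>: "affine_connection A \<Gamma>" and \<alpha>: "\<alpha> \<in> tensor_fields A k"
    and c: "c \<in> A" and c': "c' \<in> A" and p: "p \<in> fst c \<inter> fst c'" and I: "length I = k"
  shows "cov \<Gamma> \<alpha> c' p q I = (\<Sum>s\<in>UNIV. jac c c' s q p * pullback (J c c' p) (cov \<Gamma> \<alpha> c p s) I)"
proof -
  let ?J = "J c c' p"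
  let ?dJ = "\<lambda>j i. pd c' q (jac c c' j i) p"
  define G where "G s b = (\<Sum>a\<in>UNIV. ?J a q * \<Gamma> c p s a b)" for s b
  have law: "(\<Sum>r\<in>UNIV. ?J s r * \<Gamma> c' p r q i) = ?dJ s i + (\<Sum>b\<in>UNIV. ?J b i * G s b)" for s i
  proof -
    define X where "X t = ?dJ t i + (\<Sum>b\<in>UNIV. ?J b i * G t b)" for t
    have "X t = pd c' q (\<lambda>y. jac c c' t i y) p
        + (\<Sum>a\<in>UNIV. \<Sum>b\<in>UNIV. jac c c' a q p * jac c c' b i p * \<Gamma> c p t a b)" for t
      unfolding X_def G_def sum_distrib_left
      by (subst (2) sum.swap) (simp add: mult_ac)
    then have "\<Gamma> c' p r q i = (\<Sum>t\<in>UNIV. jac c' c r t p * X t)" for r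
      using \<Gamma> c c' p unfolding affine_connection_def by simp
    then have "(\<Sum>r\<in>UNIV. ?J s r * \<Gamma> c' p r q i)
        = (\<Sum>r\<in>UNIV. \<Sum>t\<in>UNIV. ?J s r * jac c' c r t p * X t)"
      by (simp add: sum_distrib_left mult.assoc)
    also have "\<dots> = (\<Sum>t\<in>UNIV. (\<Sum>r\<in>UNIV. ?J s r * jac c' c r t p) * X t)"
      unfolding sum_distrib_right by (rule sum.swap)
    also have "\<dots> = X s"
      by (simp add: jac_inverse [OF c c' p] if_distrib [of "\<lambda>x. x * _"] cong: if_cong)
    finally show ?thesis by (simp add: X_def)
  qed
  have "christoffel_term (\<lambda>r i. \<Gamma> c' p r q i) (\<alpha> c' p) I
      = christoffel_term (\<lambda>r i. \<Gamma> c' p r q i) (pullback ?J (\<alpha> c p)) I"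
    by (rule christoffel_term_cong) (simp add: tensor_fields_pullback [OF \<alpha> c c' p] I)
  also have "\<dots> = pullback_variation ?J ?dJ I (\<alpha> c p) + pullback ?J (christoffel_term G (\<alpha> c p)) I"
    by (rule christoffel_term_pullback [OF law])
  finally have "cov \<Gamma> \<alpha> c' p q I = pullback ?J (\<lambda>K. pd c' q (\<lambda>x. \<alpha> c x K) p
      - christoffel_term G (\<alpha> c p) K) I"
    by (simp add: cov_christoffel_term pd_pullback [OF \<alpha> c c' p I] pullback_diff)
  also have "\<dots> = pullback ?J (\<lambda>K. \<Sum>s\<in>UNIV. ?J s q * cov \<Gamma> \<alpha> c p s K) I"
  proof (rule pullback_cong)
    fix K
    have "diff_in c (\<lambda>x. \<alpha> c x K) p"
      using p by (intro smooth_in_diff_in [OF c] tensor_fields_smooth [OF \<alpha> c]) auto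
    moreover have "christoffel_term G (\<alpha> c p) K
        = (\<Sum>s\<in>UNIV. ?J s q * christoffel_term (\<lambda>r b. \<Gamma> c p r s b) (\<alpha> c p) K)"
      unfolding G_def [abs_def] by (rule christoffel_term_sum_symbols)
    ultimately show "pd c' q (\<lambda>x. \<alpha> c x K) p - christoffel_term G (\<alpha> c p) K
        = (\<Sum>s\<in>UNIV. ?J s q * cov \<Gamma> \<alpha> c p s K)"
      by (simp add: chain_rule [OF c c' p] cov_christoffel_term
          right_diff_distrib sum_subtractf)
  qed
  finally show ?thesis by (simp add: pullback_sum pullback_cmult)
qed

end

section \<open>Products and brackets of tensor fields are tensor fields\<close>

text \<open>The common shape of both brackets: the first index of \<open>T\<close> is contracted with the
distinguished index of \<open>X\<close>, raised by \<open>W\<close>. The algebraic bracket uses \<open>X q L = \<beta>\<^sub>L\<^sub>q\<close>, the Schouten bracket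
\<open>X q L = \<nabla>\<^sub>q \<beta>\<^sub>L\<close>.\<close>

definition contraction :: "nat \<Rightarrow> ('n::finite \<Rightarrow> 'n \<Rightarrow> real) \<Rightarrow> ('n list \<Rightarrow> real) \<Rightarrow>
    ('n \<Rightarrow> 'n list \<Rightarrow> real) \<Rightarrow> 'n list \<Rightarrow> real"
  where "contraction k W T X = symmetrize (\<lambda>L. \<Sum>r\<in>UNIV. T (r # take (k - 1) L) *
    (\<Sum>q\<in>UNIV. W r q * X q (drop (k - 1) L)))"

lemma alg_bracket_contraction:
  "alg_bracket \<Omega> k l \<alpha> \<beta> = (real k * real l) *\<^sub>R
    (\<lambda>c p. contraction k (omega_up \<Omega> c p) (\<alpha> c p) (\<lambda>q L. \<beta> c p (L @ [q])))"
  by (simp add: alg_bracket_def contraction_def scaleR_fun_def)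

lemma schouten_bracket_contraction:
  "schouten_bracket \<Omega> \<Gamma> k l \<alpha> \<beta> =
    (- real k) *\<^sub>R (\<lambda>c p. contraction k (omega_up \<Omega> c p) (\<alpha> c p) (cov \<Gamma> \<beta> c p))
    + real l *\<^sub>R (\<lambda>c p. contraction l (omega_up \<Omega> c p) (\<beta> c p) (cov \<Gamma> \<alpha> c p))"
  by (simp add: schouten_bracket_def contraction_def cov_up_def scaleR_fun_def fun_eq_iff)

context manifold
begin

lemma sym_fields_tensor: "\<alpha> \<in> sym_fields A k \<Longrightarrow> \<alpha> \<in> tensor_fields A k"
  by (simp add: sym_fields_def)

lemma smooth_in_symmetrize:
  assumes c: "c \<in> A" and T: "\<And>L. length L = length I \<Longrightarrow> smooth_in c (\<lambda>p. T p L)"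
  shows "smooth_in c (\<lambda>p. symmetrize (T p) I)"
proof -
  have "smooth_in c (\<lambda>p. (1 / fact (length I)) *
      (\<Sum>\<sigma> | \<sigma> permutes {..<length I}. T p (permute_list \<sigma> I)))"
    using c by (intro smooth_in_mult smooth_in_sum smooth_in_const T) auto
  then show ?thesis by (simp add: symmetrize_def)
qed

text \<open>Symmetrization takes care of the symmetry, so a product or bracket only has to be
checked to be tensorial before symmetrization.\<close>

lemma symmetrize_sym_fields:
  assumes "\<And>c p I. \<not> (c \<in> A \<and> p \<in> fst c \<and> length I = k) \<Longrightarrow> T c p I = 0"
    and "\<And>c I. c \<in> A \<Longrightarrow> length I = k \<Longrightarrow> smooth_in c (\<lambda>p. T c p I)"
    and "\<And>c c' p I. c \<in> A \<Longrightarrow> c' \<in> A \<Longrightarrow> p \<in> fst c \<inter> fst c' \<Longrightarrow> length I = k \<Longrightarrow>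
      T c' p I = pullback (J c c' p) (T c p) I"
  shows "(\<lambda>c p. symmetrize (T c p)) \<in> sym_fields A k"
proof -
  have "(\<lambda>c p. symmetrize (T c p)) \<in> tensor_fields A k"
  proof (rule tensor_fieldsI)
    show "symmetrize (T c p) I = 0" if "\<not> (c \<in> A \<and> p \<in> fst c \<and> length I = k)" for c p I
      using that by (intro symmetrize_zero assms(1)) auto
    show "smooth_in c (\<lambda>p. symmetrize (T c p) I)" if "c \<in> A" "length I = k" for c I
      using that by (intro smooth_in_symmetrize assms(2)) auto
    show "symmetrize (T c' p) I = pullback (J c c' p) (symmetrize (T c p)) I"
      if "c \<in> A" "c' \<in> A" "p \<in> fst c \<inter> fst c'" "length I = k" for c c' p I
      using that by (intro symmetrize_pullback assms(3)) auto
  qed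
  then show ?thesis by (simp add: sym_fields_def symmetrize_permute)
qed

lemma subspace_tensor_fields: "subspace (tensor_fields A k)"
proof (rule subspaceI)
  show "0 \<in> tensor_fields A k"
    by (rule tensor_fieldsI) auto
  show "\<alpha> + \<beta> \<in> tensor_fields A k" if "\<alpha> \<in> tensor_fields A k" "\<beta> \<in> tensor_fields A k" for \<alpha> \<beta>
  proof (rule tensor_fieldsI)
    show "(\<alpha> + \<beta>) c p I = 0" if "\<not> (c \<in> A \<and> p \<in> fst c \<and> length I = k)" for c p I
      using tensor_fields_zero [OF \<open>\<alpha> \<in> _\<close> that] tensor_fields_zero [OF \<open>\<beta> \<in> _\<close> that] by simp
    show "smooth_in c (\<lambda>q. (\<alpha> + \<beta>) c q I)" if "c \<in> A" for c I
      using tensor_fields_smooth \<open>\<alpha> \<in> _\<close> \<open>\<beta> \<in> _\<close> that by (simp add: smooth_in_add)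
    show "(\<alpha> + \<beta>) c' p I = pullback (J c c' p) ((\<alpha> + \<beta>) c p) I"
      if "c \<in> A" "c' \<in> A" "p \<in> fst c \<inter> fst c'" "length I = k" for c c' p I
      using tensor_fields_pullback [OF \<open>\<alpha> \<in> _\<close> that] tensor_fields_pullback [OF \<open>\<beta> \<in> _\<close> that]
        pullback_add [of "J c c' p" "\<alpha> c p" "\<beta> c p" I] by (simp add: plus_fun_def)
  qed
  show "r *\<^sub>R \<alpha> \<in> tensor_fields A k" if "\<alpha> \<in> tensor_fields A k" for r \<alpha>
  proof (rule tensor_fieldsI)
    show "(r *\<^sub>R \<alpha>) c p I = 0" if "\<not> (c \<in> A \<and> p \<in> fst c \<and> length I = k)" for c p I
      using tensor_fields_zero [OF \<open>\<alpha> \<in> _\<close> that] by (simp add: scaleR_fun_def)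
    show "smooth_in c (\<lambda>q. (r *\<^sub>R \<alpha>) c q I)" if "c \<in> A" for c I
      using tensor_fields_smooth \<open>\<alpha> \<in> _\<close> that by (simp add: smooth_in_cmult scaleR_fun_def)
    show "(r *\<^sub>R \<alpha>) c' p I = pullback (J c c' p) ((r *\<^sub>R \<alpha>) c p) I"
      if "c \<in> A" "c' \<in> A" "p \<in> fst c \<inter> fst c'" "length I = k" for c c' p I
      using tensor_fields_pullback [OF \<open>\<alpha> \<in> _\<close> that] pullback_cmult [of "J c c' p" r "\<alpha> c p" I]
      by (simp add: scaleR_fun_def)
  qed
qed

lemma subspace_sym_fields: "subspace (sym_fields A k)"
proof -
  have eq: "sym_fields A k = tensor_fields A k \<inter> {\<alpha>. \<forall>c p I \<sigma>. length I = k \<longrightarrow>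
      \<sigma> permutes {..<k} \<longrightarrow> \<alpha> c p (permute_list \<sigma> I) = \<alpha> c p I}"
    by (auto simp: sym_fields_def)
  have sub: "subspace {\<alpha> :: ('a, 'n) tfield. \<forall>c p I \<sigma>. length I = k \<longrightarrow>
      \<sigma> permutes {..<k} \<longrightarrow> \<alpha> c p (permute_list \<sigma> I) = \<alpha> c p I}"
    by (rule subspaceI) (auto simp: scaleR_fun_def)
  show ?thesis
    unfolding eq by (rule subspace_inter [OF subspace_tensor_fields sub])
qed

lemma sym_prod_sym_fields:
  assumes \<alpha>: "\<alpha> \<in> tensor_fields A k" and \<beta>: "\<beta> \<in> tensor_fields A l"
  shows "sym_prod k l \<alpha> \<beta> \<in> sym_fields A (k + l)"
  unfolding sym_prod_def
proof (rule symmetrize_sym_fields)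
  show "\<alpha> c p (take k I) * \<beta> c p (drop k I) = 0"
    if "\<not> (c \<in> A \<and> p \<in> fst c \<and> length I = k + l)" for c p I
  proof (cases "c \<in> A \<and> p \<in> fst c \<and> length (take k I) = k")
    case True
    then have "\<not> (c \<in> A \<and> p \<in> fst c \<and> length (drop k I) = l)" using that by auto
    then show ?thesis by (simp add: tensor_fields_zero [OF \<beta>])
  next
    case False
    then show ?thesis using tensor_fields_zero [OF \<alpha>] by simp
  qed
  show "smooth_in c (\<lambda>p. \<alpha> c p (take k I) * \<beta> c p (drop k I))" if "c \<in> A" for c I
    using that \<alpha> \<beta> by (intro smooth_in_mult tensor_fields_smooth)
  show "\<alpha> c' p (take k I) * \<beta> c' p (drop k I)
      = pullback (J c c' p) (\<lambda>L. \<alpha> c p (take k L) * \<beta> c p (drop k L)) I"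
    if "c \<in> A" "c' \<in> A" "p \<in> fst c \<inter> fst c'" "length I = k + l" for c c' p I
    using that(4) tensor_fields_pullback [OF \<alpha> that(1-3)] tensor_fields_pullback [OF \<beta> that(1-3)]
    by (simp add: pullback_take_drop)
qed

end

locale symplectic = manifold M A
  for M :: "'a topology" and A :: "('a, 'n::finite) chart set" +
  fixes \<Omega> :: "('a, 'n) tfield" and \<Gamma> :: "('a, 'n) christoffel"
  assumes symplectic: "symplectic_manifold M A \<Omega>"
    and connection: "symplectic_connection A \<Omega> \<Gamma>"
begin

lemma \<Omega>_tensor: "\<Omega> \<in> tensor_fields A 2"
  and \<Omega>_antisym: "c \<in> A \<Longrightarrow> p \<in> fst c \<Longrightarrow> \<Omega> c p [i, j] = - \<Omega> c p [j, i]"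
  and \<Omega>_invertible: "c \<in> A \<Longrightarrow> p \<in> fst c \<Longrightarrow> invertible (form_matrix \<Omega> c p)"
  using symplectic unfolding symplectic_manifold_def by blast+

lemma affine: "affine_connection A \<Gamma>"
  and \<Gamma>_sym: "c \<in> A \<Longrightarrow> p \<in> fst c \<Longrightarrow> \<Gamma> c p k i j = \<Gamma> c p k j i"
  and cov_\<Omega>: "c \<in> A \<Longrightarrow> p \<in> fst c \<Longrightarrow> cov \<Gamma> \<Omega> c p q [i, j] = 0"
  using connection unfolding symplectic_connection_def torsion_free_def by blast+

abbreviation "W \<equiv> omega_up \<Omega>"

lemma W_antisym: "c \<in> A \<Longrightarrow> p \<in> fst c \<Longrightarrow> W c p i j = - W c p j i"
  by (rule omega_up_antisym) (auto intro: \<Omega>_invertible \<Omega>_antisym)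

lemma W_inverse:
  assumes "c \<in> A" "p \<in> fst c"
  shows "(\<Sum>s\<in>UNIV. W c p i s * \<Omega> c p [s, j]) = (if i = j then - 1 else 0)"
proof -
  have "omega_up_matrix \<Omega> c p ** form_matrix \<Omega> c p = - mat 1"
    using \<Omega>_invertible assms by (simp add: omega_up_matrix_inverse)
  then have "(omega_up_matrix \<Omega> c p ** form_matrix \<Omega> c p) $ i $ j = (- mat 1 :: real^'n^'n) $ i $ j"
    by simp
  then show ?thesis
    by (simp add: matrix_matrix_mult_def omega_up_matrix_def form_matrix_def mat_def split: if_splits)
qed

lemma W_transform:
  assumes c: "c \<in> A" and c': "c' \<in> A" and p: "p \<in> fst c \<inter> fst c'"
  shows "(\<Sum>i\<in>UNIV. \<Sum>q\<in>UNIV. jac c c' j i p * W c' p i q * jac c c' s q p) = W c p j s"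
proof -
  define P where "P = (\<chi> j i. jac c c' j i p)"
  have "form_matrix \<Omega> c' p = transpose P ** (form_matrix \<Omega> c p ** P)"
    by (simp add: vec_eq_iff form_matrix_def tensor_fields_pullback [OF \<Omega>_tensor c c' p]
        pullback_Cons matrix_matrix_mult_def transpose_def P_def mult.commute)
  then have F: "form_matrix \<Omega> c' p = transpose P ** form_matrix \<Omega> c p ** P"
    by (simp add: matrix_mul_assoc)
  have inv: "invertible (form_matrix \<Omega> c p)" "invertible (form_matrix \<Omega> c' p)"
    using \<Omega>_invertible c c' p by simp_all
  have "P ** omega_up_matrix \<Omega> c' p ** transpose P = omega_up_matrix \<Omega> c p"
    by (rule minus_inverse_congruence [OF omega_up_matrix_inverse [OF inv(1)]
          omega_up_matrix_inverse [OF inv(2)] F])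
  then have "(P ** (omega_up_matrix \<Omega> c' p ** transpose P)) $ j $ s = omega_up_matrix \<Omega> c p $ j $ s"
    by (simp add: matrix_mul_assoc)
  then show ?thesis
    by (simp add: matrix_matrix_mult_def omega_up_matrix_def transpose_def P_def sum_distrib_left mult.assoc)
qed

text \<open>Raising the index of a covector gives a vector, in the inverse-free form that
\<open>contraction_pullback\<close> expects.\<close>

lemma raise_transform:
  assumes c: "c \<in> A" and c': "c' \<in> A" and p: "p \<in> fst c \<inter> fst c'"
    and x: "\<And>q. x' q = (\<Sum>s\<in>UNIV. jac c c' s q p * x s)"
  shows "(\<Sum>i\<in>UNIV. jac c c' j i p * (\<Sum>q\<in>UNIV. W c' p i q * x' q)) = (\<Sum>s\<in>UNIV. W c p j s * x s)"
proof -
  have "(\<Sum>i\<in>UNIV. jac c c' j i p * (\<Sum>q\<in>UNIV. W c' p i q * x' q))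
      = (\<Sum>i\<in>UNIV. \<Sum>q\<in>UNIV. \<Sum>s\<in>UNIV. jac c c' j i p * W c' p i q * jac c c' s q p * x s)"
    unfolding x sum_distrib_left by (simp add: mult.assoc)
  also have "\<dots> = (\<Sum>i\<in>UNIV. \<Sum>s\<in>UNIV. \<Sum>q\<in>UNIV. jac c c' j i p * W c' p i q * jac c c' s q p * x s)"
    by (intro sum.cong refl sum.swap)
  also have "\<dots> = (\<Sum>s\<in>UNIV. \<Sum>i\<in>UNIV. \<Sum>q\<in>UNIV. jac c c' j i p * W c' p i q * jac c c' s q p * x s)"
    by (rule sum.swap)
  also have "\<dots> = (\<Sum>s\<in>UNIV. W c p j s * x s)"
    by (simp add: W_transform [OF c c' p, symmetric] sum_distrib_right)
  finally show ?thesis .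
qed

text \<open>By Cramer's rule the entries are quotients of determinants of smooth functions.\<close>

lemma smooth_in_W:
  assumes c: "c \<in> A"
  shows "smooth_in c (\<lambda>p. W c p i j)"
proof -
  let ?F = "\<lambda>p. transpose (form_matrix \<Omega> c p)"
  let ?N = "\<lambda>p. \<chi> a b. if b = j then - (axis i 1 $ a) else ?F p $ a $ b"
  have W_eq: "W c p i j = det (?N p) / det (?F p)" if p: "p \<in> fst c" for p
  proof -
    have "(\<Sum>b\<in>UNIV. \<Omega> c p [b, a] * W c p i b) = - (axis i 1 $ a)" for a
      using W_inverse [OF c p, of i a] by (simp add: mult.commute axis_def)
    then have "?F p *v (\<chi> b. W c p i b) = (\<chi> a. - (axis i 1 $ a))"
      by (simp add: vec_eq_iff matrix_vector_mult_def transpose_def form_matrix_def)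
    moreover have "det (?F p) \<noteq> 0"
      using \<Omega>_invertible [OF c p] by (simp add: invertible_det_nz det_transpose)
    ultimately have "(\<chi> b. W c p i b) = (\<chi> k. det (\<chi> a b. if b = k then (\<chi> a. - (axis i 1 $ a)) $ a
        else ?F p $ a $ b) / det (?F p))"
      by (subst (asm) cramer)
    then have "(\<chi> b. W c p i b) $ j = (\<chi> k. det (\<chi> a b. if b = k then (\<chi> a. - (axis i 1 $ a)) $ a
        else ?F p $ a $ b) / det (?F p)) $ j"
      by (rule arg_cong)
    then show ?thesis by (simp cong: if_cong)
  qed
  have \<Omega>: "smooth_on (coord_image c) (\<lambda>x. in_coords c (\<lambda>p. \<Omega> c p I) x)" for I
    using tensor_fields_smooth [OF \<Omega>_tensor c] by (simp add: smooth_in_def)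
  have F_entry: "smooth_on (coord_image c) (\<lambda>x. ?F (inv_into (fst c) (snd c) x) $ a $ b)" for a b
    using \<Omega> by (simp add: transpose_def form_matrix_def in_coords_def)
  then have F: "smooth_in c (\<lambda>p. det (?F p))"
    unfolding smooth_in_def in_coords_def by (intro smooth_on_det open_coord_image c)
  have "smooth_on (coord_image c) (\<lambda>x. ?N (inv_into (fst c) (snd c) x) $ a $ b)" for a b
    using F_entry by (cases "b = j") simp_all
  then have N: "smooth_in c (\<lambda>p. det (?N p))"
    unfolding smooth_in_def in_coords_def by (intro smooth_on_det open_coord_image c)
  have "smooth_in c (\<lambda>p. det (?N p) / det (?F p))"
    unfolding smooth_in_def in_coords_simps
  proof (rule smooth_on_divide [OF open_coord_image [OF c]])
    show "smooth_on (coord_image c) (in_coords c (\<lambda>p. det (?N p)))"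
      "smooth_on (coord_image c) (in_coords c (\<lambda>p. det (?F p)))"
      using N F by (simp_all only: smooth_in_def)
    show "in_coords c (\<lambda>p. det (?F p)) x \<noteq> 0" if "x \<in> coord_image c" for x
      using that \<Omega>_invertible [OF c] c by (auto elim!: coord_imageE simp: invertible_det_nz det_transpose)
  qed
  then show ?thesis
    by (rule smooth_in_cong [OF c]) (simp add: W_eq)
qed

text \<open>Both brackets are covered at once; only the array \<open>X\<close> differs. Its first index is a
covariant index like those in \<open>L\<close>.\<close>

lemma contraction_sym_fields:
  assumes \<alpha>: "\<alpha> \<in> tensor_fields A k" and k: "0 < k"
    and X_zero: "\<And>c p q L. length L \<noteq> l \<Longrightarrow> X c p q L = 0"
    and X_smooth: "\<And>c q L. c \<in> A \<Longrightarrow> smooth_in c (\<lambda>p. X c p q L)"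
    and X_transform: "\<And>c c' p q L. c \<in> A \<Longrightarrow> c' \<in> A \<Longrightarrow> p \<in> fst c \<inter> fst c' \<Longrightarrow> length L = l \<Longrightarrow>
      X c' p q L = (\<Sum>s\<in>UNIV. jac c c' s q p * pullback (J c c' p) (X c p s) L)"
  shows "(\<lambda>c p. contraction k (W c p) (\<alpha> c p) (X c p)) \<in> sym_fields A (k - 1 + l)"
  unfolding contraction_def
proof (rule symmetrize_sym_fields)
  show "(\<Sum>r\<in>UNIV. \<alpha> c p (r # take (k - 1) I) * (\<Sum>q\<in>UNIV. W c p r q * X c p q (drop (k - 1) I))) = 0"
    if "\<not> (c \<in> A \<and> p \<in> fst c \<and> length I = k - 1 + l)" for c p I
  proof (cases "c \<in> A \<and> p \<in> fst c \<and> length (take (k - 1) I) = k - 1")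
    case True
    then have "length (drop (k - 1) I) \<noteq> l" using that by auto
    then show ?thesis by (simp add: X_zero)
  next
    case False
    then have "\<alpha> c p (r # take (k - 1) I) = 0" for r
      using k by (intro tensor_fields_zero [OF \<alpha>]) auto
    then show ?thesis by simp
  qed
  show "smooth_in c (\<lambda>p. \<Sum>r\<in>UNIV. \<alpha> c p (r # take (k - 1) I) *
      (\<Sum>q\<in>UNIV. W c p r q * X c p q (drop (k - 1) I)))" if "c \<in> A" for c I
    using that by (intro smooth_in_sum smooth_in_mult smooth_in_W X_smooth tensor_fields_smooth [OF \<alpha>])
  show "(\<Sum>r\<in>UNIV. \<alpha> c' p (r # take (k - 1) I) * (\<Sum>q\<in>UNIV. W c' p r q * X c' p q (drop (k - 1) I)))
    = pullback (J c c' p) (\<lambda>L. \<Sum>r\<in>UNIV. \<alpha> c p (r # take (k - 1) L) *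
        (\<Sum>q\<in>UNIV. W c p r q * X c p q (drop (k - 1) L))) I"
    if c: "c \<in> A" and c': "c' \<in> A" and p: "p \<in> fst c \<inter> fst c'" and I: "length I = k - 1 + l"
    for c c' p I
  proof -
    let ?K = "drop (k - 1) I"
    have "(\<Sum>i\<in>UNIV. J c c' p j i * (\<Sum>q\<in>UNIV. W c' p i q * X c' p q ?K))
        = (\<Sum>s\<in>UNIV. W c p j s * pullback (J c c' p) (X c p s) ?K)" for j
      using c c' p I by (intro raise_transform X_transform) auto
    also have "\<dots> j = pullback (J c c' p) (\<lambda>L. \<Sum>s\<in>UNIV. W c p j s * X c p s L) ?K" for j
      by (simp add: pullback_sum pullback_cmult)
    finally have V: "(\<Sum>i\<in>UNIV. J c c' p j i * (\<Sum>q\<in>UNIV. W c' p i q * X c' p q ?K))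
        = pullback (J c c' p) (\<lambda>L. \<Sum>s\<in>UNIV. W c p j s * X c p s L) ?K" for j .
    have "\<alpha> c' p (i # take (k - 1) I) = pullback (J c c' p) (\<alpha> c p) (i # take (k - 1) I)" for i
      using k I by (intro tensor_fields_pullback [OF \<alpha> c c' p]) auto
    from contraction_pullback [of "\<alpha> c' p", OF this V] show ?thesis
      using I by simp
  qed
qed

lemma smooth_in_cov:
  assumes \<alpha>: "\<alpha> \<in> tensor_fields A k" and c: "c \<in> A"
  shows "smooth_in c (\<lambda>p. cov \<Gamma> \<alpha> c p q I)"
proof -
  have "smooth_in c (\<lambda>p. \<Gamma> c p r i j)" for r i j
    using affine c by (simp add: affine_connection_def smooth_in_def)
  then show ?thesis
    unfolding cov_def using c tensor_fields_smooth [OF \<alpha> c]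
    by (intro smooth_in_diff smooth_in_sum smooth_in_mult smooth_in_pd)
qed

lemma cov_zero:
  assumes \<alpha>: "\<alpha> \<in> tensor_fields A k" and I: "length I \<noteq> k"
  shows "cov \<Gamma> \<alpha> c p q I = 0"
  using tensor_fields_zero [OF \<alpha>] I by (simp add: cov_def)

lemma contraction_cov_sym_fields:
  assumes "\<alpha> \<in> tensor_fields A k" "\<beta> \<in> tensor_fields A l" "0 < k"
  shows "(\<lambda>c p. contraction k (W c p) (\<alpha> c p) (cov \<Gamma> \<beta> c p)) \<in> sym_fields A (k + l - 1)"
proof -
  have "(\<lambda>c p. contraction k (W c p) (\<alpha> c p) (cov \<Gamma> \<beta> c p)) \<in> sym_fields A (k - 1 + l)"
    using assms by (intro contraction_sym_fields cov_zero smooth_in_cov cov_pullback affine)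
  with assms(3) show ?thesis by simp
qed

lemma alg_bracket_zero: "k = 0 \<or> l = 0 \<Longrightarrow> alg_bracket \<Omega> k l \<alpha> \<beta> = 0"
  by (auto simp: alg_bracket_contraction)

lemma alg_bracket_sym_fields:
  assumes \<alpha>: "\<alpha> \<in> tensor_fields A k" and \<beta>: "\<beta> \<in> tensor_fields A l"
  shows "alg_bracket \<Omega> k l \<alpha> \<beta> \<in> sym_fields A (k + l - 2)"
proof (cases "k = 0 \<or> l = 0")
  case True
  then show ?thesis by (simp add: alg_bracket_zero subspace_0 subspace_sym_fields)
next
  case False
  then have "(\<lambda>c p. contraction k (W c p) (\<alpha> c p) (\<lambda>q L. \<beta> c p (L @ [q]))) \<in> sym_fields A (k - 1 + (l - 1))"
  proof (intro contraction_sym_fields)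
    show "\<beta> c p (L @ [q]) = 0" if "length L \<noteq> l - 1" for c p q L
      using that False by (intro tensor_fields_zero [OF \<beta>]) auto
    show "\<beta> c' p (L @ [q]) = (\<Sum>s\<in>UNIV. jac c c' s q p * pullback (J c c' p) (\<lambda>L. \<beta> c p (L @ [s])) L)"
      if "c \<in> A" "c' \<in> A" "p \<in> fst c \<inter> fst c'" "length L = l - 1" for c c' p q L
      using tensor_fields_pullback [OF \<beta> that(1-3), of "L @ [q]"] that(4) False
      by (simp add: pullback_snoc)
  qed (use \<alpha> \<beta> tensor_fields_smooth in auto)
  moreover have "k - 1 + (l - 1) = k + l - 2" using False by simp
  ultimately show ?thesis
    by (simp add: alg_bracket_contraction subspace_scale subspace_sym_fields)
qed

lemma schouten_bracket_sym_fields: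
  assumes \<alpha>: "\<alpha> \<in> tensor_fields A k" and \<beta>: "\<beta> \<in> tensor_fields A l"
  shows "schouten_bracket \<Omega> \<Gamma> k l \<alpha> \<beta> \<in> sym_fields A (k + l - 1)"
proof -
  have *: "(- real k) *\<^sub>R (\<lambda>c p. contraction k (W c p) (\<alpha> c p) (cov \<Gamma> \<beta> c p)) \<in> sym_fields A (k + l - 1)"
    if "\<alpha> \<in> tensor_fields A k" "\<beta> \<in> tensor_fields A l" for k l \<alpha> \<beta>
    using contraction_cov_sym_fields [OF that]
    by (cases "k = 0") (simp_all only: subspace_0 subspace_scale subspace_sym_fields
        of_nat_0 minus_zero scaleR_zero_left neq0_conv simp_thms)
  have "schouten_bracket \<Omega> \<Gamma> k l \<alpha> \<beta>
      = (- real k) *\<^sub>R (\<lambda>c p. contraction k (W c p) (\<alpha> c p) (cov \<Gamma> \<beta> c p))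
        - (- real l) *\<^sub>R (\<lambda>c p. contraction l (W c p) (\<beta> c p) (cov \<Gamma> \<alpha> c p))"
    by (simp add: schouten_bracket_contraction)
  also have "\<dots> \<in> sym_fields A (k + l - 1)"
    using * [OF \<alpha> \<beta>] * [OF \<beta> \<alpha>] unfolding add.commute [of l k]
    by (rule subspace_diff [OF subspace_sym_fields])
  finally show ?thesis .
qed

lemma hat_bracket_S_hat:
  assumes "\<alpha> \<in> S_hat A" "\<beta> \<in> S_hat A"
  shows "hat_bracket \<Omega> \<Gamma> \<alpha> \<beta> \<in> S_hat A"
proof -
  have tensor: "\<alpha> k \<in> tensor_fields A k" "\<beta> k \<in> tensor_fields A k" for k
    using assms by (auto simp: S_hat_def sym_fields_tensor)
  have "alg_bracket \<Omega> k l (\<alpha> k) (\<beta> l) \<in> sym_fields A n" if "k + l = n + 2" for k l n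
    using alg_bracket_sym_fields [OF tensor, of k l] that by simp
  then have "hat_alg \<Omega> \<alpha> \<beta> n \<in> sym_fields A n" for n
    unfolding hat_alg_def by (auto intro!: subspace_sum subspace_sym_fields)
  moreover have "schouten_bracket \<Omega> \<Gamma> k l (\<alpha> k) (\<beta> l) \<in> sym_fields A n" if "k + l = n + 1" for k l n
    using schouten_bracket_sym_fields [OF tensor, of k l] that by simp
  then have "hat_schouten \<Omega> \<Gamma> \<alpha> \<beta> n \<in> sym_fields A n" for n
    unfolding hat_schouten_def by (auto intro!: subspace_sum subspace_sym_fields)
  ultimately show ?thesis
    by (simp add: S_hat_def hat_bracket_def subspace_add subspace_sym_fields)
qed

end

section \<open>Functions, exact one-forms and the condition defining the subalgebra\<close>

lemma sum_fun_apply: "(\<Sum>x\<in>X. F x) y = (\<Sum>x\<in>X. F x y)"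
  by (induction X rule: infinite_finite_induct) auto

lemma contraction_zero [simp]:
  "contraction k W 0 X = 0" "contraction k W (\<lambda>L. 0) X = 0"
  "contraction k W T 0 = 0" "contraction k W T (\<lambda>q L. 0) = 0"
  by (simp_all add: contraction_def symmetrize_def fun_eq_iff)

lemma cov_0 [simp]: "cov \<Gamma> 0 c p = 0"
  by (simp add: cov_def fun_eq_iff)

lemma bracket_zero_field [simp]:
  "alg_bracket \<Omega> k l 0 \<beta> = 0" "alg_bracket \<Omega> k l \<alpha> 0 = 0"
  "schouten_bracket \<Omega> \<Gamma> k l 0 \<beta> = 0" "schouten_bracket \<Omega> \<Gamma> k l \<alpha> 0 = 0"
  by (simp_all add: alg_bracket_contraction schouten_bracket_contraction fun_eq_iff scaleR_fun_def)

lemma sym_prod_zero [simp]: "sym_prod k l 0 \<beta> = 0" "sym_prod k l \<alpha> 0 = 0"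
  by (simp_all add: sym_prod_def symmetrize_def fun_eq_iff)

text \<open>Turns the sums over pairs of degrees into sums over the first degree.\<close>

lemma degree_pairs: "{(k, l). k + l = (n::nat)} = (\<lambda>k. (k, n - k)) ` {..n}"
  by (auto simp: image_iff)

lemma hat_alg_eq: "hat_alg \<Omega> \<alpha> \<beta> n = (\<Sum>k\<le>n + 2. alg_bracket \<Omega> k (n + 2 - k) (\<alpha> k) (\<beta> (n + 2 - k)))"
  unfolding hat_alg_def degree_pairs by (subst sum.reindex) (auto simp: inj_on_def)

lemma hat_schouten_eq: "hat_schouten \<Omega> \<Gamma> \<alpha> \<beta> n =
    (\<Sum>k\<le>n + 1. schouten_bracket \<Omega> \<Gamma> k (n + 1 - k) (\<alpha> k) (\<beta> (n + 1 - k)))"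
  unfolding hat_schouten_def degree_pairs by (subst sum.reindex) (auto simp: inj_on_def)

lemma hat_prod_eq: "hat_prod \<alpha> \<beta> n = (\<Sum>k\<le>n. sym_prod k (n - k) (\<alpha> k) (\<beta> (n - k)))"
  unfolding hat_prod_def degree_pairs by (subst sum.reindex) (auto simp: inj_on_def)

lemma sym_fields_mset:
  assumes "\<alpha> \<in> sym_fields A k" "mset I = mset K" "length K = k"
  shows "\<alpha> c p I = \<alpha> c p K"
proof -
  obtain \<sigma> where "\<sigma> permutes {..<length K}" "permute_list \<sigma> K = I"
    using assms(2) by (rule mset_eq_permutation)
  with assms(1,3) show ?thesis unfolding sym_fields_def by blast
qed

text \<open>Moving the one-form \<open>a\<close> from the left of \<open>W\<close> to its right costs a sign, as \<open>W\<close> is antisymmetric;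
the symmetric tensor \<open>T\<close> gives the same value whether its first or its last index is contracted.\<close>

lemma contraction_swap:
  assumes W: "\<And>r q. W r q = - W q r"
    and I: "length I = l - 1"
    and T: "\<And>L q. length L = l - 1 \<Longrightarrow> T (L @ [q]) = T (q # L)"
  shows "contraction 1 W a (\<lambda>q L. T (L @ [q])) I = - contraction l W T (\<lambda>q L. a (L @ [q])) I"
proof -
  have "(\<Sum>r\<in>UNIV. a [r] * (\<Sum>q\<in>UNIV. W r q * T (L @ [q])))
      = - (\<Sum>r\<in>UNIV. T (r # L) * (\<Sum>q\<in>UNIV. W r q * a [q]))" if "length L = l - 1" for L
  proof -
    have "(\<Sum>r\<in>UNIV. a [r] * (\<Sum>q\<in>UNIV. W r q * T (L @ [q])))
        = (\<Sum>r\<in>UNIV. \<Sum>q\<in>UNIV. - (T (q # L) * (W q r * a [r])))"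
      unfolding sum_distrib_left
      by (intro sum.cong refl) (subst W, simp add: T [OF that] mult_ac)
    also have "\<dots> = (\<Sum>q\<in>UNIV. \<Sum>r\<in>UNIV. - (T (q # L) * (W q r * a [r])))"
      by (rule sum.swap)
    finally show ?thesis by (simp add: sum_negf sum_distrib_left)
  qed
  then have "contraction 1 W a (\<lambda>q L. T (L @ [q])) I
      = symmetrize (\<lambda>L. - (\<Sum>r\<in>UNIV. T (r # take (l - 1) L) * (\<Sum>q\<in>UNIV. W r q * a (drop (l - 1) L @ [q])))) I"
    unfolding contraction_def by (intro symmetrize_cong) (simp add: I)
  then show ?thesis by (simp add: contraction_def symmetrize_def sum_negf)
qed

context manifold
begin

lemma subspace_S_hat: "subspace (S_hat A)"
  using subspace_sym_fields
  by (auto simp: subspace_def S_hat_def scaleR_fun_def)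

lemma S_hat_sym: "\<alpha> \<in> S_hat A \<Longrightarrow> \<alpha> k \<in> sym_fields A k"
  and S_hat_tensor: "\<alpha> \<in> S_hat A \<Longrightarrow> \<alpha> k \<in> tensor_fields A k"
  by (simp_all add: S_hat_def sym_fields_tensor)

lemma Cinf_smooth: "f \<in> Cinf A \<Longrightarrow> c \<in> A \<Longrightarrow> smooth_in c f"
  by (simp add: Cinf_def smooth_in_def)

lemma CinfI:
  "(\<And>p. p \<notin> \<Union> (fst ` A) \<Longrightarrow> f p = 0) \<Longrightarrow> (\<And>c. c \<in> A \<Longrightarrow> smooth_in c f) \<Longrightarrow> f \<in> Cinf A"
  by (simp add: Cinf_def smooth_in_def)

lemma chart_at: "p \<in> \<Union> (fst ` A) \<Longrightarrow> chart_at A p \<in> A \<and> p \<in> fst (chart_at A p)"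
  unfolding chart_at_def by (rule someI_ex) auto

lemma to_fun_eq:
  assumes \<alpha>: "\<alpha> \<in> tensor_fields A 0" and c: "c \<in> A" "p \<in> fst c"
  shows "to_fun A \<alpha> p = \<alpha> c p []"
proof -
  have p: "p \<in> \<Union> (fst ` A)" using c by auto
  then show ?thesis
    using tensor_fields_pullback [OF \<alpha>, of c "chart_at A p" p "[]"] chart_at [OF p] c
    by (simp add: to_fun_def)
qed

lemma to_fun_Cinf:
  assumes \<alpha>: "\<alpha> \<in> tensor_fields A 0"
  shows "to_fun A \<alpha> \<in> Cinf A"
proof (rule CinfI)
  show "to_fun A \<alpha> p = 0" if "p \<notin> \<Union> (fst ` A)" for p
    using that by (simp add: to_fun_def)
  show "smooth_in c (to_fun A \<alpha>)" if "c \<in> A" for c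
    using tensor_fields_smooth [OF \<alpha> that, of "[]"] by (rule smooth_in_cong [OF that]) (rule to_fun_eq [OF \<alpha> that, symmetric])
qed

lemma of_fun_sym_fields:
  assumes f: "f \<in> Cinf A"
  shows "of_fun A f \<in> sym_fields A 0"
proof -
  have "of_fun A f \<in> tensor_fields A 0"
  proof (rule tensor_fieldsI)
    show "smooth_in c (\<lambda>q. of_fun A f c q I)" if "c \<in> A" "length I = 0" for c I
      using Cinf_smooth [OF f that(1)] by (rule smooth_in_cong [OF that(1)]) (use that in \<open>simp add: of_fun_def\<close>)
  qed (auto simp: of_fun_def)
  then show ?thesis by (simp add: sym_fields_def)
qed

lemma to_fun_of_fun:
  assumes f: "f \<in> Cinf A"
  shows "to_fun A (of_fun A f) = f"
proof
  fix p
  show "to_fun A (of_fun A f) p = f p"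
    using chart_at [of p] f by (auto simp: to_fun_def of_fun_def Cinf_def)
qed

lemma of_fun_to_fun:
  assumes \<alpha>: "\<alpha> \<in> tensor_fields A 0"
  shows "of_fun A (to_fun A \<alpha>) = \<alpha>"
proof (intro ext)
  fix c p I
  show "of_fun A (to_fun A \<alpha>) c p I = \<alpha> c p I"
    using tensor_fields_zero [OF \<alpha>, of c p I] to_fun_eq [OF \<alpha>, of c p] by (auto simp: of_fun_def)
qed

lemma dform_sym_fields:
  assumes f: "f \<in> Cinf A"
  shows "dform A f \<in> sym_fields A 1"
proof -
  have "dform A f \<in> tensor_fields A 1"
  proof (rule tensor_fieldsI)
    show "smooth_in c (\<lambda>q. dform A f c q I)" if "c \<in> A" "length I = 1" for c I
      using smooth_in_pd [OF that(1) Cinf_smooth [OF f that(1)], of "hd I"]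
      by (rule smooth_in_cong [OF that(1)]) (use that in \<open>simp add: dform_def\<close>)
    show "dform A f c' p I = pullback (J c c' p) (dform A f c p) I"
      if c: "c \<in> A" and c': "c' \<in> A" and p: "p \<in> fst c \<inter> fst c'" and I: "length I = 1" for c c' p I
    proof -
      obtain i where "I = [i]" using I by (auto simp: length_Suc_conv)
      then show ?thesis
        using chain_rule [OF c c' p smooth_in_diff_in [OF c Cinf_smooth [OF f c]]] c c' p
        by (simp add: dform_def pullback_Cons)
    qed
  qed (auto simp: dform_def)
  moreover have "permute_list \<sigma> I = I" if "\<sigma> permutes {..<1::nat}" for \<sigma> and I :: "'n list"
    using that by (simp add: lessThan_Suc)
  ultimately show ?thesis
    unfolding sym_fields_def by simp
qed

lemma H_hat_S_hat: "\<alpha> \<in> H_hat A \<Longrightarrow> \<alpha> \<in> S_hat A"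
  by (simp add: H_hat_def)

lemma H_hat_dform: "\<alpha> \<in> H_hat A \<longleftrightarrow> \<alpha> \<in> S_hat A \<and> \<alpha> 1 = dform A (to_fun A (\<alpha> 0))"
  by (simp add: H_hat_def delta_star_def)

lemma pd_to_fun:
  assumes "\<alpha> \<in> tensor_fields A 0" "c \<in> A" "p \<in> fst c"
  shows "pd c i (to_fun A \<alpha>) p = pd c i (\<lambda>q. \<alpha> c q []) p"
  by (rule pd_cong [of c c]) (use assms to_fun_eq in auto)

text \<open>Off the charts and on index lists of other lengths both \<open>\<alpha>\<^sub>1\<close> and the differential of
\<open>\<alpha>\<^sub>0\<close> are zero, so comparing the remaining components suffices.\<close>

lemma H_hat_iff:
  assumes \<alpha>: "\<alpha> \<in> S_hat A"
  shows "\<alpha> \<in> H_hat A \<longleftrightarrow>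
    (\<forall>c\<in>A. \<forall>p\<in>fst c. \<forall>i. \<alpha> 1 c p [i] = pd c i (\<lambda>q. \<alpha> 0 c q []) p)"
proof -
  have "\<alpha> 1 = dform A (to_fun A (\<alpha> 0)) \<longleftrightarrow>
      (\<forall>c\<in>A. \<forall>p\<in>fst c. \<forall>i. \<alpha> 1 c p [i] = pd c i (to_fun A (\<alpha> 0)) p)"
  proof
    assume "\<alpha> 1 = dform A (to_fun A (\<alpha> 0))"
    then show "\<forall>c\<in>A. \<forall>p\<in>fst c. \<forall>i. \<alpha> 1 c p [i] = pd c i (to_fun A (\<alpha> 0)) p"
      by (simp add: dform_def)
  next
    assume *: "\<forall>c\<in>A. \<forall>p\<in>fst c. \<forall>i. \<alpha> 1 c p [i] = pd c i (to_fun A (\<alpha> 0)) p"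
    show "\<alpha> 1 = dform A (to_fun A (\<alpha> 0))"
    proof (intro ext)
      fix c p I
      show "\<alpha> 1 c p I = dform A (to_fun A (\<alpha> 0)) c p I"
      proof (cases "c \<in> A \<and> p \<in> fst c \<and> length I = 1")
        case True
        then obtain i where "I = [i]" by (auto simp: length_Suc_conv)
        with True * show ?thesis by (simp add: dform_def)
      next
        case False
        then show ?thesis
          using tensor_fields_zero [OF S_hat_tensor [OF \<alpha>]] by (auto simp: dform_def)
      qed
    qed
  qed
  then show ?thesis
    using \<alpha> by (simp add: H_hat_dform pd_to_fun S_hat_tensor)
qed

lemma H_hat_pd:
  "\<alpha> \<in> H_hat A \<Longrightarrow> c \<in> A \<Longrightarrow> p \<in> fst c \<Longrightarrow> \<alpha> 1 c p [i] = pd c i (\<lambda>q. \<alpha> 0 c q []) p"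
  using H_hat_iff H_hat_S_hat by blast

lemma diff_in_S_hat:
  "\<alpha> \<in> S_hat A \<Longrightarrow> c \<in> A \<Longrightarrow> p \<in> fst c \<Longrightarrow> diff_in c (\<lambda>q. \<alpha> k c q I) p"
  by (rule smooth_in_diff_in [OF _ tensor_fields_smooth [OF S_hat_tensor]])

lemma subspace_H_hat: "subspace (H_hat A)"
proof (rule subspaceI)
  show "0 \<in> H_hat A"
    using subspace_0 [OF subspace_S_hat] by (simp add: H_hat_iff)
  show "\<alpha> + \<beta> \<in> H_hat A" if "\<alpha> \<in> H_hat A" "\<beta> \<in> H_hat A" for \<alpha> \<beta>
  proof -
    have S: "\<alpha> \<in> S_hat A" "\<beta> \<in> S_hat A" using that by (auto simp: H_hat_S_hat)
    then have "\<alpha> + \<beta> \<in> S_hat A" using subspace_S_hat by (simp add: subspace_add)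
    then show ?thesis
      using S that by (simp add: H_hat_iff pd_add diff_in_S_hat)
  qed
  show "r *\<^sub>R \<alpha> \<in> H_hat A" if "\<alpha> \<in> H_hat A" for r \<alpha>
  proof -
    have S: "\<alpha> \<in> S_hat A" using that by (auto simp: H_hat_S_hat)
    then have "r *\<^sub>R \<alpha> \<in> S_hat A" using subspace_S_hat by (simp add: subspace_scale)
    then show ?thesis
      using S that by (simp add: H_hat_iff pd_cmult diff_in_S_hat scaleR_fun_def)
  qed
qed

lemma hat_prod_S_hat:
  assumes "\<alpha> \<in> S_hat A" "\<beta> \<in> S_hat A"
  shows "hat_prod \<alpha> \<beta> \<in> S_hat A"
  using assms unfolding S_hat_def hat_prod_def
  by (auto intro!: subspace_sum subspace_sym_fields sym_prod_sym_fields sym_fields_tensor)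

lemma hat_prod_0: "hat_prod \<alpha> \<beta> 0 c p [] = \<alpha> 0 c p [] * \<beta> 0 c p []"
  by (simp add: hat_prod_eq sym_prod_def)

lemma hat_prod_1:
  "hat_prod \<alpha> \<beta> 1 c p [i] = \<alpha> 0 c p [] * \<beta> 1 c p [i] + \<alpha> 1 c p [i] * \<beta> 0 c p []"
  by (simp add: hat_prod_eq sym_prod_def sum_fun_apply atMost_Suc)

text \<open>This is the Leibniz rule \<open>d(\<alpha>\<^sub>0 \<beta>\<^sub>0) = \<alpha>\<^sub>0 d\<beta>\<^sub>0 + \<beta>\<^sub>0 d\<alpha>\<^sub>0\<close>.\<close>

lemma hat_prod_H_hat:
  assumes \<alpha>: "\<alpha> \<in> H_hat A" and \<beta>: "\<beta> \<in> H_hat A"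
  shows "hat_prod \<alpha> \<beta> \<in> H_hat A"
proof -
  have S: "\<alpha> \<in> S_hat A" "\<beta> \<in> S_hat A" using assms by (auto simp: H_hat_S_hat)
  have "hat_prod \<alpha> \<beta> 1 c p [i] = pd c i (\<lambda>q. hat_prod \<alpha> \<beta> 0 c q []) p"
    if "c \<in> A" "p \<in> fst c" for c p i
    unfolding hat_prod_0 hat_prod_1 using S that
    by (simp add: pd_product diff_in_S_hat H_hat_pd [OF \<alpha>] H_hat_pd [OF \<beta>]
      del: One_nat_def)
  then show ?thesis
    using H_hat_iff [OF hat_prod_S_hat [OF S]] by blast
qed

end

context symplectic
begin

text \<open>The covariant derivative of a function is its differential, here \<open>\<beta>\<^sub>1\<close>. This puts the
arrays \<open>X\<close> of the Schouten bracket with \<open>\<beta>\<^sub>0\<close> and of the algebraic bracket with \<open>\<beta>\<^sub>1\<close> in the same form.\<close>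

lemma cov_0_H_hat:
  assumes \<beta>: "\<beta> \<in> H_hat A" and c: "c \<in> A" "p \<in> fst c"
  shows "cov \<Gamma> (\<beta> 0) c p = (\<lambda>q L. \<beta> 1 c p (L @ [q]))"
proof (intro ext)
  fix q L
  have S: "\<beta> \<in> S_hat A" using \<beta> by (rule H_hat_S_hat)
  show "cov \<Gamma> (\<beta> 0) c p q L = \<beta> 1 c p (L @ [q])"
  proof (cases L)
    case Nil
    then show ?thesis using H_hat_pd [OF \<beta> c] by (simp add: cov_def)
  next
    case (Cons i L')
    then show ?thesis
      using cov_zero [OF S_hat_tensor [OF S]] tensor_fields_zero [OF S_hat_tensor [OF S], of c p _ 1] by simp
  qed
qed

lemma contraction_off_chart:
  assumes "\<alpha> \<in> tensor_fields A k" "\<not> (c \<in> A \<and> p \<in> fst c)"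
  shows "contraction l V (\<alpha> c p) X = 0"
proof -
  have "\<alpha> c p = (\<lambda>L. 0)"
    by (rule ext, rule tensor_fields_zero [OF assms(1)]) (use assms(2) in blast)
  then show ?thesis by simp
qed

section \<open>The bracket in low degrees\<close>

text \<open>Both terms contract \<open>\<alpha>\<close> with the vector dual to \<open>d\<beta>\<^sub>0 = \<beta>\<^sub>1\<close>, with factors \<open>k\<close> and \<open>-k\<close>.\<close>

lemma exact_head_cancels_right:
  assumes \<alpha>: "\<alpha> \<in> sym_fields A k" and \<beta>: "\<beta> \<in> H_hat A"
  shows "alg_bracket \<Omega> k 1 \<alpha> (\<beta> 1) + schouten_bracket \<Omega> \<Gamma> k 0 \<alpha> (\<beta> 0) = 0"
proof -
  have "contraction k (W c p) (\<alpha> c p) (cov \<Gamma> (\<beta> 0) c p)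
      = contraction k (W c p) (\<alpha> c p) (\<lambda>q L. \<beta> 1 c p (L @ [q]))" for c p
    using cov_0_H_hat [OF \<beta>] contraction_off_chart [OF sym_fields_tensor [OF \<alpha>]] by metis
  then show ?thesis
    by (simp add: alg_bracket_contraction schouten_bracket_contraction)
qed

text \<open>Here the one-form \<open>d\<alpha>\<^sub>0 = \<alpha>\<^sub>1\<close> stands on different sides of \<open>\<Omega>\<^sup>r\<^sup>q\<close> in the two terms,
both of which have the factor \<open>l\<close>; the sign comes from \<open>contraction_swap\<close>.\<close>

lemma exact_head_cancels_left:
  assumes \<alpha>: "\<alpha> \<in> H_hat A" and \<beta>: "\<beta> \<in> sym_fields A l"
  shows "alg_bracket \<Omega> 1 l (\<alpha> 1) \<beta> + schouten_bracket \<Omega> \<Gamma> 0 l (\<alpha> 0) \<beta> = 0"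
    (is "?B = 0")
proof (cases "l = 0")
  case True
  then show ?thesis by (simp add: alg_bracket_zero schouten_bracket_contraction)
next
  case l: False
  have tensor: "\<alpha> k \<in> tensor_fields A k" for k
    using \<alpha> by (simp add: H_hat_S_hat S_hat_tensor)
  have \<beta>t: "\<beta> \<in> tensor_fields A l"
    using \<beta> by (rule sym_fields_tensor)
  \<comment> \<open>Off the charts and on index lists of other lengths the sum vanishes as a tensor field of rank \<open>l - 1\<close>.\<close>
  have "?B \<in> sym_fields A (l - 1)"
    using alg_bracket_sym_fields [OF tensor [of 1] \<beta>t] schouten_bracket_sym_fields [OF tensor [of 0] \<beta>t] l
    by (intro subspace_add subspace_sym_fields) simp_all
  then have B: "?B \<in> tensor_fields A (l - 1)" by (rule sym_fields_tensor)
  show ?thesis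
  proof (intro ext)
    fix c p I
    show "?B c p I = 0 c p I"
    proof (cases "c \<in> A \<and> p \<in> fst c \<and> length I = l - 1")
      case False
      then show ?thesis using tensor_fields_zero [OF B False] by simp
    next
      case True
      then have c: "c \<in> A" "p \<in> fst c" and I: "length I = l - 1" by auto
      have swap: "\<beta> c p (L @ [q]) = \<beta> c p (q # L)" if "length L = l - 1" for L q
        using that l by (intro sym_fields_mset [OF \<beta>]) auto
      have "contraction 1 (W c p) (\<alpha> 1 c p) (\<lambda>q L. \<beta> c p (L @ [q])) I
          = - contraction l (W c p) (\<beta> c p) (\<lambda>q L. \<alpha> 1 c p (L @ [q])) I"
        by (rule contraction_swap) (use W_antisym c swap I in blast)+
      then show ?thesis
        by (simp add: alg_bracket_contraction schouten_bracket_contraction scaleR_fun_def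
            cov_0_H_hat [OF \<alpha> c])
    qed
  qed
qed

lemma hat_bracket_0:
  assumes \<alpha>: "\<alpha> \<in> H_hat A" and \<beta>: "\<beta> \<in> H_hat A"
  shows "hat_bracket \<Omega> \<Gamma> \<alpha> \<beta> 0 = schouten_bracket \<Omega> \<Gamma> 1 0 (\<alpha> 1) (\<beta> 0)"
proof -
  have "hat_bracket \<Omega> \<Gamma> \<alpha> \<beta> 0 = alg_bracket \<Omega> 1 1 (\<alpha> 1) (\<beta> 1)
      + schouten_bracket \<Omega> \<Gamma> 0 1 (\<alpha> 0) (\<beta> 1) + schouten_bracket \<Omega> \<Gamma> 1 0 (\<alpha> 1) (\<beta> 0)"
    by (simp add: hat_bracket_def hat_alg_eq hat_schouten_eq eval_nat_numeral atMost_Suc alg_bracket_zero add_ac)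
  then show ?thesis
    using exact_head_cancels_left [OF \<alpha> S_hat_sym [OF H_hat_S_hat [OF \<beta>]], of 1] by simp
qed

lemma hat_bracket_1:
  assumes \<alpha>: "\<alpha> \<in> H_hat A" and \<beta>: "\<beta> \<in> H_hat A"
  shows "hat_bracket \<Omega> \<Gamma> \<alpha> \<beta> 1 = schouten_bracket \<Omega> \<Gamma> 1 1 (\<alpha> 1) (\<beta> 1)"
proof -
  have "hat_bracket \<Omega> \<Gamma> \<alpha> \<beta> 1 = (alg_bracket \<Omega> 1 2 (\<alpha> 1) (\<beta> 2)
      + schouten_bracket \<Omega> \<Gamma> 0 2 (\<alpha> 0) (\<beta> 2)) + (alg_bracket \<Omega> 2 1 (\<alpha> 2) (\<beta> 1)
      + schouten_bracket \<Omega> \<Gamma> 2 0 (\<alpha> 2) (\<beta> 0)) + schouten_bracket \<Omega> \<Gamma> 1 1 (\<alpha> 1) (\<beta> 1)"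
    by (simp add: hat_bracket_def hat_alg_eq hat_schouten_eq eval_nat_numeral atMost_Suc alg_bracket_zero add_ac)
  then show ?thesis
    using exact_head_cancels_left [OF \<alpha> S_hat_sym [OF H_hat_S_hat [OF \<beta>]], of 2]
      exact_head_cancels_right [OF S_hat_sym [OF H_hat_S_hat [OF \<alpha>]] \<beta>, of 2] by simp
qed

end

lemma matrix_add_rdistrib: "(A + B) ** C = A ** C + B ** (C :: real^'n^'n)"
  by (simp add: matrix_matrix_mult_def vec_eq_iff sum.distrib distrib_right)

lemma minus_matrix_vector_mult: "(- V) *v x = - (V *v (x :: real^'n))"
  by (simp add: matrix_vector_mult_def vec_eq_iff sum_negf)

lemma inner_antisym_matrix:
  fixes V :: "real^'n^'n"
  assumes "transpose V = - V"
  shows "x \<bullet> (V *v y) = - (y \<bullet> (V *v x))"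
proof -
  have "x \<bullet> (V *v y) = (transpose V *v x) \<bullet> y"
    by (metis dot_lmul_matrix transpose_matrix_vector)
  also have "\<dots> = - (y \<bullet> (V *v x))"
    by (simp add: assms inner_commute vector_scaleR_matrix_ac matrix_vector_mult_def inner_vec_def sum_negf)
  finally show ?thesis .
qed

context symplectic
begin

abbreviation "Wm \<equiv> omega_up_matrix \<Omega>"

lemma transpose_Wm: "c \<in> A \<Longrightarrow> p \<in> fst c \<Longrightarrow> transpose (Wm c p) = - Wm c p"
  by (simp add: transpose_def omega_up_matrix_def vec_eq_iff) (intro allI W_antisym)

lemma Wm_inverse:
  assumes "c \<in> A" "p \<in> fst c"
  shows "Wm c p ** form_matrix \<Omega> c p = - mat 1" and "form_matrix \<Omega> c p ** Wm c p = - mat 1"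
proof -
  show "Wm c p ** form_matrix \<Omega> c p = - mat 1"
    using \<Omega>_invertible assms by (simp add: omega_up_matrix_inverse)
  then show "form_matrix \<Omega> c p ** Wm c p = - mat 1"
    by (subst matrix_minus_inverse_commute)
qed

text \<open>This is \<open>\<nabla>\<Omega>\<^sup>r\<^sup>q = 0\<close>. It follows from \<open>\<nabla>\<Omega> = 0\<close> by differentiating \<open>\<Omega>\<^sup>r\<^sup>s \<Omega>\<^sub>s\<^sub>j = -\<delta>\<^sup>r\<^sub>j\<close>.\<close>

lemma pd_W:
  fixes i :: 'n
  assumes c: "c \<in> A" and p: "p \<in> fst c"
  defines "V \<equiv> Wm c p" and "G \<equiv> (\<chi> t s. \<Gamma> c p t i s)"
  shows "(\<chi> r q. pd c i (\<lambda>x. W c x r q) p) = - (V ** transpose G) - G ** V"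
proof -
  let ?O = "form_matrix \<Omega> c p"
  let ?DW = "\<chi> r q. pd c i (\<lambda>x. W c x r q) p"
  let ?DO = "\<chi> s j. pd c i (\<lambda>x. \<Omega> c x [s, j]) p"
  have diff: "diff_in c (\<lambda>x. W c x r q) p" "diff_in c (\<lambda>x. \<Omega> c x I) p" for r q I
    using c p by (auto intro: smooth_in_diff_in smooth_in_W tensor_fields_smooth [OF \<Omega>_tensor])
  have "pd c i (\<lambda>x. \<Sum>s\<in>UNIV. W c x r s * \<Omega> c x [s, j]) p = pd c i (\<lambda>x. if r = j then - 1 else 0) p" for r j
    by (rule pd_cong [OF c c]) (use p W_inverse [OF c] in auto)
  then have "(\<Sum>s\<in>UNIV. pd c i (\<lambda>x. W c x r s) p * \<Omega> c p [s, j] + W c p r s * pd c i (\<lambda>x. \<Omega> c x [s, j]) p) = 0"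
    for r j
    using c p by (simp add: pd_sum pd_product diff diff_in_mult)
  then have "?DW ** ?O + V ** ?DO = 0"
    by (simp add: vec_eq_iff matrix_matrix_mult_def form_matrix_def V_def omega_up_matrix_def sum.distrib)
  \<comment> \<open>Multiplying by \<open>V\<close> on the right removes \<open>?O\<close>, up to the sign.\<close>
  then have "(?DW ** ?O + V ** ?DO) ** V = 0"
    by (simp add: matrix_matrix_mult_def vec_eq_iff)
  then have "?DW ** (?O ** V) + V ** ?DO ** V = 0"
    by (simp add: matrix_add_rdistrib matrix_mul_assoc)
  moreover have OV: "?O ** V = - mat 1" and VO: "V ** ?O = - mat 1"
    unfolding V_def using Wm_inverse c p by auto
  ultimately have DW: "?DW = V ** ?DO ** V"
    by (simp add: matrix_mult_minus)
  have "?DO = transpose G ** ?O + ?O ** G"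
    using cov_\<Omega> [OF c p, of i]
    by (simp add: vec_eq_iff cov_christoffel_term christoffel_term_Cons matrix_matrix_mult_def
        transpose_def form_matrix_def G_def mult.commute)
  then have "V ** ?DO ** V = V ** transpose G ** (?O ** V) + (V ** ?O) ** G ** V"
    by (simp add: matrix_add_ldistrib matrix_add_rdistrib matrix_mul_assoc)
  then show ?thesis
    by (simp add: DW OV VO matrix_mult_minus minus_matrix_mult)
qed

lemma hat_bracket_0_eq:
  assumes \<alpha>: "\<alpha> \<in> H_hat A" and \<beta>: "\<beta> \<in> H_hat A" and c: "c \<in> A" and p: "p \<in> fst c"
  shows "hat_bracket \<Omega> \<Gamma> \<alpha> \<beta> 0 c p []
    = - (\<Sum>r\<in>UNIV. \<alpha> 1 c p [r] * (\<Sum>q\<in>UNIV. W c p r q * \<beta> 1 c p [q]))"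
  by (simp add: hat_bracket_0 [OF \<alpha> \<beta>] schouten_bracket_contraction scaleR_fun_def contraction_def
      cov_0_H_hat [OF \<beta> c p])

lemma hat_bracket_1_eq:
  "hat_bracket \<Omega> \<Gamma> \<alpha> \<beta> 1 c p [i]
    = - (\<Sum>r\<in>UNIV. \<alpha> 1 c p [r] * (\<Sum>q\<in>UNIV. W c p r q * cov \<Gamma> (\<beta> 1) c p q [i]))
      + (\<Sum>r\<in>UNIV. \<beta> 1 c p [r] * (\<Sum>q\<in>UNIV. W c p r q * cov \<Gamma> (\<alpha> 1) c p q [i]))"
  if "\<alpha> \<in> H_hat A" "\<beta> \<in> H_hat A"
  by (simp add: hat_bracket_1 [OF that, simplified] schouten_bracket_contraction scaleR_fun_def contraction_def)

lemma sum_inner_Wm: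
  "(\<Sum>r\<in>UNIV. a r * (\<Sum>q\<in>UNIV. W c p r q * b q)) = (\<chi> r. a r) \<bullet> (Wm c p *v (\<chi> q. b q))"
  by (simp add: inner_vec_def matrix_vector_mult_def omega_up_matrix_def)

lemma pd_H_hat_commute:
  assumes \<alpha>: "\<alpha> \<in> H_hat A" and c: "c \<in> A" and p: "p \<in> fst c"
  shows "pd c i (\<lambda>x. \<alpha> 1 c x [j]) p = pd c j (\<lambda>x. \<alpha> 1 c x [i]) p"
proof -
  have "pd c i (\<lambda>x. \<alpha> 1 c x [j]) p = pd c i (pd c j (\<lambda>x. \<alpha> 0 c x [])) p" for i j
    by (rule pd_cong [OF c c]) (use p H_hat_pd [OF \<alpha> c] in auto)
  moreover have "smooth_in c (\<lambda>x. \<alpha> 0 c x [])"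
    by (rule tensor_fields_smooth [OF S_hat_tensor [OF H_hat_S_hat [OF \<alpha>]] c])
  ultimately show ?thesis
    using pd_commute [OF c _ p] by metis
qed

text \<open>For a closed one-form and a torsion-free connection \<open>\<nabla>\<^sub>q \<alpha>\<^sub>i\<close> is symmetric; the right side is
\<open>\<nabla>\<^sub>i \<alpha>\<^sub>q\<close>.\<close>

lemma cov_H_hat:
  assumes \<alpha>: "\<alpha> \<in> H_hat A" and c: "c \<in> A" and p: "p \<in> fst c"
  shows "(\<chi> q. cov \<Gamma> (\<alpha> 1) c p q [i])
    = (\<chi> q. pd c i (\<lambda>x. \<alpha> 1 c x [q]) p) - transpose (\<chi> t s. \<Gamma> c p t i s) *v (\<chi> t. \<alpha> 1 c p [t])"
  using \<Gamma>_sym [OF c p]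
  by (simp add: vec_eq_iff cov_christoffel_term christoffel_term_Cons matrix_vector_mult_def transpose_def
      pd_H_hat_commute [OF \<alpha> c p, of i] del: One_nat_def)

text \<open>Writing \<open>V\<close> for the matrix \<open>\<Omega>\<^sup>r\<^sup>q\<close>, \<open>G\<close> for \<open>\<Gamma>\<^sup>t\<^sub>i\<^sub>s\<close> with \<open>i\<close> fixed, \<open>a, b\<close> for \<open>\<alpha>\<^sub>1, \<beta>\<^sub>1\<close> at a point and \<open>a', b'\<close>, \<open>V'\<close>
for derivatives in the \<open>i\<close>-th coordinate, the degree 1 component of the bracket is
\<open>- a \<bullet> V (b' - G\<^sup>T b) + b \<bullet> V (a' - G\<^sup>T a)\<close>, and the derivative of the degree 0 component is
\<open>- (a' \<bullet> V b + a \<bullet> V' b + a \<bullet> V b')\<close> with \<open>V' = - V G\<^sup>T - G V\<close> by \<open>pd_W\<close>. They agree as \<open>V\<close> is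
antisymmetric.\<close>

lemma hat_bracket_H_hat:
  assumes \<alpha>: "\<alpha> \<in> H_hat A" and \<beta>: "\<beta> \<in> H_hat A"
  shows "hat_bracket \<Omega> \<Gamma> \<alpha> \<beta> \<in> H_hat A"
proof -
  have S: "\<alpha> \<in> S_hat A" "\<beta> \<in> S_hat A" using assms by (auto simp: H_hat_S_hat)
  have "hat_bracket \<Omega> \<Gamma> \<alpha> \<beta> 1 c p [i] = pd c i (\<lambda>q. hat_bracket \<Omega> \<Gamma> \<alpha> \<beta> 0 c q []) p"
    if c: "c \<in> A" and p: "p \<in> fst c" for c p i
  proof -
    define a where "a = (\<chi> r. \<alpha> 1 c p [r])"
    define b where "b = (\<chi> r. \<beta> 1 c p [r])"
    define a' where "a' = (\<chi> r. pd c i (\<lambda>x. \<alpha> 1 c x [r]) p)"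
    define b' where "b' = (\<chi> r. pd c i (\<lambda>x. \<beta> 1 c x [r]) p)"
    define V where "V = Wm c p"
    define G where "G = (\<chi> t s. \<Gamma> c p t i s)"
    have V: "transpose V = - V" using c p by (simp add: V_def transpose_Wm)
    have diff: "diff_in c (\<lambda>x. W c x r q) p" "diff_in c (\<lambda>x. \<alpha> k c x I) p" "diff_in c (\<lambda>x. \<beta> k c x I) p"
      for r q I k
      using c p S by (auto intro: smooth_in_diff_in smooth_in_W diff_in_S_hat)
    have "pd c i (\<lambda>q. hat_bracket \<Omega> \<Gamma> \<alpha> \<beta> 0 c q []) p
        = pd c i (\<lambda>x. - (\<Sum>r\<in>UNIV. \<alpha> 1 c x [r] * (\<Sum>q\<in>UNIV. W c x r q * \<beta> 1 c x [q]))) p"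
      by (rule pd_cong [OF c c]) (use p hat_bracket_0_eq [OF \<alpha> \<beta> c] in auto)
    also have "\<dots> = - (\<Sum>r\<in>UNIV. pd c i (\<lambda>x. \<alpha> 1 c x [r]) p * (\<Sum>q\<in>UNIV. W c p r q * \<beta> 1 c p [q])
        + \<alpha> 1 c p [r] * (\<Sum>q\<in>UNIV. pd c i (\<lambda>x. W c x r q) p * \<beta> 1 c p [q]
          + W c p r q * pd c i (\<lambda>x. \<beta> 1 c x [q]) p))"
      using c p by (simp add: pd_minus pd_sum pd_product diff diff_in_mult diff_in_sum del: One_nat_def)
    also have "\<dots> = - (a' \<bullet> (V *v b) + a \<bullet> ((\<chi> r q. pd c i (\<lambda>x. W c x r q) p) *v b) + a \<bullet> (V *v b'))"
      by (simp add: a_def b_def a'_def b'_def V_def inner_vec_def matrix_vector_mult_def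
          omega_up_matrix_def sum.distrib distrib_left del: One_nat_def)
    also have "(\<chi> r q. pd c i (\<lambda>x. W c x r q) p) = - (V ** transpose G) - G ** V"
      unfolding V_def G_def by (rule pd_W [OF c p])
    also have "a \<bullet> ((- (V ** transpose G) - G ** V) *v b)
        = - (a \<bullet> (V *v (transpose G *v b))) - (transpose G *v a) \<bullet> (V *v b)"
    proof -
      have "(- (V ** transpose G) - G ** V) *v b = - (V *v (transpose G *v b)) - G *v (V *v b)"
        by (simp only: matrix_vector_mult_diff_rdistrib minus_matrix_vector_mult matrix_vector_mul_assoc)
      moreover have "(transpose G *v a) \<bullet> (V *v b) = a \<bullet> (G *v (V *v b))"
        by (simp only: transpose_matrix_vector dot_lmul_matrix)
      ultimately show ?thesis by (simp only: inner_diff_right inner_minus_right)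
    qed
    also have "- (a' \<bullet> (V *v b) + (- (a \<bullet> (V *v (transpose G *v b))) - (transpose G *v a) \<bullet> (V *v b))
          + a \<bullet> (V *v b'))
        = - (a \<bullet> (V *v (b' - transpose G *v b))) + b \<bullet> (V *v (a' - transpose G *v a))"
      using inner_antisym_matrix [OF V, of b a'] inner_antisym_matrix [OF V, of b "transpose G *v a"]
      by (simp add: matrix_vector_mult_diff_distrib inner_diff_right)
    also have "\<dots> = hat_bracket \<Omega> \<Gamma> \<alpha> \<beta> 1 c p [i]"
      unfolding hat_bracket_1_eq [OF \<alpha> \<beta>] sum_inner_Wm cov_H_hat [OF \<alpha> c p] cov_H_hat [OF \<beta> c p]
      by (simp add: a_def b_def a'_def b'_def V_def G_def)
    finally show ?thesis by simp
  qed
  then show ?thesis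
    using H_hat_iff [OF hat_bracket_S_hat [OF S]] by blast
qed

text \<open>The algebraic bracket lowers the total degree by two and the Schouten bracket by one, so
every summand in degree \<open>n\<close> contains a vanishing component.\<close>

lemma hat_bracket_low_degree:
  assumes "\<And>i. i < k \<Longrightarrow> \<alpha> i = 0" "\<And>i. i < l \<Longrightarrow> \<beta> i = 0" "n + 2 < k + l"
  shows "hat_bracket \<Omega> \<Gamma> \<alpha> \<beta> n = 0"
proof -
  have "alg_bracket \<Omega> j (n + 2 - j) (\<alpha> j) (\<beta> (n + 2 - j)) = 0" if "j \<le> n + 2" for j
    using assms that by (cases "j < k") auto
  moreover have "schouten_bracket \<Omega> \<Gamma> j (n + 1 - j) (\<alpha> j) (\<beta> (n + 1 - j)) = 0" if "j \<le> n + 1" for j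
    using assms that by (cases "j < k") auto
  ultimately show ?thesis
    by (simp add: hat_bracket_def hat_alg_eq hat_schouten_eq)
qed

lemma hat_bracket_H_hat_ge:
  assumes \<alpha>: "\<alpha> \<in> H_hat_ge A k" and \<beta>: "\<beta> \<in> H_hat_ge A l"
  shows "hat_bracket \<Omega> \<Gamma> \<alpha> \<beta> \<in> H_hat_ge A (k + l - 2)"
  using assms hat_bracket_H_hat hat_bracket_low_degree [of k \<alpha> l \<beta>]
  by (simp add: H_hat_ge_def)

text \<open>Degree counting alone bounds the degree from below only by \<open>l - 2\<close>. In
degree \<open>l - 2\<close> the only candidate is the algebraic bracket with \<open>\<alpha>\<^sub>0\<close>, which vanishes. In degree \<open>l - 1\<close> the terms
with \<open>\<alpha>\<^sub>1\<close> and \<open>\<alpha>\<^sub>0\<close> remain, and they cancel because \<open>\<alpha>\<^sub>1\<close> is exact.\<close>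

lemma hat_bracket_ideal_right:
  assumes \<alpha>: "\<alpha> \<in> H_hat A" and \<beta>: "\<beta> \<in> H_hat_ge A l"
  shows "hat_bracket \<Omega> \<Gamma> \<alpha> \<beta> \<in> H_hat_ge A l"
proof -
  have \<beta>H: "\<beta> \<in> H_hat A" and \<beta>0: "\<And>i. i < l \<Longrightarrow> \<beta> i = 0"
    using \<beta> by (auto simp: H_hat_ge_def)
  have "hat_bracket \<Omega> \<Gamma> \<alpha> \<beta> n = 0" if n: "n < l" for n
  proof -
    have alg: "alg_bracket \<Omega> j (n + 2 - j) (\<alpha> j) (\<beta> (n + 2 - j)) = 0" if "j \<le> n + 2" "j \<noteq> 1 \<or> n + 1 < l" for j
    proof -
      have "j = 0 \<or> n + 2 - j < l" using that n by auto
      then show ?thesis by (auto simp: \<beta>0 alg_bracket_zero)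
    qed
    have sch: "schouten_bracket \<Omega> \<Gamma> j (n + 1 - j) (\<alpha> j) (\<beta> (n + 1 - j)) = 0" if "j \<le> n + 1" "j \<noteq> 0 \<or> n + 1 < l" for j
    proof -
      have "n + 1 - j < l" using that n by auto
      then show ?thesis by (simp only: \<beta>0 bracket_zero_field)
    qed
    show ?thesis
    proof (cases "n + 1 < l")
      case True
      then show ?thesis
        using alg sch by (simp add: hat_bracket_def hat_alg_eq hat_schouten_eq)
    next
      case False
      with n have l: "l = n + 1" by simp
      have "hat_alg \<Omega> \<alpha> \<beta> n = (\<Sum>j\<in>{1}. alg_bracket \<Omega> j (n + 2 - j) (\<alpha> j) (\<beta> (n + 2 - j)))"
        unfolding hat_alg_eq by (rule sum.mono_neutral_right) (use alg l in auto)
      moreover have "hat_schouten \<Omega> \<Gamma> \<alpha> \<beta> n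
          = (\<Sum>j\<in>{0}. schouten_bracket \<Omega> \<Gamma> j (n + 1 - j) (\<alpha> j) (\<beta> (n + 1 - j)))"
        unfolding hat_schouten_eq by (rule sum.mono_neutral_right) (use sch l in auto)
      ultimately have "hat_bracket \<Omega> \<Gamma> \<alpha> \<beta> n = alg_bracket \<Omega> 1 l (\<alpha> 1) (\<beta> l) + schouten_bracket \<Omega> \<Gamma> 0 l (\<alpha> 0) (\<beta> l)"
        using l by (simp add: hat_bracket_def)
      then show ?thesis
        using exact_head_cancels_left [OF \<alpha> S_hat_sym [OF H_hat_S_hat [OF \<beta>H]]] by simp
    qed
  qed
  then show ?thesis
    using hat_bracket_H_hat [OF \<alpha> \<beta>H] by (simp add: H_hat_ge_def)
qed

lemma hat_bracket_ideal_left: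
  assumes \<alpha>: "\<alpha> \<in> H_hat A" and \<beta>: "\<beta> \<in> H_hat_ge A l"
  shows "hat_bracket \<Omega> \<Gamma> \<beta> \<alpha> \<in> H_hat_ge A l"
proof -
  have \<beta>H: "\<beta> \<in> H_hat A" and \<beta>0: "\<And>i. i < l \<Longrightarrow> \<beta> i = 0"
    using \<beta> by (auto simp: H_hat_ge_def)
  have "hat_bracket \<Omega> \<Gamma> \<beta> \<alpha> n = 0" if n: "n < l" for n
  proof -
    have alg: "alg_bracket \<Omega> j (n + 2 - j) (\<beta> j) (\<alpha> (n + 2 - j)) = 0" if "j \<le> n + 2" "j \<noteq> l \<or> n + 1 < l" for j
    proof -
      have "n + 2 - j = 0 \<or> j < l" using that n by auto
      then show ?thesis by (auto simp: \<beta>0 alg_bracket_zero)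
    qed
    have sch: "schouten_bracket \<Omega> \<Gamma> j (n + 1 - j) (\<beta> j) (\<alpha> (n + 1 - j)) = 0" if "j \<le> n + 1" "j \<noteq> l \<or> n + 1 < l" for j
    proof -
      have "j < l" using that n by auto
      then show ?thesis by (simp only: \<beta>0 bracket_zero_field)
    qed
    show ?thesis
    proof (cases "n + 1 < l")
      case True
      then show ?thesis
        using alg sch by (simp add: hat_bracket_def hat_alg_eq hat_schouten_eq)
    next
      case False
      with n have l: "l = n + 1" by simp
      have "hat_alg \<Omega> \<beta> \<alpha> n = (\<Sum>j\<in>{l}. alg_bracket \<Omega> j (n + 2 - j) (\<beta> j) (\<alpha> (n + 2 - j)))"
        unfolding hat_alg_eq by (rule sum.mono_neutral_right) (use alg l in auto)
      moreover have "hat_schouten \<Omega> \<Gamma> \<beta> \<alpha> n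
          = (\<Sum>j\<in>{l}. schouten_bracket \<Omega> \<Gamma> j (n + 1 - j) (\<beta> j) (\<alpha> (n + 1 - j)))"
        unfolding hat_schouten_eq by (rule sum.mono_neutral_right) (use sch l in auto)
      ultimately have "hat_bracket \<Omega> \<Gamma> \<beta> \<alpha> n = alg_bracket \<Omega> l 1 (\<beta> l) (\<alpha> 1) + schouten_bracket \<Omega> \<Gamma> l 0 (\<beta> l) (\<alpha> 0)"
        using l by (simp add: hat_bracket_def)
      then show ?thesis
        using exact_head_cancels_right [OF S_hat_sym [OF H_hat_S_hat [OF \<beta>H]] \<alpha>] by simp
    qed
  qed
  then show ?thesis
    using hat_bracket_H_hat [OF \<beta>H \<alpha>] by (simp add: H_hat_ge_def)
qed

end

section \<open>The exact sequence and its splitting\<close>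

lemma to_fun_add: "to_fun A (\<alpha> + \<beta>) = to_fun A \<alpha> + to_fun A \<beta>"
  by (simp add: to_fun_def fun_eq_iff)

lemma to_fun_scaleR: "to_fun A (r *\<^sub>R \<alpha>) = r *\<^sub>R to_fun A \<alpha>"
  by (simp add: to_fun_def fun_eq_iff scaleR_fun_def)

lemma to_fun_zero [simp]: "to_fun A 0 = 0"
  by (simp add: to_fun_def fun_eq_iff)

lemma of_fun_zero [simp]: "of_fun A 0 = 0"
  by (simp add: of_fun_def fun_eq_iff)

lemma dform_zero [simp]: "dform A 0 = 0"
  by (simp add: dform_def fun_eq_iff zero_fun_def)

lemma proj_fun_add: "proj_fun A (\<alpha> + \<beta>) = proj_fun A \<alpha> + proj_fun A \<beta>"
  by (simp add: proj_fun_def to_fun_add)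

lemma proj_fun_scaleR: "proj_fun A (r *\<^sub>R \<alpha>) = r *\<^sub>R proj_fun A \<alpha>"
proof -
  have "(r *\<^sub>R \<alpha>) 0 = r *\<^sub>R \<alpha> 0" by (simp add: scaleR_fun_def)
  then show ?thesis by (simp add: proj_fun_def to_fun_scaleR)
qed

lemma iota_0: "iota A f 0 = of_fun A (- f)"
  and iota_1: "iota A f 1 = - dform A f"
  and iota_ge_2: "i \<ge> 2 \<Longrightarrow> iota A f i = 0"
  by (simp_all add: iota_def in_degree_def delta_star_def)

context manifold
begin

lemma Cinf_minus: "f \<in> Cinf A \<Longrightarrow> - f \<in> Cinf A"
  by (rule CinfI) (auto simp: Cinf_def fun_Compl_def smooth_in_def intro!: smooth_in_minus [unfolded smooth_in_def])

lemma dform_minus: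
  assumes f: "f \<in> Cinf A"
  shows "dform A (- f) = - dform A f"
proof -
  have "pd c i (- f) p = - pd c i f p" if "c \<in> A" "p \<in> fst c" for c i p
    using pd_minus [OF smooth_in_diff_in [OF that(1) Cinf_smooth [OF f that(1)] that(2)]]
    by (simp add: fun_Compl_def)
  then show ?thesis by (simp add: dform_def fun_eq_iff)
qed

lemma proj_fun_Cinf: "\<alpha> \<in> H_hat A \<Longrightarrow> proj_fun A \<alpha> \<in> Cinf A"
  unfolding proj_fun_def by (intro Cinf_minus to_fun_Cinf S_hat_tensor H_hat_S_hat)

lemma iota_H_hat:
  assumes f: "f \<in> Cinf A"
  shows "iota A f \<in> H_hat A"
proof -
  have "iota A f k \<in> sym_fields A k" for k
  proof (cases "k \<ge> 2")
    case True
    then show ?thesis using subspace_0 [OF subspace_sym_fields] by (simp add: iota_ge_2)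
  next
    case False
    then have "k = 0 \<or> k = 1" by auto
    then show ?thesis
      using of_fun_sym_fields [OF Cinf_minus [OF f]] dform_sym_fields [OF f] subspace_neg [OF subspace_sym_fields]
      by (auto simp: iota_0 iota_1 simp del: One_nat_def)
  qed
  then show ?thesis
    using f by (simp add: H_hat_dform S_hat_def iota_0 iota_1 to_fun_of_fun Cinf_minus dform_minus del: One_nat_def)
qed

lemma proj_iota: "f \<in> Cinf A \<Longrightarrow> proj_fun A (iota A f) = f"
  by (simp add: proj_fun_def iota_0 to_fun_of_fun Cinf_minus)

text \<open>An element of \<open>H_hat A\<close> is determined in degrees 0 and 1 by its projection.\<close>

lemma iota_proj_low_degree:
  assumes \<alpha>: "\<alpha> \<in> H_hat A" and i: "i < 2"
  shows "iota A (proj_fun A \<alpha>) i = \<alpha> i"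
proof -
  have t: "\<alpha> 0 \<in> tensor_fields A 0"
    using \<alpha> by (intro S_hat_tensor H_hat_S_hat)
  have "iota A (proj_fun A \<alpha>) 0 = \<alpha> 0"
    by (simp add: iota_0 proj_fun_def of_fun_to_fun [OF t])
  moreover have "iota A (proj_fun A \<alpha>) 1 = \<alpha> 1"
    using \<alpha> by (simp add: iota_1 proj_fun_def dform_minus [OF to_fun_Cinf [OF t]] H_hat_dform del: One_nat_def)
  moreover have "i = 0 \<or> i = 1" using i by auto
  ultimately show ?thesis by auto
qed

lemma iota_image: "iota A ` Cinf A = {\<alpha> \<in> H_hat A. \<forall>i\<ge>2. \<alpha> i = 0}"
proof
  show "iota A ` Cinf A \<subseteq> {\<alpha> \<in> H_hat A. \<forall>i\<ge>2. \<alpha> i = 0}"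
    by (auto simp: iota_H_hat iota_ge_2)
  show "{\<alpha> \<in> H_hat A. \<forall>i\<ge>2. \<alpha> i = 0} \<subseteq> iota A ` Cinf A"
  proof
    fix \<alpha> assume *: "\<alpha> \<in> {\<alpha> \<in> H_hat A. \<forall>i\<ge>2. \<alpha> i = 0}"
    then have "iota A (proj_fun A \<alpha>) i = \<alpha> i" for i
      using iota_proj_low_degree [of \<alpha> i] by (cases "i < 2") (auto simp: iota_ge_2)
    then have "\<alpha> = iota A (proj_fun A \<alpha>)" by (simp add: fun_eq_iff)
    with * show "\<alpha> \<in> iota A ` Cinf A" using proj_fun_Cinf by blast
  qed
qed

text \<open>Elements of the image of \<open>iota\<close> are recovered from their projection; identities between
them can therefore be checked after applying \<open>proj_fun\<close>.\<close>

lemma iota_proj: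
  assumes "\<alpha> \<in> iota A ` Cinf A"
  shows "iota A (proj_fun A \<alpha>) = \<alpha>"
  using assms proj_iota by auto

lemma subspace_iota_image: "subspace (iota A ` Cinf A)"
proof -
  have eq: "{\<alpha> \<in> H_hat A. \<forall>i\<ge>2. \<alpha> i = 0} = H_hat A \<inter> {\<alpha>. \<forall>i\<ge>2. \<alpha> i = 0}" by auto
  have sub: "subspace {\<alpha> :: ('a, 'n) gfield. \<forall>i\<ge>2. \<alpha> i = 0}"
    by (rule subspaceI) (auto simp: scaleR_fun_def fun_eq_iff)
  show ?thesis
    unfolding iota_image eq by (rule subspace_inter [OF subspace_H_hat sub])
qed

lemma subspace_H_hat_ge: "subspace (H_hat_ge A k)"
proof -
  have eq: "H_hat_ge A k = H_hat A \<inter> {\<alpha>. \<forall>i<k. \<alpha> i = 0}" by (auto simp: H_hat_ge_def)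
  have sub: "subspace {\<alpha> :: ('a, 'n) gfield. \<forall>i<k. \<alpha> i = 0}"
    by (rule subspaceI) (auto simp: scaleR_fun_def fun_eq_iff)
  show ?thesis
    unfolding eq by (rule subspace_inter [OF subspace_H_hat sub])
qed

lemma H_hat_ge_kernel: "H_hat_ge A 2 = {\<alpha> \<in> H_hat A. proj_fun A \<alpha> = 0}"
proof
  show "H_hat_ge A 2 \<subseteq> {\<alpha> \<in> H_hat A. proj_fun A \<alpha> = 0}"
    by (auto simp: H_hat_ge_def proj_fun_def)
  show "{\<alpha> \<in> H_hat A. proj_fun A \<alpha> = 0} \<subseteq> H_hat_ge A 2"
  proof
    fix \<alpha> assume *: "\<alpha> \<in> {\<alpha> \<in> H_hat A. proj_fun A \<alpha> = 0}"
    have "iota A 0 i = 0" if "i < 2" for i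
    proof -
      have "i = 0 \<or> i = 1" using that by auto
      then show ?thesis by (auto simp: iota_0 iota_1 simp del: One_nat_def)
    qed
    with * show "\<alpha> \<in> H_hat_ge A 2"
      using iota_proj_low_degree [of \<alpha>] by (auto simp: H_hat_ge_def)
  qed
qed

lemma H_hat_ge_S_hat_ge:
  assumes "k \<ge> 2"
  shows "H_hat_ge A k = S_hat_ge A k"
  using assms by (auto simp: H_hat_ge_def S_hat_ge_def H_hat_dform)

lemma H_hat_decomposition:
  "H_hat A = {x + y |x y. x \<in> iota A ` Cinf A \<and> y \<in> H_hat_ge A 2}"
proof
  show "H_hat A \<subseteq> {x + y |x y. x \<in> iota A ` Cinf A \<and> y \<in> H_hat_ge A 2}"
  proof
    fix \<alpha> assume \<alpha>: "\<alpha> \<in> H_hat A"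
    let ?x = "iota A (proj_fun A \<alpha>)"
    have x: "?x \<in> iota A ` Cinf A" using proj_fun_Cinf [OF \<alpha>] by blast
    have "\<alpha> - ?x \<in> H_hat A"
      by (rule subspace_diff [OF subspace_H_hat \<alpha> iota_H_hat [OF proj_fun_Cinf [OF \<alpha>]]])
    then have "\<alpha> - ?x \<in> H_hat_ge A 2"
      using iota_proj_low_degree [OF \<alpha>] by (simp add: H_hat_ge_def)
    moreover have "\<alpha> = ?x + (\<alpha> - ?x)" by simp
    ultimately show "\<alpha> \<in> {x + y |x y. x \<in> iota A ` Cinf A \<and> y \<in> H_hat_ge A 2}"
      using x by blast
  qed
  show "{x + y |x y. x \<in> iota A ` Cinf A \<and> y \<in> H_hat_ge A 2} \<subseteq> H_hat A"
    using subspace_add [OF subspace_H_hat] by (auto simp: iota_image H_hat_ge_def)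
qed

lemma iota_image_Int_H_hat_ge: "iota A ` Cinf A \<inter> H_hat_ge A 2 = {0}"
proof -
  have "\<alpha> = 0" if "\<alpha> \<in> iota A ` Cinf A" "\<alpha> \<in> H_hat_ge A 2" for \<alpha>
  proof
    fix i
    show "\<alpha> i = 0 i"
      using that by (cases "i < 2") (auto simp: iota_image H_hat_ge_def)
  qed
  then show ?thesis
    using subspace_0 [OF subspace_iota_image] subspace_0 [OF subspace_H_hat_ge] by blast
qed

lemma hat_prod_low_degree:
  assumes "\<And>i. i < k \<Longrightarrow> \<alpha> i = 0" "\<And>i. i < l \<Longrightarrow> \<beta> i = 0" "n < k + l"
  shows "hat_prod \<alpha> \<beta> n = 0"
proof -
  have "sym_prod j (n - j) (\<alpha> j) (\<beta> (n - j)) = 0" if "j \<le> n" for j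
    using assms that by (cases "j < k") auto
  then show ?thesis by (simp add: hat_prod_eq)
qed

lemma hat_prod_H_hat_ge:
  assumes "\<alpha> \<in> H_hat_ge A k" "\<beta> \<in> H_hat_ge A l"
  shows "hat_prod \<alpha> \<beta> \<in> H_hat_ge A (k + l)"
  using assms hat_prod_H_hat hat_prod_low_degree [of k \<alpha> l \<beta>] by (simp add: H_hat_ge_def)

lemma proj_fun_hat_prod:
  "proj_fun A (hat_prod \<alpha> \<beta>) = - (proj_fun A \<alpha> * proj_fun A \<beta>)"
  by (simp add: fun_eq_iff proj_fun_def to_fun_def hat_prod_0)

end

context symplectic
begin

text \<open>With \<open>V\<close> the matrix \<open>\<Omega>\<^sup>r\<^sup>q\<close> and \<open>a, b\<close> the one-forms \<open>\<alpha>\<^sub>1, \<beta>\<^sub>1\<close> at \<open>p\<close>, the Hamiltonian fields of \<open>-\<alpha>\<^sub>0\<close> and \<open>-\<beta>\<^sub>0\<close> are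
\<open>V a\<close> and \<open>V b\<close>: the two signs, from \<open>proj_fun\<close> and from the order of the indices in \<open>ham\<close>, cancel. Then
\<open>\<Omega>(V a, V b) = - (V a) \<bullet> b = a \<bullet> V b\<close>.\<close>

lemma proj_fun_hat_bracket:
  assumes \<alpha>: "\<alpha> \<in> H_hat A" and \<beta>: "\<beta> \<in> H_hat A"
  shows "proj_fun A (hat_bracket \<Omega> \<Gamma> \<alpha> \<beta>) = poisson_bracket A \<Omega> (proj_fun A \<alpha>) (proj_fun A \<beta>)"
proof
  fix p
  show "proj_fun A (hat_bracket \<Omega> \<Gamma> \<alpha> \<beta>) p = poisson_bracket A \<Omega> (proj_fun A \<alpha>) (proj_fun A \<beta>) p"
  proof (cases "p \<in> \<Union> (fst ` A)")
    case False
    then show ?thesis by (simp add: proj_fun_def poisson_bracket_def to_fun_def)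
  next
    case True
    define c where "c = chart_at A p"
    have c: "c \<in> A" and p: "p \<in> fst c" using chart_at [OF True] by (auto simp: c_def)
    define V where "V = Wm c p"
    have V: "transpose V = - V" using c p by (simp add: V_def transpose_Wm)
    have ham: "(\<chi> i. ham \<Omega> (proj_fun A \<gamma>) c p i) = V *v (\<chi> r. \<gamma> 1 c p [r])" if "\<gamma> \<in> H_hat A" for \<gamma>
    proof -
      have t: "\<gamma> 0 \<in> tensor_fields A 0" using that by (intro S_hat_tensor H_hat_S_hat)
      have d: "pd c r (proj_fun A \<gamma>) p = - \<gamma> 1 c p [r]" for r
        using pd_minus [OF smooth_in_diff_in [OF c Cinf_smooth [OF to_fun_Cinf [OF t] c] p]]
          pd_to_fun [OF t c p] H_hat_pd [OF that c p]
        by (simp add: proj_fun_def fun_Compl_def)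
      have "W c p r i * - \<gamma> 1 c p [r] = W c p i r * \<gamma> 1 c p [r]" for r i
        by (subst W_antisym [OF c p]) simp
      then show ?thesis
        by (simp add: ham_def d matrix_vector_mult_def V_def omega_up_matrix_def del: One_nat_def)
    qed
    let ?a = "\<chi> r. \<alpha> 1 c p [r]" and ?b = "\<chi> r. \<beta> 1 c p [r]" and ?O = "form_matrix \<Omega> c p"
    have "poisson_bracket A \<Omega> (proj_fun A \<alpha>) (proj_fun A \<beta>) p
        = (\<chi> i. ham \<Omega> (proj_fun A \<alpha>) c p i) \<bullet> (?O *v (\<chi> i. ham \<Omega> (proj_fun A \<beta>) c p i))"
      using True by (simp add: poisson_bracket_def to_fun_def c_def [symmetric] inner_vec_def
          matrix_vector_mult_def form_matrix_def sum_distrib_left mult_ac)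
    also have "\<dots> = (V *v ?a) \<bullet> ((?O ** V) *v ?b)"
      by (simp add: ham \<alpha> \<beta> matrix_vector_mul_assoc)
    also have "\<dots> = - ((V *v ?a) \<bullet> ?b)"
      using Wm_inverse(2) [OF c p] by (simp add: V_def minus_matrix_vector_mult)
    also have "\<dots> = ?a \<bullet> (V *v ?b)"
      using inner_antisym_matrix [OF V, of ?a ?b] by (simp add: inner_commute)
    also have "\<dots> = proj_fun A (hat_bracket \<Omega> \<Gamma> \<alpha> \<beta>) p"
      using True hat_bracket_0_eq [OF \<alpha> \<beta> c p]
      by (simp add: proj_fun_def to_fun_def c_def [symmetric] V_def sum_inner_Wm [symmetric] del: One_nat_def)
    finally show ?thesis by simp
  qed
qed

text \<open>In degree \<open>n \<ge> 2\<close> a summand of the bracket would need two degrees with sum at least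
\<open>n + 1 \<ge> 3\<close>, but only 0 and 1 occur.\<close>

lemma hat_bracket_iota_image:
  assumes "\<alpha> \<in> iota A ` Cinf A" "\<beta> \<in> iota A ` Cinf A"
  shows "hat_bracket \<Omega> \<Gamma> \<alpha> \<beta> \<in> iota A ` Cinf A"
proof -
  have H: "\<alpha> \<in> H_hat A" "\<beta> \<in> H_hat A" and ge: "\<And>i. i \<ge> 2 \<Longrightarrow> \<alpha> i = 0" "\<And>i. i \<ge> 2 \<Longrightarrow> \<beta> i = 0"
    using assms by (auto simp: iota_image)
  have "hat_bracket \<Omega> \<Gamma> \<alpha> \<beta> n = 0" if n: "n \<ge> 2" for n
  proof -
    have "alg_bracket \<Omega> j (n + 2 - j) (\<alpha> j) (\<beta> (n + 2 - j)) = 0" if "j \<le> n + 2" for j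
      using ge n that by (cases "j \<ge> 2") auto
    moreover have "schouten_bracket \<Omega> \<Gamma> j (n + 1 - j) (\<alpha> j) (\<beta> (n + 1 - j)) = 0" if "j \<le> n + 1" for j
      using ge n that by (cases "j \<ge> 2") auto
    ultimately show ?thesis
      by (simp add: hat_bracket_def hat_alg_eq hat_schouten_eq)
  qed
  then show ?thesis
    using hat_bracket_H_hat [OF H] by (simp add: iota_image)
qed

lemma lie_hom_proj_fun:
  "lie_hom (H_hat A) (hat_bracket \<Omega> \<Gamma>) (Cinf A) (poisson_bracket A \<Omega>) (proj_fun A)"
  unfolding lie_hom_def
  using proj_fun_Cinf proj_fun_add proj_fun_scaleR proj_fun_hat_bracket by blast

text \<open>The image of \<open>iota\<close> is closed under all operations and \<open>proj_fun\<close> is injective on it, so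
\<open>iota\<close> inherits the homomorphism property from \<open>proj_fun\<close>.\<close>

lemma lie_hom_iota:
  "lie_hom (Cinf A) (poisson_bracket A \<Omega>) (H_hat A) (hat_bracket \<Omega> \<Gamma>) (iota A)"
  unfolding lie_hom_def
proof (intro conjI ballI allI)
  show "iota A ` Cinf A \<subseteq> H_hat A"
    by (auto simp: iota_image)
  fix f g assume f: "f \<in> Cinf A" and g: "g \<in> Cinf A"
  have "iota A f + iota A g \<in> iota A ` Cinf A"
    using f g subspace_add [OF subspace_iota_image] by blast
  from iota_proj [OF this] show "iota A (f + g) = iota A f + iota A g"
    by (simp add: proj_fun_add proj_iota f g)
  have "hat_bracket \<Omega> \<Gamma> (iota A f) (iota A g) \<in> iota A ` Cinf A"
    using f g hat_bracket_iota_image by blast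
  from iota_proj [OF this] show "iota A (poisson_bracket A \<Omega> f g) = hat_bracket \<Omega> \<Gamma> (iota A f) (iota A g)"
    by (simp add: proj_fun_hat_bracket iota_H_hat proj_iota f g)
next
  fix r f assume f: "f \<in> Cinf A"
  have "r *\<^sub>R iota A f \<in> iota A ` Cinf A"
    using f subspace_scale [OF subspace_iota_image] by blast
  from iota_proj [OF this] show "iota A (r *\<^sub>R f) = r *\<^sub>R iota A f"
    by (simp add: proj_fun_scaleR proj_iota f)
qed

lemma poisson_subalgebra_H_hat:
  "poisson_subalgebra (S_hat A) (hat_bracket \<Omega> \<Gamma>) hat_prod (H_hat A)"
  unfolding poisson_subalgebra_def lie_subalgebra_def
  using subspace_H_hat H_hat_S_hat hat_bracket_H_hat hat_prod_H_hat by blast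

lemma lie_ideal_H_hat_ge: "lie_ideal (H_hat A) (hat_bracket \<Omega> \<Gamma>) (H_hat_ge A k)"
  unfolding lie_ideal_def
  using subspace_H_hat_ge hat_bracket_ideal_right hat_bracket_ideal_left by (auto simp: H_hat_ge_def)

lemma poisson_ideal_H_hat_ge: "poisson_ideal (H_hat A) (hat_bracket \<Omega> \<Gamma>) hat_prod (H_hat_ge A k)"
proof -
  have "H_hat A = H_hat_ge A 0" by (simp add: H_hat_ge_def)
  then show ?thesis
    unfolding poisson_ideal_def
    using lie_ideal_H_hat_ge hat_prod_H_hat_ge [of _ 0 _ k] hat_prod_H_hat_ge [of _ k _ 0] by simp
qed

lemma short_exact_H_hat: "short_exact (H_hat_ge A 2) (\<lambda>\<alpha>. \<alpha>) (H_hat A) (proj_fun A) (Cinf A)"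
proof -
  have "proj_fun A ` H_hat A = Cinf A"
  proof
    show "proj_fun A ` H_hat A \<subseteq> Cinf A"
      using proj_fun_Cinf by blast
    show "Cinf A \<subseteq> proj_fun A ` H_hat A"
    proof
      fix f assume f: "f \<in> Cinf A"
      show "f \<in> proj_fun A ` H_hat A"
        by (rule image_eqI [where x = "iota A f"]) (simp_all add: proj_iota iota_H_hat f)
    qed
  qed
  then show ?thesis
    by (auto simp: short_exact_def H_hat_ge_kernel)
qed

lemma lie_semidirect_H_hat:
  "lie_semidirect (H_hat A) (hat_bracket \<Omega> \<Gamma>) (iota A ` Cinf A) (H_hat_ge A 2)"
proof -
  have "lie_subalgebra (H_hat A) (hat_bracket \<Omega> \<Gamma>) (iota A ` Cinf A)"
    unfolding lie_subalgebra_def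
    using subspace_iota_image hat_bracket_iota_image iota_H_hat by blast
  then show ?thesis
    unfolding lie_semidirect_def
    using lie_ideal_H_hat_ge iota_image_Int_H_hat_ge H_hat_decomposition by blast
qed

end

theorem lemma3p7:
  fixes M :: "'a topology"
    and A :: "('a, 'n::finite) chart set"
    and \<Omega> :: "('a, 'n) tfield"
    and \<Gamma> :: "('a, 'n) christoffel"
  assumes "symplectic_manifold M A \<Omega>"
    and "symplectic_connection A \<Omega> \<Gamma>"
  shows "(poisson_subalgebra (S_hat A) (hat_bracket \<Omega> \<Gamma>) hat_prod (H_hat A)) \<and>
    (\<forall>k\<ge>2. H_hat_ge A k = S_hat_ge A k) \<and>
    (\<forall>k l. l \<ge> 2 \<longrightarrow> (\<forall>\<alpha>\<in>H_hat_ge A k. \<forall>\<beta>\<in>H_hat_ge A l.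
        hat_bracket \<Omega> \<Gamma> \<alpha> \<beta> \<in> H_hat_ge A (k + l - 2))) \<and>
    (\<forall>k\<ge>2. poisson_ideal (H_hat A) (hat_bracket \<Omega> \<Gamma>) hat_prod (H_hat_ge A k)) \<and>
    (lie_hom (H_hat A) (hat_bracket \<Omega> \<Gamma>) (Cinf A) (poisson_bracket A \<Omega>) (proj_fun A)) \<and>
    (\<forall>\<alpha>\<in>H_hat A. \<forall>\<beta>\<in>H_hat A. proj_fun A (hat_prod \<alpha> \<beta>) = - (proj_fun A \<alpha> * proj_fun A \<beta>)) \<and>
    (short_exact (H_hat_ge A 2) (\<lambda>\<alpha>. \<alpha>) (H_hat A) (proj_fun A) (Cinf A)) \<and>
    (lie_hom (Cinf A) (poisson_bracket A \<Omega>) (H_hat A) (hat_bracket \<Omega> \<Gamma>) (iota A)) \<and>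
    (inj_on (iota A) (Cinf A)) \<and>
    (\<forall>f\<in>Cinf A. proj_fun A (iota A f) = f) \<and>
    (iota A ` Cinf A =
        {\<alpha> \<in> S_hat A. \<alpha> 1 = - delta_star A (to_fun A (\<alpha> 0)) \<and> (\<forall>i\<ge>2. \<alpha> i = 0)}) \<and>
    (lie_semidirect (H_hat A) (hat_bracket \<Omega> \<Gamma>) (iota A ` Cinf A) (H_hat_ge A 2))"
proof -
  interpret symplectic M A \<Omega> \<Gamma>
  proof unfold_locales
    show "smooth_manifold M A"
      using assms(1) unfolding symplectic_manifold_def by (rule conjunct1)
  qed (fact assms)+
  have inj: "inj_on (iota A) (Cinf A)"
    by (rule inj_on_inverseI [of _ "proj_fun A"]) (rule proj_iota)
  have image: "iota A ` Cinf A =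
      {\<alpha> \<in> S_hat A. \<alpha> 1 = - delta_star A (to_fun A (\<alpha> 0)) \<and> (\<forall>i\<ge>2. \<alpha> i = 0)}"
    unfolding iota_image H_hat_def by blast
  show ?thesis
  proof (intro conjI)
    show "\<forall>k\<ge>2. H_hat_ge A k = S_hat_ge A k"
      using H_hat_ge_S_hat_ge by blast
    show "\<forall>k l. l \<ge> 2 \<longrightarrow> (\<forall>\<alpha>\<in>H_hat_ge A k. \<forall>\<beta>\<in>H_hat_ge A l.
        hat_bracket \<Omega> \<Gamma> \<alpha> \<beta> \<in> H_hat_ge A (k + l - 2))"
      using hat_bracket_H_hat_ge by blast
    show "\<forall>k\<ge>2. poisson_ideal (H_hat A) (hat_bracket \<Omega> \<Gamma>) hat_prod (H_hat_ge A k)"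
      using poisson_ideal_H_hat_ge by blast
    show "\<forall>\<alpha>\<in>H_hat A. \<forall>\<beta>\<in>H_hat A.
        proj_fun A (hat_prod \<alpha> \<beta>) = - (proj_fun A \<alpha> * proj_fun A \<beta>)"
      using proj_fun_hat_prod by blast
    show "\<forall>f\<in>Cinf A. proj_fun A (iota A f) = f"
      using proj_iota by blast
  qed (rule poisson_subalgebra_H_hat lie_hom_proj_fun short_exact_H_hat lie_hom_iota inj image
      lie_semidirect_H_hat)+
qed

end
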